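(* Let $M \subseteq \mathbb{R}^d$ be a compact smooth $n$-dimensional submanifold (with $n<d$) and let $dA$ be its surface measure. For $\operatorname{Re} s > 4$ define $$B_{M_\circ}(s) = \int_M \int_M \Delta_{\circ_u} \Delta_{\circ_v} N_s(v-u)\, dA(v)\, dA(u),$$ where $N_s(x) = \|x\|^s$ and $\Delta_{\circ_u}$, $\Delta_{\circ_v}$ are the coaxial derivatives at $u$ and $v$ (acting in the variables $u$ and $v$ respectively). Then $B_{M_\circ}$ admits an analytic continuation to the whole complex plane as a meromorphic function with only simple poles at $-n-j$, $j=-4,-2,0,2,4,\dots$.
   Context: For $u \in M$, let $\nu_u = (T_uM)^\perp$ be the normal space to $M$ at $u$ and $\Sigma_r$ the sphere of radius $r$ centered at $0$ in $\nu_u$, with surface measure $d\sigma$; let $\omega_{d-n-1}$ be the surface measure of the unit sphere in $\nu_u\cong\mathbb{R}^{d-n}$. For $\varphi$ of class $C^2$ near $u$, the coaxial derivative of $\varphi$ at $u$ is $$\Delta_{\circ_u}\varphi = 2(d-n)\lim_{r\to 0}\frac{\frac{1}{\omega_{d-n-1}r^{d-n-1}}\int_{\Sigma_r}\varphi(u+\sigma)\,d\sigma - \varphi(u)}{r^2},$$ equivalently $\Delta_{\circ_u}\varphi = (X_1^2+\cdots+X_{d-n}^2)\varphi(u)$ where $X_1,\dots,X_{d-n}$ is any orthonormal basis of $\nu_u$ regarded as constant vector fields on $\mathbb{R}^d$. The function $B_{M_\circ}$ is the Brylinski beta function $s\mapsto T_\circ(N_s * T_\circ)$ of the coaxial layer,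 i.e. of the distribution $T_\circ\varphi = \int_M \Delta_{\circ_u}\varphi\, dA(u)$. *)

theory Defs
  imports "HOL-Analysis.Analysis" "HOL-Complex_Analysis.Complex_Analysis"
begin

definition dderiv :: "('a::real_normed_vector \<Rightarrow> 'b::real_normed_vector) \<Rightarrow> 'a \<Rightarrow> 'a \<Rightarrow> 'b" where
  "dderiv f v x = vector_derivative (\<lambda>t::real. f (x + t *\<^sub>R v)) (at 0)"

fun iter_dderiv :: "'a::real_normed_vector list \<Rightarrow> ('a \<Rightarrow> 'b::real_normed_vector) \<Rightarrow> 'a \<Rightarrow> 'b" where
  "iter_dderiv [] f = f"
| "iter_dderiv (v # vs) f = dderiv (iter_dderiv vs f) v"

text \<open>C-infinity on an open set U: all iterated directional derivatives exist on U and are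
  continuous on U (equivalent to the usual notion on finite-dimensional spaces).\<close>
definition smooth_on :: "'a::euclidean_space set \<Rightarrow> ('a \<Rightarrow> 'b::real_normed_vector) \<Rightarrow> bool" where
  "smooth_on U f \<longleftrightarrow>
     (\<forall>vs. continuous_on U (iter_dderiv vs f) \<and>
        (\<forall>v. \<forall>x\<in>U. (\<lambda>t::real. iter_dderiv vs f (x + t *\<^sub>R v)) differentiable (at 0)))"

definition local_param :: "'a::euclidean_space set \<Rightarrow> 'n::euclidean_space set \<Rightarrow> ('n \<Rightarrow> 'a) \<Rightarrow> bool" where
  "local_param M V \<phi> \<longleftrightarrow>
     open V \<and> smooth_on V \<phi> \<and> inj_on \<phi> V \<and>
     (\<forall>x\<in>V. independent ((\<lambda>b. dderiv \<phi> b x) ` Basis) \<and>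
        inj_on (\<lambda>b. dderiv \<phi> b x) Basis) \<and>
     (\<exists>U. open U \<and> \<phi> ` V = M \<inter> U) \<and>
     continuous_on (\<phi> ` V) (inv_into V \<phi>)"

definition smooth_submanifold :: "'n::euclidean_space itself \<Rightarrow> 'a::euclidean_space set \<Rightarrow> bool" where
  "smooth_submanifold (_::'n itself) M \<longleftrightarrow>
     (\<forall>p\<in>M. \<exists>V (\<phi>::'n \<Rightarrow> 'a). local_param M V \<phi> \<and> p \<in> \<phi> ` V)"

text \<open>Gram determinant det(D\<phi>(x)^T D\<phi>(x)), via the Leibniz formula over the basis of 'n.\<close>
definition gram_det :: "('n::euclidean_space \<Rightarrow> 'a::euclidean_space) \<Rightarrow> 'n \<Rightarrow> real" where
  "gram_det \<phi> x =
     (\<Sum>p | p permutes (Basis::'n set). of_int (sign p) *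
        (\<Prod>b\<in>Basis. dderiv \<phi> b x \<bullet> dderiv \<phi> (p b) x))"

definition surface_measure :: "'n::euclidean_space itself \<Rightarrow> 'a::euclidean_space set \<Rightarrow> 'a measure" where
  "surface_measure (_::'n itself) M =
     (THE \<mu>. sets \<mu> = sets (borel :: 'a measure) \<and> emeasure \<mu> (UNIV - M) = 0 \<and>
        (\<forall>V (\<phi>::'n \<Rightarrow> 'a) E. local_param M V \<phi> \<longrightarrow> E \<in> sets lborel \<longrightarrow> E \<subseteq> V \<longrightarrow>
           emeasure \<mu> (\<phi> ` E) = (\<integral>\<^sup>+ x \<in> E. ennreal (sqrt (gram_det \<phi> x)) \<partial>lborel)))"

definition tangent_space :: "'a::euclidean_space set \<Rightarrow> 'a \<Rightarrow> 'a set" where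
  "tangent_space M u =
     {vector_derivative \<gamma> (at 0) | \<gamma>::real \<Rightarrow> 'a.
        \<gamma> 0 = u \<and> \<gamma> differentiable (at 0) \<and> (\<exists>e>0. \<forall>t. \<bar>t\<bar> < e \<longrightarrow> \<gamma> t \<in> M)}"

definition normal_space :: "'a::euclidean_space set \<Rightarrow> 'a \<Rightarrow> 'a set" where
  "normal_space M u = {w. \<forall>v\<in>tangent_space M u. w \<bullet> v = 0}"

definition coaxial_deriv :: "'a::euclidean_space set \<Rightarrow> 'a \<Rightarrow> ('a \<Rightarrow> complex) \<Rightarrow> complex" where
  "coaxial_deriv M u \<phi> =
     (let B = (SOME B. B \<subseteq> normal_space M u \<and> pairwise orthogonal B \<and> (\<forall>b\<in>B. norm b = 1)
                     \<and> span B = normal_space M u)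
      in \<Sum>b\<in>B. dderiv (dderiv \<phi> b) b u)"

definition Nfun :: "complex \<Rightarrow> 'a::real_normed_vector \<Rightarrow> complex" where
  "Nfun s x = complex_of_real (norm x) powr s"

definition coaxial_beta :: "'n::euclidean_space itself \<Rightarrow> 'a::euclidean_space set \<Rightarrow> complex \<Rightarrow> complex" where
  "coaxial_beta n M s =
     (\<integral>u. (\<integral>v. coaxial_deriv M u (\<lambda>w. coaxial_deriv M v (\<lambda>z. Nfun s (z - w)))
           \<partial>surface_measure n M) \<partial>surface_measure n M)"

end

theory Submission
  imports Defs
begin

text \<open>
  Off the diagonal \<open>\<Delta>\<^sub>u \<Delta>\<^sub>v \<parallel>v - u\<parallel>\<^sup>s\<close> is an explicit combination of terms that are
  homogeneous of degree \<open>s - 4\<close> in \<open>v - u\<close> and smooth in the normal projections at \<open>u\<close> and \<open>v\<close>, so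
  the part of the integral with \<open>\<parallel>v - u\<parallel>\<close> bounded below is entire in \<open>s\<close>. Near the diagonal put
  \<open>u = \<phi> x\<close> and \<open>v = \<phi> (x + \<rho> k)\<close> in a chart \<open>\<phi>\<close>, with \<open>k\<close> in a fixed annulus. Then \<open>v - u = \<rho> Y\<close> with
  \<open>Y\<close> nowhere zero and smooth in \<open>\<rho>\<close> across \<open>\<rho> = 0\<close>, and the contribution becomes the integral of
  \<open>\<rho> powr (s + n - 5) * H s \<rho>\<close> over \<open>0 < \<rho> \<le> R\<close>, where \<open>H\<close> is entire in \<open>s\<close>, smooth in \<open>\<rho>\<close> and, by the
  symmetry \<open>(\<rho>, k) \<mapsto> (-\<rho>, -k)\<close>, even in \<open>\<rho>\<close>. Integration by parts replaces \<open>H\<close> by the even function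
  \<open>H' / \<rho>\<close> and raises the exponent by two at the price of one simple pole; iterating continues the
  integral to the whole plane. The cut-offs are nowhere differentiated in \<open>\<rho>\<close>, hence Borel pieces of
  \<open>M\<close> can be used instead of a smooth partition of unity.
\<close>

section \<open>Functions smooth in one real variable with continuous parameters\<close>

text \<open>The coaxial derivatives use orthonormal bases picked by \<open>SOME\<close>, which may
  vary erratically with the point; only the orthogonal projections onto the normal spaces survive in
  the kernel, and Cramer's rule makes these smooth in a chart. Likewise the surface measure is
  picked by \<open>THE\<close>, so existence and uniqueness precede every computation with it.

  The blow-up is even because the reflection fixes both \<open>x\<close> and
  \<open>x + \<rho> k\<close>: the pair of points is the same, only \<open>Y\<close> changes sign,
  and the kernel is even in \<open>Y\<close>.

  The exponent counts degrees: two operators of second order lower \<open>s\<close> to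
  \<open>s - 4\<close>, a dilated annulus has volume of order \<open>\<rho> ^ n\<close>, and the
  average over radii brings \<open>1 / \<rho>\<close>. Hence the first pole \<open>4 - n\<close>,
  that is \<open>j = -4\<close>. The sharp end of the radial range at \<open>R\<close> contributes
  only an entire boundary term to each integration by parts. On the diagonal itself, a null set, the
  integrand may be changed freely.\<close>

text \<open>The derivatives are two-sided, so \<open>J\<close> is meant to be open.\<close>

primrec ck :: "nat \<Rightarrow> 'q::topological_space set \<Rightarrow> real set \<Rightarrow> ('q \<Rightarrow> real \<Rightarrow> 'b::real_normed_vector) \<Rightarrow> bool" where
  "ck 0 Q J f \<longleftrightarrow> continuous_on (Q \<times> J) (\<lambda>(q,r). f q r)"
| "ck (Suc n) Q J f \<longleftrightarrow> continuous_on (Q \<times> J) (\<lambda>(q,r). f q r) \<and>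
     (\<exists>f'. (\<forall>q\<in>Q. \<forall>r\<in>J. (f q has_vector_derivative f' q r) (at r)) \<and> ck n Q J f')"

lemma ck_continuous: "ck n Q J f \<Longrightarrow> continuous_on (Q \<times> J) (\<lambda>(q,r). f q r)"
  by (cases n) auto

lemma ck_SucI:
  assumes "\<And>q r. q \<in> Q \<Longrightarrow> r \<in> J \<Longrightarrow> (f q has_vector_derivative f' q r) (at r)" "ck n Q J f'"
    "continuous_on (Q \<times> J) (\<lambda>(q,r). f q r)"
  shows "ck (Suc n) Q J f"
  using assms by auto

lemma ck_SucE:
  assumes "ck (Suc n) Q J f"
  obtains f' where "\<And>q r. q \<in> Q \<Longrightarrow> r \<in> J \<Longrightarrow> (f q has_vector_derivative f' q r) (at r)" "ck n Q J f'"
  using assms by auto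

lemma ck_SucD: "ck (Suc n) Q J f \<Longrightarrow> ck n Q J f"
proof (induction n arbitrary: f)
  case (Suc n)
  then obtain f' where "\<And>q r. q \<in> Q \<Longrightarrow> r \<in> J \<Longrightarrow> (f q has_vector_derivative f' q r) (at r)" "ck (Suc n) Q J f'"
    using ck_SucE[OF Suc.prems] by metis
  with Suc.IH ck_continuous[OF Suc.prems] show ?case by (intro ck_SucI[of Q J f f' n])
qed auto

lemma ck_const:
  assumes "continuous_on Q g"
  shows "ck n Q J (\<lambda>q r. g q)"
  using assms
proof (induction n arbitrary: g)
  case 0
  have "continuous_on (Q \<times> J) (\<lambda>x. g (fst x))"
    by (rule continuous_on_compose2[OF 0]) (auto intro: continuous_on_fst)
  then show ?case by (simp add: split_def)
next
  case (Suc n)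
  have "continuous_on (Q \<times> J) (\<lambda>x. g (fst x))"
    by (rule continuous_on_compose2[OF Suc.prems]) (auto intro: continuous_on_fst)
  with Suc.IH[of "\<lambda>_. 0"] show ?case
    by (intro ck_SucI[where f'="\<lambda>q r. 0"]) (auto simp: split_def)
qed

text \<open>Two-sided derivatives are local, so agreement on the open set \<open>J\<close> alone
  lets them pass from \<open>f\<close> to \<open>g\<close>.\<close>

lemma ck_cong:
  assumes "open J" "\<And>q r. q \<in> Q \<Longrightarrow> r \<in> J \<Longrightarrow> f q r = g q r" "ck n Q J f"
  shows "ck n Q J g"
proof -
  have c: "continuous_on (Q \<times> J) (\<lambda>(q, r). g q r)"
    using ck_continuous[OF assms(3)] by (rule continuous_on_eq) (use assms(2) in auto)
  show ?thesis
  proof (cases n)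
    case 0 with c show ?thesis by simp
  next
    case (Suc m)
    with assms(3) obtain f' where f': "\<And>q r. q \<in> Q \<Longrightarrow> r \<in> J \<Longrightarrow> (f q has_vector_derivative f' q r) (at r)" "ck m Q J f'"
      using ck_SucE[of m Q J f] by blast
    have "(g q has_vector_derivative f' q r) (at r)" if "q \<in> Q" "r \<in> J" for q r
      using f'(1)[OF that] assms(1) that(2) assms(2)[OF that(1)]
      by (rule has_vector_derivative_transform_within_open)
    with f' c Suc show ?thesis by (auto intro!: ck_SucI simp del: ck.simps)
  qed
qed

lemma ck_param:
  fixes f :: "'q::topological_space \<Rightarrow> real \<Rightarrow> 'b::real_normed_vector" and g :: "'p::topological_space \<Rightarrow> 'q"
  assumes "ck n Q J f" "continuous_on Q' g" "\<And>q. q \<in> Q' \<Longrightarrow> g q \<in> Q"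
  shows "ck n Q' J (\<lambda>q. f (g q))"
proof -
  have c: "continuous_on (Q' \<times> J) (\<lambda>(q, r). f (g q) r)"
    if "continuous_on (Q \<times> J) (\<lambda>(q,r). f q r)" for f :: "'q \<Rightarrow> real \<Rightarrow> 'b"
  proof -
    have "continuous_on (Q' \<times> J) (\<lambda>x. (g (fst x), snd x))"
      by (intro continuous_on_Pair continuous_on_compose2[OF assms(2)] continuous_intros) auto
    from continuous_on_compose2[OF that this] assms(3) show ?thesis by (auto simp: split_def image_subset_iff)
  qed
  show ?thesis using assms(1)
  proof (induction n arbitrary: f)
    case 0 then show ?case using c by simp
  next
    case (Suc n)
    from Suc.prems obtain f' where f': "\<And>q r. q \<in> Q \<Longrightarrow> r \<in> J \<Longrightarrow> (f q has_vector_derivative f' q r) (at r)" "ck n Q J f'"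
      by (metis ck_SucE)
    show ?case
      by (rule ck_SucI[where f'="\<lambda>q. f' (g q)"])
        (use f' Suc.IH assms(3) c[OF ck_continuous[OF Suc.prems]] in auto)
  qed
qed

lemma ck_add:
  "ck n Q J f \<Longrightarrow> ck n Q J g \<Longrightarrow> ck n Q J (\<lambda>q r. f q r + g q r)"
proof (induction n arbitrary: f g)
  case 0 then show ?case by (auto simp: split_def intro!: continuous_intros)
next
  case (Suc n)
  from Suc.prems obtain f' g' where "\<And>q r. q \<in> Q \<Longrightarrow> r \<in> J \<Longrightarrow> (f q has_vector_derivative f' q r) (at r)" "ck n Q J f'"
    "\<And>q r. q \<in> Q \<Longrightarrow> r \<in> J \<Longrightarrow> (g q has_vector_derivative g' q r) (at r)" "ck n Q J g'"
    by (metis ck_SucE)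
  moreover have "continuous_on (Q \<times> J) (\<lambda>(q, r). f q r + g q r)"
    using ck_continuous[OF Suc.prems(1)] ck_continuous[OF Suc.prems(2)]
    by (auto simp: split_def intro!: continuous_intros)
  ultimately show ?case
    by (intro ck_SucI[where f'="\<lambda>q r. f' q r + g' q r"] Suc.IH) (auto intro!: derivative_intros)
qed

lemma ck_bilinear:
  assumes B: "bounded_bilinear B"
  shows "ck n Q J f \<Longrightarrow> ck n Q J g \<Longrightarrow> ck n Q J (\<lambda>q r. B (f q r) (g q r))"
proof (induction n arbitrary: f g)
  case 0 then show ?case using bounded_bilinear.continuous_on[OF B] by (auto simp: split_def)
next
  case (Suc n)
  from Suc.prems obtain f' g' where d: "\<And>q r. q \<in> Q \<Longrightarrow> r \<in> J \<Longrightarrow> (f q has_vector_derivative f' q r) (at r)" "ck n Q J f'"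
    "\<And>q r. q \<in> Q \<Longrightarrow> r \<in> J \<Longrightarrow> (g q has_vector_derivative g' q r) (at r)" "ck n Q J g'"
    by (metis ck_SucE)
  have "continuous_on (Q \<times> J) (\<lambda>(q, r). B (f q r) (g q r))"
    using ck_continuous[OF Suc.prems(1)] ck_continuous[OF Suc.prems(2)]
      bounded_bilinear.continuous_on[OF B] by (auto simp: split_def)
  with d Suc.prems show ?case
    by (intro ck_SucI[where f'="\<lambda>q r. B (f q r) (g' q r) + B (f' q r) (g q r)"] ck_add Suc.IH)
      (auto intro!: bounded_bilinear.has_vector_derivative[OF B] dest: ck_SucD simp del: ck.simps)
qed

lemmas ck_mult = ck_bilinear[OF bounded_bilinear_mult]
lemmas ck_scaleR = ck_bilinear[OF bounded_bilinear_scaleR]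
lemmas ck_inner = ck_bilinear[OF bounded_bilinear_inner]

lemma ck_linear:
  assumes L: "bounded_linear L"
  shows "ck n Q J f \<Longrightarrow> ck n Q J (\<lambda>q r. L (f q r))"
proof (induction n arbitrary: f)
  case 0 then show ?case using bounded_linear.continuous_on[OF L] by (auto simp: split_def)
next
  case (Suc n)
  from Suc.prems obtain f' where d: "\<And>q r. q \<in> Q \<Longrightarrow> r \<in> J \<Longrightarrow> (f q has_vector_derivative f' q r) (at r)" "ck n Q J f'"
    by (metis ck_SucE)
  have "continuous_on (Q \<times> J) (\<lambda>(q, r). L (f q r))"
    using ck_continuous[OF Suc.prems(1)] bounded_linear.continuous_on[OF L] by (auto simp: split_def)
  with d Suc.IH show ?case
    by (intro ck_SucI[where f'="\<lambda>q r. L (f' q r)"])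
      (auto intro!: bounded_linear.has_vector_derivative[OF L])
qed

lemma ck_diff: "ck n Q J f \<Longrightarrow> ck n Q J g \<Longrightarrow> ck n Q J (\<lambda>q r. f q r - g q r)"
  using ck_add[of n Q J f "\<lambda>q r. - g q r"] ck_linear[OF bounded_linear_minus[OF bounded_linear_ident], of n Q J g]
  by simp

lemma ck_sum: "(\<And>i. i \<in> I \<Longrightarrow> ck n Q J (f i)) \<Longrightarrow> ck n Q J (\<lambda>q r. \<Sum>i\<in>I. f i q r)"
  by (induction I rule: infinite_finite_induct) (auto intro!: ck_add ck_const)

lemma ck_prod:
  fixes f :: "'i \<Rightarrow> 'q::topological_space \<Rightarrow> real \<Rightarrow> 'b::real_normed_field"
  shows "(\<And>i. i \<in> I \<Longrightarrow> ck n Q J (f i)) \<Longrightarrow> ck n Q J (\<lambda>q r. \<Prod>i\<in>I. f i q r)"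
  by (induction I rule: infinite_finite_induct) (auto intro!: ck_mult ck_const)

lemma ck_inverse:
  fixes f :: "'q::topological_space \<Rightarrow> real \<Rightarrow> real"
  assumes "\<And>q r. q \<in> Q \<Longrightarrow> r \<in> J \<Longrightarrow> f q r \<noteq> 0"
  shows "ck n Q J f \<Longrightarrow> ck n Q J (\<lambda>q r. inverse (f q r))"
proof (induction n)
  case 0 then show ?case using assms by (auto simp: split_def intro!: continuous_intros)
next
  case (Suc n)
  from Suc.prems obtain f' where d: "\<And>q r. q \<in> Q \<Longrightarrow> r \<in> J \<Longrightarrow> (f q has_vector_derivative f' q r) (at r)" "ck n Q J f'"
    by (metis ck_SucE)
  have c: "continuous_on (Q \<times> J) (\<lambda>(q, r). inverse (f q r))"
    using ck_continuous[OF Suc.prems(1)] assms by (auto simp: split_def intro!: continuous_intros)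
  \<comment> \<open>The derivative is kept as a product with copies of the inverse itself, so that
    the same claim for one order less closes the induction.\<close>
  have "((\<lambda>r. inverse (f q r)) has_vector_derivative - (inverse (f q r) * f' q r * inverse (f q r))) (at r)"
    if "q \<in> Q" "r \<in> J" for q r
    using d(1)[OF that] assms[OF that] unfolding has_real_derivative_iff_has_vector_derivative[symmetric]
    by (auto intro!: derivative_eq_intros)
  with c show ?case
    by (intro ck_SucI[where f'="\<lambda>q r. - (inverse (f q r) * f' q r * inverse (f q r))"])
      (use Suc.IH[OF ck_SucD[OF Suc.prems]] d(2) in
        \<open>auto intro!: ck_linear[OF bounded_linear_minus[OF bounded_linear_ident]] ck_mult simp del: ck.simps\<close>)
qed

lemma ck_ln:
  fixes f :: "'q::topological_space \<Rightarrow> real \<Rightarrow> real"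
  assumes pos: "\<And>q r. q \<in> Q \<Longrightarrow> r \<in> J \<Longrightarrow> f q r > 0" and f: "ck n Q J f"
  shows "ck n Q J (\<lambda>q r. ln (f q r))"
proof -
  have nz: "\<And>q r. q \<in> Q \<Longrightarrow> r \<in> J \<Longrightarrow> f q r \<noteq> 0" using pos by force
  have c: "continuous_on (Q \<times> J) (\<lambda>(q, r). ln (f q r))"
    using ck_continuous[OF f] nz by (auto simp: split_def intro!: continuous_intros)
  show ?thesis
  proof (cases n)
    case 0 with c show ?thesis by simp
  next
    case (Suc m)
    then obtain f' where d: "\<And>q r. q \<in> Q \<Longrightarrow> r \<in> J \<Longrightarrow> (f q has_vector_derivative f' q r) (at r)" "ck m Q J f'"
      using f ck_SucE[of m Q J f] by blast
    have "((\<lambda>r. ln (f q r)) has_vector_derivative (f' q r * inverse (f q r))) (at r)" if "q \<in> Q" "r \<in> J" for q r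
      using d(1)[OF that] pos[OF that] unfolding has_real_derivative_iff_has_vector_derivative[symmetric]
      by (auto intro!: derivative_eq_intros simp: field_simps)
    moreover have "ck m Q J (\<lambda>q r. f' q r * inverse (f q r))"
      using f Suc d(2) nz by (intro ck_mult ck_inverse) (auto dest: ck_SucD simp del: ck.simps)
    ultimately show ?thesis unfolding Suc using c by (intro ck_SucI) auto
  qed
qed

lemma ck_exp:
  fixes f :: "'q::topological_space \<Rightarrow> real \<Rightarrow> 'b::{real_normed_field,banach}"
  shows "ck n Q J f \<Longrightarrow> ck n Q J (\<lambda>q r. exp (f q r))"
proof (induction n)
  case 0 then show ?case by (auto simp: split_def intro!: continuous_intros)
next
  case (Suc n)
  from Suc.prems obtain f' where d: "\<And>q r. q \<in> Q \<Longrightarrow> r \<in> J \<Longrightarrow> (f q has_vector_derivative f' q r) (at r)" "ck n Q J f'"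
    by (metis ck_SucE)
  have c: "continuous_on (Q \<times> J) (\<lambda>(q, r). exp (f q r))"
    using ck_continuous[OF Suc.prems(1)] by (auto simp: split_def intro!: continuous_intros)
  have "((\<lambda>r. exp (f q r)) has_vector_derivative (f' q r * exp (f q r))) (at r)" if "q \<in> Q" "r \<in> J" for q r
    using field_vector_diff_chain_at[OF d(1)[OF that] DERIV_exp] by (simp add: o_def)
  with c show ?case
    by (intro ck_SucI[where f'="\<lambda>q r. f' q r * exp (f q r)"])
      (use Suc.IH[OF ck_SucD[OF Suc.prems]] d(2) in \<open>auto intro!: ck_mult simp del: ck.simps\<close>)
qed

text \<open>Each derivative in \<open>r\<close> brings down a factor \<open>t\<close>, so the
  induction has to carry an arbitrary power \<open>t ^ m\<close>. The interval is centred at 0 and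
  therefore contains \<open>t * r\<close> together with \<open>r\<close>.\<close>

lemma ck_integral_dilation:
  fixes f :: "'q::topological_space \<Rightarrow> real \<Rightarrow> 'b::banach"
  assumes J: "J = {-e<..<e}"
  shows "ck n Q J f \<Longrightarrow> ck n Q J (\<lambda>q r. integral (cbox 0 1) (\<lambda>t. t ^ m *\<^sub>R f q (t * r)))"
proof (induction n arbitrary: f m)
  have tr: "t * r \<in> J" if "t \<in> cbox 0 (1::real)" "r \<in> J" for t r
  proof -
    have "\<bar>t * r\<bar> \<le> 1 * \<bar>r\<bar>" unfolding abs_mult using that by (intro mult_right_mono) auto
    then show ?thesis using that J by auto
  qed
  have c: "continuous_on ((Q \<times> J) \<times> cbox 0 (1::real)) (\<lambda>((q,r),t). t ^ m *\<^sub>R f q (t * r))"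
    if "continuous_on (Q \<times> J) (\<lambda>(q,r). f q r)" for f :: "'q \<Rightarrow> real \<Rightarrow> 'b" and m
  proof -
    have "continuous_on ((Q \<times> J) \<times> cbox 0 (1::real)) (\<lambda>x. (case (fst (fst x), snd x * snd (fst x)) of (q,r) \<Rightarrow> f q r))"
      by (rule continuous_on_compose2[OF that]) (auto intro!: continuous_intros tr)
    then show ?thesis by (auto simp: split_def intro!: continuous_intros)
  qed
  have c2: "continuous_on (Q \<times> J) (\<lambda>(q, r). integral (cbox 0 1) (\<lambda>t. t ^ m *\<^sub>R f q (t * r)))"
    if "continuous_on (Q \<times> J) (\<lambda>(q,r). f q r)" for f :: "'q \<Rightarrow> real \<Rightarrow> 'b" and m
    using integral_continuous_on_param[of "Q \<times> J" 0 1 "\<lambda>(q,r) t. t ^ m *\<^sub>R f q (t * r)"] c[OF that, of m]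
    by (simp add: split_def)
  {
    case 0
    then show ?case using c2 by simp
  next
    case (Suc n)
    from Suc.prems obtain f' where d: "\<And>q r. q \<in> Q \<Longrightarrow> r \<in> J \<Longrightarrow> (f q has_vector_derivative f' q r) (at r)" "ck n Q J f'"
      by (metis ck_SucE)
    have "((\<lambda>r. integral (cbox 0 1) (\<lambda>t. t ^ m *\<^sub>R f q (t * r))) has_vector_derivative
            integral (cbox 0 1) (\<lambda>t. t ^ Suc m *\<^sub>R f' q (t * r))) (at r within J)" if "q \<in> Q" "r \<in> J" for q r
    proof (rule leibniz_rule_vector_derivative)
      fix x t assume "x \<in> J" "t \<in> cbox 0 (1::real)"
      with tr that have "(f q has_vector_derivative f' q (t * x)) (at (t * x))" by (intro d) auto
      from vector_diff_chain_at[where f="\<lambda>x. t * x" and f'=t, OF _ this]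
        has_real_derivative_iff_has_vector_derivative[THEN iffD1, OF DERIV_cmult_Id]
      have "((\<lambda>x. f q (t * x)) has_vector_derivative t *\<^sub>R f' q (t * x)) (at x)"
        by (simp add: o_def)
      from has_vector_derivative_scaleR[OF DERIV_const[of "t ^ m"] this]
      show "((\<lambda>x. t ^ m *\<^sub>R f q (t * x)) has_vector_derivative t ^ Suc m *\<^sub>R f' q (t * x)) (at x within J)"
        by (auto simp: ac_simps intro: has_vector_derivative_at_within)
    next
      fix x assume "x \<in> J"
      have "continuous_on (cbox 0 (1::real)) (\<lambda>t. ((q,x),t))"
        by (intro continuous_on_Pair continuous_on_const continuous_on_id)
      from continuous_on_compose2[OF c[OF ck_continuous[OF Suc.prems], of m] this] that \<open>x \<in> J\<close>
      have "continuous_on (cbox 0 (1::real)) (\<lambda>t. t ^ m *\<^sub>R f q (t * x))" by (auto simp: image_subset_iff)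
      then show "(\<lambda>t. t ^ m *\<^sub>R f q (t * x)) integrable_on cbox 0 1"
        by (intro integrable_continuous) auto
    next
      have "continuous_on (J \<times> cbox 0 (1::real)) (\<lambda>x. ((q, fst x), snd x))"
        by (intro continuous_intros)
      from continuous_on_compose2[OF c[OF ck_continuous[OF d(2)], of "Suc m"] this] that
      show "continuous_on (J \<times> cbox 0 1) (\<lambda>(x, t). t ^ Suc m *\<^sub>R f' q (t * x))"
        by (auto simp: split_def image_subset_iff)
    qed (use that J in auto)
    then have "((\<lambda>r. integral (cbox 0 1) (\<lambda>t. t ^ m *\<^sub>R f q (t * r))) has_vector_derivative
            integral (cbox 0 1) (\<lambda>t. t ^ Suc m *\<^sub>R f' q (t * r))) (at r)" if "q \<in> Q" "r \<in> J" for q r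
      using that at_within_open[of r J] J by fastforce
    with Suc.IH[OF d(2), of "Suc m"] c2[OF ck_continuous[OF Suc.prems], of m]
    show ?case by (intro ck_SucI) auto
  }
qed

text \<open>Hadamard's lemma: by the fundamental theorem of calculus \<open>f q r\<close> is
  \<open>r\<close> times the mean of \<open>f'\<close> over the segment from 0 to \<open>r\<close>,
  and that mean is as smooth as \<open>f'\<close>. It makes difference quotients smooth across
  \<open>r = 0\<close>, both in the blow-up and in the step of the integration by parts.\<close>

lemma ck_hadamard:
  fixes f :: "'q::topological_space \<Rightarrow> real \<Rightarrow> 'b::banach"
  assumes J: "J = {-e<..<e}" and e: "e > 0"
    and d: "\<And>q r. q \<in> Q \<Longrightarrow> r \<in> J \<Longrightarrow> (f q has_vector_derivative f' q r) (at r)" "ck n Q J f'"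
    and 0: "\<And>q. q \<in> Q \<Longrightarrow> f q 0 = 0"
  shows "ck n Q J (\<lambda>q r. if r = 0 then f' q 0 else f q r /\<^sub>R r)"
proof (rule ck_cong[OF _ _ ck_integral_dilation[OF J d(2), of 0]])
  show "open J" using J by auto
  fix q r assume q: "q \<in> Q" and r: "r \<in> J"
  have "((\<lambda>t. r *\<^sub>R f' q (t * r)) has_integral (f q (1 * r) - f q (0 * r))) {0..1}"
  proof (rule fundamental_theorem_of_calculus)
    fix t :: real assume t: "t \<in> {0..1}"
    have "\<bar>t * r\<bar> \<le> 1 * \<bar>r\<bar>" unfolding abs_mult using t by (intro mult_right_mono) auto
    then have "t * r \<in> J" using r J by auto
    have "((\<lambda>t. t * r) has_vector_derivative r) (at t)"
      unfolding has_real_derivative_iff_has_vector_derivative[symmetric] by (auto intro!: derivative_eq_intros)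
    from vector_diff_chain_at[OF this d(1)[OF q \<open>t * r \<in> J\<close>]]
    have "((\<lambda>t. f q (t * r)) has_vector_derivative r *\<^sub>R f' q (t * r)) (at t)"
      by (simp add: o_def)
    then show "((\<lambda>t. f q (t * r)) has_vector_derivative r *\<^sub>R f' q (t * r)) (at t within {0..1})"
      by (rule has_vector_derivative_at_within)
  qed auto
  then have i: "((\<lambda>t. r *\<^sub>R f' q (t * r)) has_integral f q r) {0..1}" using 0[OF q] by simp
  show "integral (cbox 0 1) (\<lambda>t. t ^ 0 *\<^sub>R f' q (t * r)) = (if r = 0 then f' q 0 else f q r /\<^sub>R r)"
  proof (cases "r = 0")
    case False
    from has_integral_cmul[OF i, of "inverse r"] False
    have "((\<lambda>t. f' q (t * r)) has_integral f q r /\<^sub>R r) {0..1}" by simp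
    with False show ?thesis by (simp add: integral_unique)
  qed simp
qed

definition sm :: "'q::topological_space set \<Rightarrow> real set \<Rightarrow> ('q \<Rightarrow> real \<Rightarrow> 'b::real_normed_vector) \<Rightarrow> bool" where
  "sm Q J f \<longleftrightarrow> (\<forall>n. ck n Q J f)"

text \<open>Every order \<open>n\<close> comes with a derivative of its own. Derivatives at a point
  are unique, so all of them agree on \<open>J\<close> with \<open>vector_derivative\<close>, which
  is then smooth to every order.\<close>

lemma sm_derivE:
  assumes "sm Q J f" "open J"
  obtains f' where "\<And>q r. q \<in> Q \<Longrightarrow> r \<in> J \<Longrightarrow> (f q has_vector_derivative f' q r) (at r)" "sm Q J f'"
proof -
  define f' where "f' q r = vector_derivative (f q) (at r)" for q r
  have *: "(\<forall>q\<in>Q. \<forall>r\<in>J. (f q has_vector_derivative f' q r) (at r)) \<and> ck n Q J f'" for n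
  proof -
    from assms(1) have "ck (Suc n) Q J f" by (simp add: sm_def del: ck.simps)
    then obtain g where g: "\<And>q r. q \<in> Q \<Longrightarrow> r \<in> J \<Longrightarrow> (f q has_vector_derivative g q r) (at r)" "ck n Q J g"
      by (metis ck_SucE)
    have eq: "g q r = f' q r" if "q \<in> Q" "r \<in> J" for q r
      using g(1)[OF that] by (simp add: f'_def vector_derivative_at)
    with g ck_cong[OF assms(2) eq] show ?thesis by auto
  qed
  then show thesis by (intro that[of f']) (auto simp: sm_def)
qed

lemma sm_continuous: "sm Q J f \<Longrightarrow> continuous_on (Q \<times> J) (\<lambda>(q,r). f q r)"
  by (auto simp: sm_def intro: ck_continuous)

section \<open>Integrals depending on a parameter\<close>

text \<open>The mean value inequality bounds the remainder quotients by twice the majorant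
  \<open>g\<close>, and dominated convergence applies. With total derivatives, one statement serves
  the complex parameter \<open>s\<close> and the real parameter \<open>r\<close>.\<close>

lemma has_derivative_lebesgue_integral:
  fixes f :: "'p \<Rightarrow> 'x::real_normed_vector \<Rightarrow> 'b::{banach,second_countable_topology}"
  assumes e: "e > 0"
    and int: "\<And>x. x \<in> ball x0 e \<Longrightarrow> integrable M (\<lambda>p. f p x)"
    and der: "\<And>p x. p \<in> space M \<Longrightarrow> x \<in> ball x0 e \<Longrightarrow> (f p has_derivative f' p x) (at x)"
    and bd: "\<And>p x h. p \<in> space M \<Longrightarrow> x \<in> ball x0 e \<Longrightarrow> norm (f' p x h) \<le> g p * norm h"
    and g: "integrable M g"
    and meas: "\<And>h. (\<lambda>p. f' p x0 h) \<in> borel_measurable M"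
  shows "((\<lambda>x. \<integral>p. f p x \<partial>M) has_derivative (\<lambda>h. \<integral>p. f' p x0 h \<partial>M)) (at x0)"
proof -
  have x0: "x0 \<in> ball x0 e" using e by simp
  have lin: "linear (f' p x0)" if "p \<in> space M" for p
    using der[OF that x0] by (simp add: has_derivative_linear)
  have int': "integrable M (\<lambda>p. f' p x0 h)" for h
    using bd[OF _ x0, of _ h] g
    by (intro Bochner_Integration.integrable_bound[OF integrable_mult_left[OF g, of "norm h"] meas] AE_I2)
      (auto intro: order.trans[OF _ abs_ge_self])
  have bl: "bounded_linear (\<lambda>h. \<integral>p. f' p x0 h \<partial>M)"
  proof (rule bounded_linear_intro)
    fix x y
    have "(\<integral>p. f' p x0 (x + y) \<partial>M) = (\<integral>p. f' p x0 x + f' p x0 y \<partial>M)"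
      by (intro Bochner_Integration.integral_cong refl) (simp add: lin linear_add)
    then show "(\<integral>p. f' p x0 (x + y) \<partial>M) = (\<integral>p. f' p x0 x \<partial>M) + (\<integral>p. f' p x0 y \<partial>M)"
      using int' by simp
  next
    fix r x
    have "(\<integral>p. f' p x0 (r *\<^sub>R x) \<partial>M) = (\<integral>p. r *\<^sub>R f' p x0 x \<partial>M)"
      by (intro Bochner_Integration.integral_cong refl) (simp add: lin linear_scale)
    then show "(\<integral>p. f' p x0 (r *\<^sub>R x) \<partial>M) = r *\<^sub>R (\<integral>p. f' p x0 x \<partial>M)" by simp
  next
    fix h
    have "norm (\<integral>p. f' p x0 h \<partial>M) \<le> (\<integral>p. g p * norm h \<partial>M)"
      by (rule order.trans[OF integral_norm_bound integral_mono])
        (use bd[OF _ x0] g int' in auto)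
    then show "norm (\<integral>p. f' p x0 h \<partial>M) \<le> norm h * (\<integral>p. g p \<partial>M)" using g by (simp add: mult.commute)
  qed
  have *: "((\<lambda>y. (1 / norm (y - x0)) *\<^sub>R ((\<integral>p. f p y \<partial>M) - ((\<integral>p. f p x0 \<partial>M) + (\<integral>p. f' p x0 (y - x0) \<partial>M)))) \<longlongrightarrow> 0)
     (at x0 within ball x0 e)"
    unfolding tendsto_at_iff_sequentially
  proof (intro allI impI)
    fix X assume X: "\<forall>i::nat. X i \<in> ball x0 e - {x0}" and lim: "X \<longlonglongrightarrow> x0"
    define q where "q i p = (1 / norm (X i - x0)) *\<^sub>R (f p (X i) - (f p x0 + f' p x0 (X i - x0)))" for i p
    have Xi: "X i \<in> ball x0 e" "X i \<noteq> x0" for i using X by auto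
    have "(\<lambda>i. \<integral>p. q i p \<partial>M) \<longlonglongrightarrow> (\<integral>p. 0 \<partial>M)"
    proof (rule integral_dominated_convergence[where w="\<lambda>p. 2 * \<bar>g p\<bar>"])
      show "q i \<in> borel_measurable M" for i
        unfolding q_def using int[OF Xi(1)] int[OF x0] meas by (auto dest!: borel_measurable_integrable)
      show "integrable M (\<lambda>p. 2 * \<bar>g p\<bar>)" using g by simp
      show "AE p in M. (\<lambda>i. q i p) \<longlonglongrightarrow> 0"
      proof (rule AE_I2)
        fix p assume p: "p \<in> space M"
        from der[OF p x0] have "((\<lambda>y. (1 / norm (y - x0)) *\<^sub>R (f p y - (f p x0 + f' p x0 (y - x0)))) \<longlongrightarrow> 0) (at x0)"
          unfolding has_derivative_within by blast
        moreover have "filterlim X (at x0) sequentially"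
          using lim X unfolding filterlim_at by (auto intro!: always_eventually)
        ultimately show "(\<lambda>i. q i p) \<longlonglongrightarrow> 0" unfolding q_def
          by (rule filterlim_compose)
      qed
      show "AE p in M. norm (q i p) \<le> 2 * \<bar>g p\<bar>" for i
      proof (rule AE_I2)
        fix p assume p: "p \<in> space M"
        have bd': "norm (f' p x h) \<le> \<bar>g p\<bar> * norm h" if "x \<in> ball x0 e" for x h
          using bd[OF p that, of h] by (rule order.trans) (simp add: mult_right_mono)
        have "norm (f p (X i) - f p x0) \<le> \<bar>g p\<bar> * norm (X i - x0)"
        proof (rule differentiable_bound[OF convex_ball])
          show "(f p has_derivative f' p x) (at x within ball x0 e)" if "x \<in> ball x0 e" for x
            using der[OF p that] by (rule has_derivative_at_withinI)
          show "onorm (f' p x) \<le> \<bar>g p\<bar>" if "x \<in> ball x0 e" for x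
            using bd'[OF that] by (intro onorm_bound) auto
        qed (use Xi x0 in auto)
        moreover have "norm (f' p x0 (X i - x0)) \<le> \<bar>g p\<bar> * norm (X i - x0)" using bd'[OF x0] by simp
        ultimately have "norm (f p (X i) - (f p x0 + f' p x0 (X i - x0))) \<le> 2 * \<bar>g p\<bar> * norm (X i - x0)"
          unfolding diff_diff_eq[symmetric] by (intro order.trans[OF norm_triangle_ineq4]) simp
        then show "norm (q i p) \<le> 2 * \<bar>g p\<bar>" using Xi(2)[of i] by (simp add: q_def divide_simps del: scaleR_diff_right scaleR_add_right)
      qed
    qed auto
    moreover have "(\<integral>p. q i p \<partial>M) = (1 / norm (X i - x0)) *\<^sub>R ((\<integral>p. f p (X i) \<partial>M) - ((\<integral>p. f p x0 \<partial>M) + (\<integral>p. f' p x0 (X i - x0) \<partial>M)))" for i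
      unfolding q_def using int[OF Xi(1), of i] int[OF x0] int' by simp
    ultimately show "((\<lambda>y. (1 / norm (y - x0)) *\<^sub>R ((\<integral>p. f p y \<partial>M) - ((\<integral>p. f p x0 \<partial>M) + (\<integral>p. f' p x0 (y - x0) \<partial>M)))) \<circ> X) \<longlonglongrightarrow> 0"
      by (simp add: o_def)
  qed
  show ?thesis unfolding has_derivative_within using bl * at_within_open[OF x0 open_ball] by simp
qed

text \<open>A majorant of the integrand alone suffices: Cauchy's inequality on discs of half the
  radius turns it into a majorant of the derivative.\<close>

lemma holomorphic_on_lebesgue_integral:
  fixes f :: "'p \<Rightarrow> complex \<Rightarrow> complex"
  assumes S: "open S"
    and hol: "\<And>p. p \<in> space M \<Longrightarrow> f p holomorphic_on S"
    and meas: "\<And>s. s \<in> S \<Longrightarrow> (\<lambda>p. f p s) \<in> borel_measurable M"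
    and dom: "\<And>s. s \<in> S \<Longrightarrow> \<exists>r>0. \<exists>g. cball s r \<subseteq> S \<and> integrable M g \<and> (\<forall>p\<in>space M. \<forall>t\<in>cball s r. norm (f p t) \<le> g p)"
  shows "(\<lambda>s. \<integral>p. f p s \<partial>M) holomorphic_on S"
proof -
  have "(\<lambda>s. \<integral>p. f p s \<partial>M) field_differentiable (at s)" if s: "s \<in> S" for s
  proof -
    obtain r g where r: "r > 0" "cball s r \<subseteq> S" and g: "integrable M g"
      and bd: "\<And>p t. p \<in> space M \<Longrightarrow> t \<in> cball s r \<Longrightarrow> norm (f p t) \<le> g p" using dom[OF s] by blast
    have sub: "x \<in> S" "cball x (r/2) \<subseteq> cball s r" if "x \<in> ball s (r/2)" for x
    proof -
      show "cball x (r/2) \<subseteq> cball s r" using that r(1) by (auto simp: cball_subset_cball_iff dist_commute)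
      then show "x \<in> S" using r centre_in_cball[of x "r/2"] by (metis less_imp_le half_gt_zero subsetD)
    qed
    have der: "(f p has_field_derivative deriv (f p) x) (at x)" if "p \<in> space M" "x \<in> S" for p x
      using hol[OF that(1)] S that(2) by (rule holomorphic_derivI)
    have b: "norm (deriv (f p) x) \<le> g p / (r/2)" if p: "p \<in> space M" and x: "x \<in> ball s (r/2)" for p x
    proof -
      have h: "f p holomorphic_on cball x (r/2)" using hol[OF p] sub(2)[OF x] r(2) by (auto intro: holomorphic_on_subset)
      have "norm ((deriv ^^ 1) (f p) x) \<le> fact 1 * g p / (r/2) ^ 1"
      proof (rule Cauchy_inequality)
        show "f p holomorphic_on ball x (r/2)" using h by (rule holomorphic_on_subset) auto
        show "continuous_on (cball x (r/2)) (f p)" using h by (rule holomorphic_on_imp_continuous_on)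
        show "0 < r/2" using r by simp
        fix y assume "norm (x - y) = r / 2"
        then have "y \<in> cball x (r/2)" by (simp add: dist_norm)
        with sub(2)[OF x] show "norm (f p y) \<le> g p" by (intro bd p) auto
      qed
      then show ?thesis by simp
    qed
    have intf: "integrable M (\<lambda>p. f p x)" if "x \<in> ball s (r/2)" for x
      using bd sub[OF that] that r(1) by (intro Bochner_Integration.integrable_bound[OF g meas[OF sub(1)[OF that]]] AE_I2)
        (auto intro: order.trans[OF _ abs_ge_self])
    \<comment> \<open>The derivative is measurable as a pointwise limit of difference quotients. The
      2 in the denominator of \<open>X\<close> keeps already the first sample point strictly inside
      the disc of radius \<open>r / 2\<close>.\<close>
    have md: "(\<lambda>p. deriv (f p) s) \<in> borel_measurable M"
    proof (rule borel_measurable_LIMSEQ_metric)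
      define X where "X i = s + of_real (r / 2 / (2 + real i))" for i
      have X: "X i \<in> ball s (r/2)" "X i \<noteq> s" for i 
      proof -
        have *: "norm (X i - s) = r / 2 / (2 + real i)" using r(1) unfolding X_def by (simp add: norm_of_real del: of_real_divide)
        have "r / 2 / (2 + real i) < r / 2 / 1" using r(1) by (intro divide_strict_left_mono) auto
        moreover have "r / 2 / (2 + real i) \<noteq> 0" using r(1) by (simp add: add_eq_0_iff)
        ultimately show "X i \<in> ball s (r/2)" "X i \<noteq> s" using * by (auto simp: dist_norm norm_minus_commute)
      qed
      show "(\<lambda>p. (f p (X i) - f p s) / (X i - s)) \<in> borel_measurable M" for i
        using meas[OF s] meas[OF sub(1)[OF X(1)]] by simp
      fix p assume p: "p \<in> space M"
      have "((\<lambda>y. (f p y - f p s) / (y - s)) \<longlongrightarrow> deriv (f p) s) (at s)"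
        using der[OF p s] by (simp add: has_field_derivative_iff)
      moreover have "X \<longlonglongrightarrow> s + of_real 0" unfolding X_def by (intro tendsto_intros tendsto_of_real) real_asymp
      then have "filterlim X (at s) sequentially" using X by (simp add: filterlim_at)
      ultimately show "(\<lambda>i. (f p (X i) - f p s) / (X i - s)) \<longlonglongrightarrow> deriv (f p) s"
        by (rule filterlim_compose)
    qed
    have "((\<lambda>x. \<integral>p. f p x \<partial>M) has_derivative (\<lambda>h. \<integral>p. deriv (f p) s * h \<partial>M)) (at s)"
    proof (rule has_derivative_lebesgue_integral[where e="r/2" and g="\<lambda>p. g p / (r/2)"])
      show "(f p has_derivative (*) (deriv (f p) x)) (at x)" if "p \<in> space M" "x \<in> ball s (r/2)" for p x
        using der[OF that(1) sub(1)[OF that(2)]] by (simp add: has_field_derivative_def)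
      show "norm (deriv (f p) x * h) \<le> g p / (r/2) * norm h" if "p \<in> space M" "x \<in> ball s (r/2)" for p x h
        unfolding norm_mult using b[OF that] by (rule mult_right_mono) simp
      show "(\<lambda>p. deriv (f p) s * h) \<in> borel_measurable M" for h using md by simp
    qed (use r intf g in auto)
    moreover have "(\<lambda>h. \<integral>p. deriv (f p) s * h \<partial>M) = (*) (\<integral>p. deriv (f p) s \<partial>M)"
      by (simp add: fun_eq_iff)
    ultimately show ?thesis by (auto simp: field_differentiable_def has_field_derivative_def)
  qed
  then show ?thesis by (auto simp: holomorphic_on_def intro: field_differentiable_at_within)
qed

text \<open>The domain of integration \<open>P\<close> is only Borel, so all bounds are taken on the
  compact set \<open>P0\<close> around it. A continuous integrand is bounded there locally uniformly
  in the parameters, which gives integrability and, by dominated convergence, continuity.\<close>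

lemma continuous_on_lebesgue_integral:
  fixes f :: "'p::euclidean_space \<Rightarrow> 'q::euclidean_space \<Rightarrow> real \<Rightarrow> complex"
  assumes M: "sets M = sets borel" "emeasure M P0 < \<infinity>" and P0: "compact P0" and P: "P \<in> sets borel" "P \<subseteq> P0" and J: "open J"
    and f: "continuous_on ((P0 \<times> UNIV) \<times> J) (\<lambda>(p,r). f (fst p) (snd p) r)"
  shows "\<And>q r. r \<in> J \<Longrightarrow> integrable M (\<lambda>p. indicator P p *\<^sub>R f p q r)"
    and "\<And>K. compact K \<Longrightarrow> K \<subseteq> UNIV \<times> J \<Longrightarrow> \<exists>B. \<forall>p\<in>P0. \<forall>(q,r)\<in>K. norm (f p q r) \<le> B"
    and "continuous_on (UNIV \<times> J) (\<lambda>(q,r). \<integral>p. indicator P p *\<^sub>R f p q r \<partial>M)"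
proof -
  have comp: "\<exists>B. \<forall>p\<in>P0. \<forall>(q,r)\<in>K. norm (f p q r) \<le> B" if "compact K" "K \<subseteq> UNIV \<times> J" for K
  proof -
    have "continuous_on (P0 \<times> K) (\<lambda>x. ((fst x, fst (snd x)), snd (snd x)))" by (intro continuous_intros)
    moreover have "(\<lambda>x. ((fst x, fst (snd x)), snd (snd x))) ` (P0 \<times> K) \<subseteq> (P0 \<times> UNIV) \<times> J" using that by force
    ultimately have "continuous_on (P0 \<times> K) (\<lambda>x. f (fst x) (fst (snd x)) (snd (snd x)))"
      using continuous_on_compose2[OF f, of "P0 \<times> K" "\<lambda>x. ((fst x, fst (snd x)), snd (snd x))"] by (simp add: split_def)
    then have "bounded ((\<lambda>x. f (fst x) (fst (snd x)) (snd (snd x))) ` (P0 \<times> K))"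
      using P0 that by (intro compact_imp_bounded compact_continuous_image compact_Times)
    then show ?thesis by (fastforce simp: bounded_iff split_def)
  qed
  then show "\<And>K. compact K \<Longrightarrow> K \<subseteq> UNIV \<times> J \<Longrightarrow> \<exists>B. \<forall>p\<in>P0. \<forall>(q,r)\<in>K. norm (f p q r) \<le> B" .
  have meas: "(\<lambda>p. indicator P p *\<^sub>R f p q r) \<in> borel_measurable M" if "r \<in> J" for q r
  proof -
    have "continuous_on P (\<lambda>p. ((p, q), r))" by (intro continuous_intros)
    from continuous_on_compose2[OF f this] that P have "continuous_on P (\<lambda>p. f p q r)"
      by (auto simp: image_subset_iff split_def)
    then show ?thesis using borel_measurable_continuous_on_indicator[OF P(1)] M(1) measurable_cong_sets by blast
  qed
  have emP: "emeasure M P < \<infinity>"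
    using emeasure_mono[OF P(2), of M] M P0 by (auto simp: compact_imp_closed)
  have intc: "integrable M (\<lambda>p. indicator P p *\<^sub>R (B::real))" for B
    using emP M(1) P(1) by (intro integrable_indicator integrable_real_indicator integrable_scaleR_left) auto
  show "integrable M (\<lambda>p. indicator P p *\<^sub>R f p q r)" if r: "r \<in> J" for q r
  proof -
    obtain B where B: "\<And>p. p \<in> P0 \<Longrightarrow> norm (f p q r) \<le> B" using comp[of "{(q,r)}"] r by auto
    show ?thesis using P(2) B
      by (intro Bochner_Integration.integrable_bound[OF intc[of B] meas[OF r]] AE_I2) (auto simp: indicator_def intro: order.trans[OF _ abs_ge_self])
  qed
  show "continuous_on (UNIV \<times> J) (\<lambda>(q,r). \<integral>p. indicator P p *\<^sub>R f p q r \<partial>M)"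
  proof (rule continuous_on_sequentiallyI)
    fix u and a :: "'q \<times> real" assume u: "\<forall>n::nat. u n \<in> UNIV \<times> J" and a: "a \<in> UNIV \<times> J" and lim: "u \<longlonglongrightarrow> a"
    \<comment> \<open>A convergent sequence together with its limit is compact, so a single constant
      dominates all its members.\<close>
    obtain B where B: "\<And>p q r. p \<in> P0 \<Longrightarrow> (q,r) \<in> insert a (range u) \<Longrightarrow> norm (f p q r) \<le> B"
    proof -
      have "insert a (range u) \<subseteq> UNIV \<times> J" using u a by blast
      from comp[OF compact_sequence_with_limit[OF lim] this] show ?thesis using that by (metis case_prodD)
    qed
    have "(\<lambda>n. \<integral>p. indicator P p *\<^sub>R f p (fst (u n)) (snd (u n)) \<partial>M) \<longlonglongrightarrow> (\<integral>p. indicator P p *\<^sub>R f p (fst a) (snd a) \<partial>M)"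
    proof (rule integral_dominated_convergence[OF _ _ intc[of B]])
      show "(\<lambda>p. indicator P p *\<^sub>R f p (fst a) (snd a)) \<in> borel_measurable M"
        "(\<lambda>p. indicator P p *\<^sub>R f p (fst (u i)) (snd (u i))) \<in> borel_measurable M" for i
        using meas u a by (auto simp: mem_Times_iff)
      show "AE p in M. norm (indicator P p *\<^sub>R f p (fst (u i)) (snd (u i))) \<le> indicator P p *\<^sub>R B" for i
        using P(2) B[of _ "fst (u i)" "snd (u i)"] by (intro AE_I2) (auto simp: indicator_def)
      show "AE p in M. (\<lambda>i. indicator P p *\<^sub>R f p (fst (u i)) (snd (u i))) \<longlonglongrightarrow> indicator P p *\<^sub>R f p (fst a) (snd a)"
      proof (rule AE_I2)
        fix p
        show "(\<lambda>i. indicator P p *\<^sub>R f p (fst (u i)) (snd (u i))) \<longlonglongrightarrow> indicator P p *\<^sub>R f p (fst a) (snd a)"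
        proof (cases "p \<in> P")
          case True
          have "(\<lambda>i. ((p, fst (u i)), snd (u i))) \<longlonglongrightarrow> ((p, fst a), snd a)" using lim by (intro tendsto_intros)
          from continuous_on_tendsto_compose[OF f this] True P(2) u a
          have "(\<lambda>i. f p (fst (u i)) (snd (u i))) \<longlonglongrightarrow> f p (fst a) (snd a)"
            by (auto simp: mem_Times_iff split_def)
          then show ?thesis by (intro tendsto_intros)
        qed simp
      qed
    qed
    then show "(\<lambda>n. case u n of (q, r) \<Rightarrow> \<integral>p. indicator P p *\<^sub>R f p q r \<partial>M) \<longlonglongrightarrow> (case a of (q, r) \<Rightarrow> \<integral>p. indicator P p *\<^sub>R f p q r \<partial>M)"
      by (simp add: split_def)
  qed
qed

lemma ck_lebesgue_integral:
  fixes f :: "'p::euclidean_space \<Rightarrow> 'q::euclidean_space \<Rightarrow> real \<Rightarrow> complex"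
  assumes M: "sets M = sets borel" "emeasure M P0 < \<infinity>" and P0: "compact P0" and P: "P \<in> sets borel" "P \<subseteq> P0" and J: "open J"
  shows "ck n (P0 \<times> UNIV) J (\<lambda>x. f (fst x) (snd x)) \<Longrightarrow> ck n UNIV J (\<lambda>q r. \<integral>p. indicator P p *\<^sub>R f p q r \<partial>M)"
proof (induction n arbitrary: f)
  case 0
  then show ?case using continuous_on_lebesgue_integral(3)[OF M P0 P J, of f] by simp
next
  case (Suc n)
  obtain g where g: "\<And>x r. x \<in> P0 \<times> UNIV \<Longrightarrow> r \<in> J \<Longrightarrow> (f (fst x) (snd x) has_vector_derivative g x r) (at r)" "ck n (P0 \<times> UNIV) J g"
    using ck_SucE[OF Suc.prems] by metis
  define f' where "f' p q = g (p,q)" for p q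
  have f': "\<And>p q r. p \<in> P0 \<Longrightarrow> r \<in> J \<Longrightarrow> (f p q has_vector_derivative f' p q r) (at r)" "ck n (P0 \<times> UNIV) J (\<lambda>x. f' (fst x) (snd x))"
    using g by (auto simp: f'_def)
  note c = continuous_on_lebesgue_integral[OF M P0 P J ck_continuous[OF Suc.prems]]
  note c' = continuous_on_lebesgue_integral[OF M P0 P J ck_continuous[OF f'(2)]]
  have "((\<lambda>r. \<integral>p. indicator P p *\<^sub>R f p q r \<partial>M) has_vector_derivative (\<integral>p. indicator P p *\<^sub>R f' p q r \<partial>M)) (at r)" if r: "r \<in> J" for q r
  proof -
    obtain e where e: "e > 0" "cball r e \<subseteq> J" using J r open_contains_cball by blast
    obtain B where B: "\<And>p t. p \<in> P0 \<Longrightarrow> t \<in> cball r e \<Longrightarrow> norm (f' p q t) \<le> B"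
      using c'(2)[of "{q} \<times> cball r e"] e(2) compact_Times[OF _ compact_cball, of "{q}" r e]
      by (fastforce simp del: mem_cball)
    have "((\<lambda>r. \<integral>p. indicator P p *\<^sub>R f p q r \<partial>M) has_derivative (\<lambda>h. \<integral>p. h *\<^sub>R indicator P p *\<^sub>R f' p q r \<partial>M)) (at r)"
    proof (rule has_derivative_lebesgue_integral[where g="\<lambda>p. indicator P p * norm B", OF e(1)])
      show "integrable M (\<lambda>p. indicator P p *\<^sub>R f p q x)" if "x \<in> ball r e" for x using c(1) that e(2) by (auto simp: subset_iff)
      show "((\<lambda>x. indicator P p *\<^sub>R f p q x) has_derivative (\<lambda>h. h *\<^sub>R indicator P p *\<^sub>R f' p q x)) (at x)"
        if "x \<in> ball r e" for p x
      proof (cases "p \<in> P")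
        case True
        with f'(1)[of p x q] P(2) that e(2) show ?thesis by (auto simp: has_vector_derivative_def subset_iff)
      qed simp
      show "norm (h *\<^sub>R indicator P p *\<^sub>R f' p q x) \<le> indicator P p * norm B * norm h" if "x \<in> ball r e" for p x h
        using that B[of p x] P(2) by (cases "p \<in> P") (auto simp: mult.commute[of "\<bar>h\<bar>"] intro!: mult_right_mono)
      have "emeasure M P < \<infinity>" using emeasure_mono[OF P(2), of M] M P0 by (auto simp: compact_imp_closed)
      then show "integrable M (\<lambda>p. indicator P p * norm B)" using M(1) P(1) by (intro integrable_mult_left integrable_real_indicator) auto
      show "(\<lambda>p. h *\<^sub>R indicator P p *\<^sub>R f' p q r) \<in> borel_measurable M" for h
        using borel_measurable_scaleR[OF borel_measurable_const borel_measurable_integrable[OF c'(1)[OF r, of q]]] .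
    qed
    then show ?thesis unfolding has_vector_derivative_def by (simp only: integral_scaleR_right)
  qed
  with Suc.IH[OF f'(2)] c(3) show ?case by (intro ck_SucI) auto
qed

section \<open>Continuation of Mellin transforms of even families\<close>

text \<open>Uniform continuity on compact sets makes the holomorphic functions at
  \<open>h > 0\<close> converge locally uniformly as \<open>h\<close> tends to 0, and Weierstrass's
  theorem covers the limit.\<close>

lemma holomorphic_slice:
  fixes D :: "complex \<Rightarrow> real \<Rightarrow> complex"
  assumes e: "e > 0" and c: "continuous_on (UNIV \<times> {-e<..<e}) (\<lambda>(s,h). D s h)"
    and hol: "\<And>h. 0 < h \<Longrightarrow> h < e \<Longrightarrow> (\<lambda>s. D s h) holomorphic_on UNIV"
  shows "(\<lambda>s. D s 0) holomorphic_on UNIV"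
proof (rule holomorphic_uniform_sequence[OF open_UNIV])
  define h where "h n = e / (2 + real n)" for n
  have h: "0 < h n" "h n < e" "h n \<le> e/2" for n using e by (auto simp: h_def field_simps intro: add_pos_nonneg)
  have h0: "h \<longlonglongrightarrow> 0" unfolding h_def by real_asymp
  show "(\<lambda>s. D s (h n)) holomorphic_on UNIV" for n using hol h by blast
  fix x :: complex
  have "uniform_limit (cball x 1) (\<lambda>n s. D s (h n)) (\<lambda>s. D s 0) sequentially"
  proof (rule uniform_limitI)
    fix \<epsilon> :: real assume \<epsilon>: "\<epsilon> > 0"
    have "uniformly_continuous_on (cball x 1 \<times> {0..e/2}) (\<lambda>(s,h). D s h)"
      by (intro compact_uniformly_continuous continuous_on_subset[OF c] compact_Times) (use e in auto)
    then obtain d where d: "d > 0" "\<And>s h s' h'. s \<in> cball x 1 \<Longrightarrow> h \<in> {0..e/2} \<Longrightarrow> s' \<in> cball x 1 \<Longrightarrow> h' \<in> {0..e/2} \<Longrightarrow>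
        dist (s,h) (s',h') < d \<Longrightarrow> dist (D s h) (D s' h') < \<epsilon>"
      using \<epsilon> unfolding uniformly_continuous_on_def by fastforce
    have "\<forall>\<^sub>F n in sequentially. dist (h n) 0 < d" using h0 d(1) by (rule tendstoD)
    then show "\<forall>\<^sub>F n in sequentially. \<forall>s\<in>cball x 1. dist (D s (h n)) (D s 0) < \<epsilon>"
    proof eventually_elim
      case (elim n)
      then show ?case using h[of n] e by (auto intro!: d(2) simp: dist_Pair_Pair simp del: mem_cball)
    qed
  qed
  then show "\<exists>d>0. cball x d \<subseteq> UNIV \<and> uniform_limit (cball x d) (\<lambda>n s. D s (h n)) (\<lambda>s. D s 0) sequentially"
    by (intro exI[of _ 1]) auto
qed

text \<open>The difference quotients in \<open>r\<close> are holomorphic in \<open>s\<close> and, by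
  \<open>ck_hadamard\<close> of order 0, continuous up to step 0. This is how holomorphy in
  \<open>s\<close> survives the differentiation in \<open>r\<close> of the integration by
  parts.\<close>

lemma holomorphic_param_deriv:
  fixes H :: "complex \<Rightarrow> real \<Rightarrow> complex"
  assumes J: "open J" and r: "r \<in> J"
    and hol: "\<And>r. r \<in> J \<Longrightarrow> (\<lambda>s. H s r) holomorphic_on UNIV"
    and d: "\<And>s r. r \<in> J \<Longrightarrow> (H s has_vector_derivative H' s r) (at r)"
    and c: "continuous_on (UNIV \<times> J) (\<lambda>(s,r). H' s r)"
  shows "(\<lambda>s. H' s r) holomorphic_on UNIV"
proof -
  obtain e where e: "e > 0" "ball r e \<subseteq> J" using J r open_contains_ball by blast
  define D where "D s h = (if h = 0 then H' s r else (H s (r + h) - H s r) /\<^sub>R h)" for s h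
  have J': "r + h \<in> J" if "h \<in> {-e<..<e}" for h using e(2) that by (auto simp: subset_iff dist_norm)
  have "ck 0 UNIV {-e<..<e} (\<lambda>s h. if h = 0 then (\<lambda>s h. H' s (r + h)) s 0 else (\<lambda>s h. H s (r + h) - H s r) s h /\<^sub>R h)"
  proof (rule ck_hadamard[OF refl e(1)])
    fix s h assume "h \<in> {-e<..<e}"
    with d[OF J'] have "(H s has_vector_derivative H' s (r + h)) (at (r + h))" by blast
    moreover have "((\<lambda>h. r + h) has_vector_derivative 1) (at h)" by (auto intro!: derivative_eq_intros)
    ultimately have "((\<lambda>h. H s (r + h)) has_vector_derivative H' s (r + h)) (at h)"
      using vector_diff_chain_at[of "\<lambda>h. r + h" 1 h "H s" "H' s (r + h)"] by (simp add: o_def)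
    then show "((\<lambda>h. H s (r + h) - H s r) has_vector_derivative H' s (r + h)) (at h)"
      by (auto intro!: derivative_eq_intros)
  next
    have "continuous_on (UNIV \<times> {-e<..<e}) (\<lambda>x. case (fst x, r + snd x) of (s, r) \<Rightarrow> H' s r)"
      by (rule continuous_on_compose2[OF c]) (auto intro!: continuous_intros J')
    then show "ck 0 UNIV {-e<..<e} (\<lambda>s h. H' s (r + h))" by (simp add: split_def)
  qed auto
  then have "continuous_on (UNIV \<times> {-e<..<e}) (\<lambda>(s,h). D s h)" unfolding ck.simps D_def by (simp cong: if_cong)
  moreover have "(\<lambda>s. D s h) holomorphic_on UNIV" if "0 < h" "h < e" for h
    unfolding D_def scaleR_conv_of_real using that r J'[of h] by (auto intro!: holomorphic_intros hol)
  ultimately have "(\<lambda>s. D s 0) holomorphic_on UNIV" by (rule holomorphic_slice[OF e(1)])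
  then show ?thesis by (simp add: D_def)
qed

definition even_family :: "real set \<Rightarrow> (complex \<Rightarrow> real \<Rightarrow> complex) \<Rightarrow> bool" where
  "even_family J H \<longleftrightarrow> sm UNIV J H \<and> (\<forall>r\<in>J. (\<lambda>s. H s r) holomorphic_on UNIV) \<and> (\<forall>s. \<forall>r\<in>J. H s (-r) = H s r)"

text \<open>Passing from \<open>H\<close> to \<open>H1 = H' / r\<close> in an integration by parts raises the exponent by two, not
  by one: this is why the poles come in steps of two.\<close>

lemma even_family_step:
  assumes J: "J = {-e<..<e}" and e: "e > 0" and H: "even_family J H"
  shows "\<exists>H1. even_family J H1 \<and> (\<forall>s. \<forall>r\<in>J. (H s has_vector_derivative r *\<^sub>R H1 s r) (at r))"
proof -
  have oJ: "open J" and 0: "0 \<in> J" and sym: "\<And>r. r \<in> J \<Longrightarrow> - r \<in> J" using J e by auto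
  from H have sH: "sm UNIV J H" and hol: "\<And>r. r \<in> J \<Longrightarrow> (\<lambda>s. H s r) holomorphic_on UNIV"
    and ev: "\<And>s r. r \<in> J \<Longrightarrow> H s (-r) = H s r" by (auto simp: even_family_def)
  obtain H' where H': "\<And>s r. r \<in> J \<Longrightarrow> (H s has_vector_derivative H' s r) (at r)" "sm UNIV J H'"
    using sm_derivE[OF sH oJ] by (metis UNIV_I)
  obtain H'' where H'': "\<And>s r. r \<in> J \<Longrightarrow> (H' s has_vector_derivative H'' s r) (at r)" "sm UNIV J H''"
    using sm_derivE[OF H'(2) oJ] by (metis UNIV_I)
  have odd: "H' s (-r) = - H' s r" if r: "r \<in> J" for s r
  proof -
    have "(uminus has_vector_derivative -1) (at r)" by (auto intro!: derivative_eq_intros)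
    from vector_diff_chain_at[OF this H'(1)[OF sym[OF r]]]
    have "((\<lambda>r. H s (- r)) has_vector_derivative - H' s (- r)) (at r)" by (simp add: o_def)
    then have "(H s has_vector_derivative - H' s (- r)) (at r)"
      by (rule has_vector_derivative_transform_within_open[OF _ oJ r]) (use ev in auto)
    from vector_derivative_unique_at[OF this H'(1)[OF r]] show ?thesis by (metis minus_minus)
  qed
  have H'0: "H' s 0 = 0" for s using odd[OF 0, of s] by (simp add: complex_eq_iff)
  define H1 where "H1 s r = (if r = 0 then H'' s 0 else H' s r /\<^sub>R r)" for s r
  have "sm UNIV J H1" unfolding sm_def H1_def
    using ck_hadamard[where f=H' and f'=H'' and Q=UNIV, OF J e H''(1) _ H'0] H''(2) by (auto simp: sm_def)
  moreover have hol': "(\<lambda>s. H' s r) holomorphic_on UNIV" if "r \<in> J" for r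
    using holomorphic_param_deriv[OF oJ that hol H'(1) sm_continuous[OF H'(2)]] .
  have hol'': "(\<lambda>s. H'' s r) holomorphic_on UNIV" if "r \<in> J" for r
    using holomorphic_param_deriv[OF oJ that hol' H''(1) sm_continuous[OF H''(2)]] .
  have "(\<lambda>s. H1 s r) holomorphic_on UNIV" if "r \<in> J" for r
    using hol'[OF that] hol''[OF 0] unfolding H1_def scaleR_conv_of_real
    by (cases "r = 0") (auto intro!: holomorphic_intros)
  moreover have "H1 s (-r) = H1 s r" if "r \<in> J" for s r using odd[OF that] by (simp add: H1_def)
  moreover have "r *\<^sub>R H1 s r = H' s r" for s r using H'0 by (simp add: H1_def)
  ultimately show ?thesis using H'(1) by (intro exI[of _ H1]) (auto simp: even_family_def)
qed

section \<open>Truncated Mellin transforms\<close>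

definition mellin :: "real \<Rightarrow> complex \<Rightarrow> (real \<Rightarrow> complex) \<Rightarrow> complex" where
  "mellin R z h = (\<integral>r. indicator {0<..R} r *\<^sub>R (of_real r powr (z - 1) * h r) \<partial>lborel)"

lemma integrable_powr_Ioc:
  fixes d R :: real
  assumes "d > 0" "R \<ge> 0"
  shows "integrable lborel (\<lambda>r. indicator {0<..R} r *\<^sub>R (r powr (d - 1)))"
proof -
  have "(\<lambda>r. r powr (d - 1)) integrable_on {0..R}"
    using has_integral_powr_from_0[of "d - 1" R] assms by (auto simp: integrable_on_def)
  then have "(\<lambda>r. r powr (d - 1)) absolutely_integrable_on {0..R}"
    by (rule nonnegative_absolutely_integrable_1) auto
  then have "integrable lebesgue (\<lambda>r. indicator {0..R} r *\<^sub>R (r powr (d - 1)))" by (simp add: set_integrable_def)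
  then have "integrable lborel (\<lambda>r. indicator {0..R} r *\<^sub>R (r powr (d - 1)))"
    by (subst (asm) integrable_completion) auto
  moreover have "(\<lambda>r. indicator {0..R} r *\<^sub>R (r powr (d - 1))) = (\<lambda>r. indicator {0<..R} r *\<^sub>R (r powr (d - 1)))"
    by (auto simp: indicator_def fun_eq_iff)
  ultimately show ?thesis by metis
qed

text \<open>Below 1 a smaller exponent gives a larger power; with \<open>R \<le> 1\<close> one
  integrable power therefore dominates a whole half-plane of exponents.\<close>

lemma norm_powr_le_of_le_one:
  assumes "0 < r" "r \<le> 1" "d \<le> Re z"
  shows "norm (of_real r powr (z - 1) :: complex) \<le> r powr (d - 1)"
proof -
  have "norm (of_real r powr (z - 1) :: complex) = r powr (Re z - 1)" using assms by (simp add: norm_powr_real_powr)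
  also have "\<dots> \<le> r powr (d - 1)" using assms by (intro powr_mono') auto
  finally show ?thesis .
qed

lemma mellin_integrable:
  assumes R: "R > 0" "R \<le> 1" and z: "Re z > 0" and h: "continuous_on {0..R} h"
  shows "integrable lborel (\<lambda>r. indicator {0<..R} r *\<^sub>R (of_real r powr (z - 1) * h r))"
proof -
  obtain B where B: "\<And>r. r \<in> {0..R} \<Longrightarrow> norm (h r) \<le> B"
    using compact_imp_bounded[OF compact_continuous_image[OF h]] unfolding bounded_iff by (metis compact_Icc imageI)
  have B0: "B \<ge> 0" using order.trans[OF norm_ge_zero B[of 0]] R(1) by simp
  have m: "(\<lambda>r. indicator {0<..R} r *\<^sub>R (of_real r powr (z - 1) * h r)) \<in> borel_measurable lborel"
  proof -
    have "continuous_on {0<..R} (\<lambda>r. of_real r powr (z - 1) * h r)"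
      by (intro continuous_intros continuous_on_subset[OF h]) auto
    from borel_measurable_continuous_on_indicator[OF _ this] show ?thesis by simp
  qed
  show ?thesis
  proof (rule Bochner_Integration.integrable_bound[OF _ m])
    show "integrable lborel (\<lambda>r. indicator {0<..R} r *\<^sub>R (r powr (Re z - 1)) * B)"
      using R z by (intro integrable_mult_left integrable_powr_Ioc) auto
    show "AE r in lborel. norm (indicator {0<..R} r *\<^sub>R (of_real r powr (z - 1) * h r)) \<le> norm (indicator {0<..R} r *\<^sub>R (r powr (Re z - 1)) * B)"
      using B norm_powr_le_of_le_one[of _ "Re z" z] R B0
      by (intro AE_I2) (auto simp: indicator_def norm_mult intro!: mult_mono)
  qed
qed

lemma mellin_holomorphic:
  fixes H :: "complex \<Rightarrow> real \<Rightarrow> complex"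
  assumes R: "R > 0" "R \<le> 1" and c: "continuous_on (UNIV \<times> {0..R}) (\<lambda>(s,r). H s r)"
    and hol: "\<And>r. r \<in> {0..R} \<Longrightarrow> (\<lambda>s. H s r) holomorphic_on UNIV"
  shows "(\<lambda>s. mellin R (s + of_real a) (H s)) holomorphic_on {s. Re s > - a}"
  unfolding mellin_def
proof (rule holomorphic_on_lebesgue_integral)
  show "open {s. Re s > - a}" by (simp add: open_halfspace_Re_gt)
  have cr: "continuous_on {0..R} (H s)" for s
  proof -
    have "continuous_on {0..R} (\<lambda>r. (s, r))" by (intro continuous_intros)
    from continuous_on_compose2[OF c this] show ?thesis by auto
  qed
  show "(\<lambda>s. indicator {0<..R} r *\<^sub>R (of_real r powr (s + of_real a - 1) * H s r)) holomorphic_on {s. Re s > - a}" for r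
    by (cases "r \<in> {0<..R}") (auto simp: powr_def intro!: holomorphic_intros holomorphic_on_subset[OF hol])
  show "(\<lambda>r. indicator {0<..R} r *\<^sub>R (of_real r powr (s + of_real a - 1) * H s r)) \<in> borel_measurable lborel" if "s \<in> {s. Re s > - a}" for s
    using mellin_integrable[OF R _ cr, of "s + of_real a" s] that by (auto dest: borel_measurable_integrable)
  fix s assume "s \<in> {s. Re s > - a}"
  then have s: "Re s + a > 0" by simp
  \<comment> \<open>Half the distance from \<open>s\<close> to the edge of the half-plane: on the
    disc of this radius the real part of the Mellin variable stays at least
    \<open>d\<close>.\<close>
  define d where "d = (Re s + a) / 2"
  have d: "d > 0" using s by (simp add: d_def)
  have "continuous_on (cball s d \<times> {0..R}) (\<lambda>(s,r). H s r)" by (rule continuous_on_subset[OF c]) auto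
  then have "bounded ((\<lambda>(s,r). H s r) ` (cball s d \<times> {0..R}))"
    by (intro compact_imp_bounded compact_continuous_image compact_Times) auto
  then obtain B where B: "\<And>t r. t \<in> cball s d \<Longrightarrow> r \<in> {0..R} \<Longrightarrow> norm (H t r) \<le> B"
    unfolding bounded_iff by (metis (no_types, lifting) SigmaI case_prod_conv imageI)
  have B0: "B \<ge> 0" using order.trans[OF norm_ge_zero B[of s 0]] R(1) d by simp
  have Re: "d \<le> Re (t + of_real a)" if "t \<in> cball s d" for t
    using that abs_Re_le_cmod[of "s - t"] by (auto simp: dist_norm d_def field_simps)
  have "integrable lborel (\<lambda>r. indicator {0<..R} r *\<^sub>R (r powr (d - 1)) * B)"
    using R d by (intro integrable_mult_left integrable_powr_Ioc) auto
  moreover have "norm (indicator {0<..R} r *\<^sub>R (of_real r powr (t + of_real a - 1) * H t r)) \<le> indicator {0<..R} r *\<^sub>R (r powr (d - 1)) * B"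
    if "t \<in> cball s d" for t r
    using B[OF that, of r] norm_powr_le_of_le_one[OF _ _ Re[OF that], of r] R B0
    by (auto simp: indicator_def norm_mult intro!: mult_mono)
  moreover have "cball s d \<subseteq> {s. Re s > - a}" using Re d by force
  ultimately show "\<exists>r>0. \<exists>g. cball s r \<subseteq> {s. - a < Re s} \<and> integrable lborel g \<and>
     (\<forall>p\<in>space lborel. \<forall>t\<in>cball s r. norm (indicator {0<..R} p *\<^sub>R (of_real p powr (t + of_real a - 1) * H t p)) \<le> g p)"
    using d by blast
qed

text \<open>The derivative of \<open>r powr z * h r\<close> is integrated. Since
  \<open>h' = r h1\<close>, its second summand carries the power \<open>z + 1\<close>, that is the
  Mellin variable \<open>z + 2\<close>. The boundary term at 0 vanishes because
  \<open>Re z > 0\<close>.\<close>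

lemma mellin_by_parts:
  assumes R: "R > 0" "R \<le> 1" "R < e" and z: "Re z > 0"
    and d: "\<And>r. r \<in> {-e<..<e} \<Longrightarrow> (h has_vector_derivative r *\<^sub>R h1 r) (at r)"
    and c: "continuous_on {-e<..<e} h1"
  shows "mellin R z h = (of_real R powr z * h R - mellin R (z + 2) h1) / z"
proof -
  have z0: "z \<noteq> 0" using z by auto
  have ch: "continuous_on {0..R} h"
  proof (intro continuous_at_imp_continuous_on ballI)
    fix r assume "r \<in> {0..R}"
    with R show "isCont h r" by (intro has_vector_derivative_continuous[OF d]) auto
  qed
  have ch1: "continuous_on {0..R} h1" using R by (intro continuous_on_subset[OF c]) auto
  define g where "g r = of_real r powr z * h r" for r :: real
  define g' where "g' r = z * (of_real r powr (z - 1) * h r) + of_real r powr ((z + 2) - 1) * h1 r" for r :: real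
  have cg: "continuous_on {0..R} g" unfolding g_def
    by (intro continuous_intros ch) (use z in auto)
  have dg: "(g has_vector_derivative g' r) (at r)" if r: "r \<in> {0<..<R}" for r
  proof -
    have "((\<lambda>w. w powr z) has_field_derivative z * of_real r powr (z - 1)) (at (of_real r))"
      using r by (intro has_field_derivative_powr) auto
    from field_vector_diff_chain_at[OF has_vector_derivative_of_real[OF DERIV_ident] this]
    have "((\<lambda>r. of_real r powr z) has_vector_derivative z * of_real r powr (z - 1)) (at r)" by (simp add: o_def)
    from has_vector_derivative_mult[OF this d[of r]] r R
    have "(g has_vector_derivative of_real r powr z * (r *\<^sub>R h1 r) + z * of_real r powr (z - 1) * h r) (at r)"
      by (simp add: g_def[abs_def])
    moreover have "of_real r powr (z + 2 - 1) = of_real r powr z * (of_real r :: complex)"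
      using r powr_add[of "of_real r :: complex" z 1] by (simp add: add.commute)
    ultimately show ?thesis by (simp add: g'_def scaleR_conv_of_real algebra_simps)
  qed
  have hi: "(g' has_integral g R - g 0) {0..R}"
    using R by (intro fundamental_theorem_of_calculus_interior cg dg) auto
  have i1: "integrable lborel (\<lambda>r. indicator {0<..R} r *\<^sub>R (of_real r powr (z - 1) * h r))"
    by (rule mellin_integrable[OF R(1,2) z ch])
  have i2: "integrable lborel (\<lambda>r. indicator {0<..R} r *\<^sub>R (of_real r powr ((z + 2) - 1) * h1 r))"
    by (rule mellin_integrable[OF R(1,2) _ ch1]) (use z in auto)
  have eq: "indicator {0<..R} r *\<^sub>R g' r = z * (indicator {0<..R} r *\<^sub>R (of_real r powr (z - 1) * h r))
      + indicator {0<..R} r *\<^sub>R (of_real r powr ((z + 2) - 1) * h1 r)" for r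
    by (simp add: g'_def scaleR_conv_of_real algebra_simps)
  have "z * mellin R z h + mellin R (z + 2) h1 = (\<integral>r. indicator {0<..R} r *\<^sub>R g' r \<partial>lborel)"
    unfolding mellin_def eq using Bochner_Integration.integral_add[OF integrable_mult_right[OF i1, of z] i2]
    by (simp only: integral_mult_right_zero)
  also have "\<dots> = integral {0<..R} g'"
  proof -
    have "set_integrable lborel {0<..R} g'" unfolding set_integrable_def eq
      by (rule Bochner_Integration.integrable_add[OF integrable_mult_right[OF i1, of z] i2])
    from set_borel_integral_eq_integral(2)[OF this] show ?thesis by (simp add: set_lebesgue_integral_def)
  qed
  also have "\<dots> = integral {0..R} g'"
    by (rule integral_spike_set) (auto intro: negligible_subset[of "{0}"])
  also have "\<dots> = g R" using hi z0 by (simp add: integral_unique g_def)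
  finally show ?thesis using z0 by (simp add: g_def field_simps)
qed

text \<open>Around every point the function is \<open>g s / (s - z)\<close> with analytic
  \<open>g\<close>, so poles of higher order are excluded while removable points are allowed. This
  makes the class closed under sums and under multiplication by entire functions. Values at points
  of \<open>S\<close> are left free.\<close>

definition simple_poles_in :: "complex set \<Rightarrow> (complex \<Rightarrow> complex) \<Rightarrow> bool" where
  "simple_poles_in S f \<longleftrightarrow>
     (\<forall>z. (z \<notin> S \<longrightarrow> f analytic_on {z}) \<and> (\<exists>g. g analytic_on {z} \<and> (\<forall>\<^sub>F s in at z. f s = g s / (s - z))))"

lemma simple_poles_in_analytic:
  assumes "f analytic_on UNIV"
  shows "simple_poles_in S f"
proof -
  have a: "f analytic_on {z}" for z using assms by (rule analytic_on_subset) auto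
  moreover have "\<exists>g. g analytic_on {z} \<and> (\<forall>\<^sub>F s in at z. f s = g s / (s - z))" for z
    by (intro exI[of _ "\<lambda>s. f s * (s - z)"]) (auto intro!: analytic_intros a simp: eventually_at_filter)
  ultimately show ?thesis by (simp add: simple_poles_in_def)
qed

lemma simple_poles_in_add:
  assumes "simple_poles_in S f" "simple_poles_in S g"
  shows "simple_poles_in S (\<lambda>s. f s + g s)"
  unfolding simple_poles_in_def
proof (intro allI conjI impI)
  fix z
  show "z \<notin> S \<Longrightarrow> (\<lambda>s. f s + g s) analytic_on {z}" using assms by (auto simp: simple_poles_in_def intro!: analytic_intros)
  obtain f1 g1 where f1: "f1 analytic_on {z}" "\<forall>\<^sub>F s in at z. f s = f1 s / (s - z)"
    and g1: "g1 analytic_on {z}" "\<forall>\<^sub>F s in at z. g s = g1 s / (s - z)"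
    using assms unfolding simple_poles_in_def by blast
  have "\<forall>\<^sub>F s in at z. f s + g s = (f1 s + g1 s) / (s - z)"
    using f1(2) g1(2) by eventually_elim (simp add: add_divide_distrib)
  then show "\<exists>h. h analytic_on {z} \<and> (\<forall>\<^sub>F s in at z. f s + g s = h s / (s - z))"
    using f1 g1 by (intro exI[of _ "\<lambda>s. f1 s + g1 s"]) (auto intro!: analytic_intros)
qed

lemma simple_poles_in_sum:
  "(\<And>i. i \<in> I \<Longrightarrow> simple_poles_in S (f i)) \<Longrightarrow> simple_poles_in S (\<lambda>s. \<Sum>i\<in>I. f i s)"
proof (induction I rule: infinite_finite_induct)
  case (insert x I)
  then show ?case using simple_poles_in_add[of S "f x" "\<lambda>s. \<Sum>i\<in>I. f i s"] by simp
qed (auto intro!: simple_poles_in_analytic)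

lemma simple_poles_in_mult:
  assumes "simple_poles_in S f" "h analytic_on UNIV"
  shows "simple_poles_in S (\<lambda>s. h s * f s)"
  unfolding simple_poles_in_def
proof (intro allI conjI impI)
  fix z
  have h: "h analytic_on {z}" using assms(2) by (rule analytic_on_subset) auto
  with assms show "z \<notin> S \<Longrightarrow> (\<lambda>s. h s * f s) analytic_on {z}" by (auto simp: simple_poles_in_def intro!: analytic_intros)
  obtain f1 where f1: "f1 analytic_on {z}" "\<forall>\<^sub>F s in at z. f s = f1 s / (s - z)"
    using assms unfolding simple_poles_in_def by blast
  have "\<forall>\<^sub>F s in at z. h s * f s = (h s * f1 s) / (s - z)"
    using f1(2) by eventually_elim simp
  then show "\<exists>g. g analytic_on {z} \<and> (\<forall>\<^sub>F s in at z. h s * f s = g s / (s - z))"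
    using f1 h by (intro exI[of _ "\<lambda>s. h s * f1 s"]) (auto intro!: analytic_intros)
qed

text \<open>At a pole \<open>g z \<noteq> 0\<close>, since otherwise the function would converge to
  \<open>deriv g z\<close>; so the order is exactly -1. A point outside \<open>S\<close> is no pole
  because the function is continuous there.\<close>

lemma simple_poles_inD:
  assumes "simple_poles_in S f"
  shows "f meromorphic_on UNIV" "f analytic_on (UNIV - S)" "is_pole f z \<Longrightarrow> z \<in> S \<and> zorder f z = -1"
proof -
  have "f meromorphic_on {z}" for z
  proof -
    obtain g where g: "g analytic_on {z}" "\<forall>\<^sub>F s in at z. f s = g s / (s - z)"
      using assms unfolding simple_poles_in_def by blast
    have "(\<lambda>s. g s / (s - z)) meromorphic_on {z}"
      using analytic_on_imp_meromorphic_on[OF g(1)]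
      by (intro meromorphic_on_divide analytic_on_imp_meromorphic_on[of "\<lambda>s. s - z"] analytic_intros)
    with g(2) show ?thesis by (subst meromorphic_on_cong[where g="\<lambda>s. g s / (s - z)" and B="{z}"]) auto
  qed
  then show "f meromorphic_on UNIV" unfolding meromorphic_on_def by blast
  show "f analytic_on (UNIV - S)" using assms unfolding simple_poles_in_def by (subst analytic_on_analytic_at) auto
  assume pole: "is_pole f z"
  show "z \<in> S \<and> zorder f z = -1"
  proof
    show "z \<in> S"
    proof (rule ccontr)
      assume "z \<notin> S"
      then have "f analytic_on {z}" using assms by (auto simp: simple_poles_in_def)
      then have "isCont f z" by (simp add: analytic_at_imp_isCont)
      with pole show False unfolding is_pole_def isCont_def
        using not_tendsto_and_filterlim_at_infinity[of "at z"] by auto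
    qed
    obtain g where g: "g analytic_on {z}" "\<forall>\<^sub>F s in at z. f s = g s / (s - z)"
      using assms unfolding simple_poles_in_def by blast
    obtain A where A: "open A" "z \<in> A" "g holomorphic_on A" using g(1) by (auto simp: analytic_at)
    have "g z \<noteq> 0"
    proof
      assume "g z = 0"
      have "((\<lambda>s. (g s - g z) / (s - z)) \<longlongrightarrow> deriv g z) (at z)"
        using holomorphic_derivI[OF A(3,1,2)] by (simp add: has_field_derivative_iff)
      then have "(f \<longlongrightarrow> deriv g z) (at z)"
        by (rule Lim_transform_eventually) (use g(2) \<open>g z = 0\<close> in \<open>auto elim: eventually_mono\<close>)
      with pole show False unfolding is_pole_def
        using not_tendsto_and_filterlim_at_infinity[of "at z"] by auto
    qed
    have "zorder f z = zorder (\<lambda>s. g s / (s - z)) z" using g(2) by (intro zorder_cong) auto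
    also have "\<dots> = -1"
      by (rule zorder_eqI[OF A \<open>g z \<noteq> 0\<close>]) (simp add: divide_inverse)
    finally show "zorder f z = -1" .
  qed
qed

text \<open>The result of \<open>N\<close> integrations by parts applied to the \<open>i\<close>-th
  member of the chain \<open>Hs\<close>, for the Mellin variable \<open>s + a + 2 i\<close>. As
  \<open>N\<close> descends \<open>i\<close> rises, since each step passes to the next member and
  raises the variable by 2.\<close>

primrec mellin_ext :: "real \<Rightarrow> real \<Rightarrow> (nat \<Rightarrow> complex \<Rightarrow> real \<Rightarrow> complex) \<Rightarrow> nat \<Rightarrow> nat \<Rightarrow> complex \<Rightarrow> complex" where
  "mellin_ext R a Hs 0 = (\<lambda>i s. mellin R (s + of_real (a + 2 * real i)) (Hs i s))"
| "mellin_ext R a Hs (Suc N) = (\<lambda>i s.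
     (of_real R powr (s + of_real (a + 2 * real i)) * Hs i s R - mellin_ext R a Hs N (Suc i) s)
       / (s + of_real (a + 2 * real i)))"

text \<open>\<open>N\<close> integrations by parts reach the half-plane
  \<open>Re s > - a - 2 N\<close>, and versions for different \<open>N\<close> agree where both
  apply (\<open>stable\<close>). The denominators accumulate, but each vanishes at one point only
  and no two of them at the same point, so the poles remain simple.\<close>

lemma mellin_continuation:
  assumes J: "J = {-e<..<e}" and R: "0 < R" "R \<le> 1" "R < e" and H: "even_family J H"
  shows "\<exists>f. simple_poles_in {- of_real a - 2 * of_nat j | j. True} f \<and>
    (\<forall>s. Re s > - a \<longrightarrow> f s = mellin R (s + of_real a) (H s))"
proof -
  have e: "e > 0" using R by simp
  have "\<exists>Hs. Hs 0 = H \<and> (\<forall>i. even_family J (Hs i) \<and> (\<forall>s. \<forall>r\<in>J. (Hs i s has_vector_derivative r *\<^sub>R Hs (Suc i) s r) (at r)))"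
  proof -
    have "\<exists>Hs. \<forall>i. (even_family J (Hs i) \<and> (i = 0 \<longrightarrow> Hs i = H)) \<and> (\<forall>s. \<forall>r\<in>J. (Hs i s has_vector_derivative r *\<^sub>R Hs (Suc i) s r) (at r))"
      by (rule dependent_nat_choice) (use H even_family_step[OF J e] in auto)
    then show ?thesis by blast
  qed
  then obtain Hs where Hs0: "Hs 0 = H" and Hs: "\<And>i. even_family J (Hs i)"
    and Hd: "\<And>i s r. r \<in> J \<Longrightarrow> (Hs i s has_vector_derivative r *\<^sub>R Hs (Suc i) s r) (at r)" by blast
  define G where "G = mellin_ext R a Hs"
  define w where "w i s = s + complex_of_real (a + 2 * real i)" for i s
  have G0: "G 0 i s = mellin R (w i s) (Hs i s)" for i s by (simp add: G_def w_def)
  have GS: "G (Suc N) i s = (of_real R powr w i s * Hs i s R - G N (Suc i) s) / w i s" for N i s by (simp add: G_def w_def)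
  have wS: "w (Suc i) s = w i s + 2" for i s by (simp add: w_def)
  have cont: "continuous_on (UNIV \<times> J) (\<lambda>(s,r). Hs i s r)" for i using Hs[of i] by (auto simp: even_family_def sm_continuous)
  have hol: "(\<lambda>s. Hs i s r) holomorphic_on UNIV" if "r \<in> J" for i r using Hs[of i] that by (auto simp: even_family_def)
  have step: "G (Suc N) i s = G N i s" if "Re (w i s) + 2 * real N > 0" for N i s
    using that
  proof (induction N arbitrary: i)
    case 0
    have "continuous_on {-e<..<e} (\<lambda>r. (s, r))" by (intro continuous_intros)
    from continuous_on_compose2[OF cont[of "Suc i"] this] J have "continuous_on {-e<..<e} (Hs (Suc i) s)" by auto
    from mellin_by_parts[OF R _ Hd[of _ i s] this, of "w i s"] 0 J show ?case
      by (simp add: GS G0 wS)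
  next
    case (Suc N)
    from Suc.IH[of "Suc i"] Suc.prems have "G (Suc N) (Suc i) s = G N (Suc i) s" by (simp add: wS)
    then show ?case by (subst (1 2) GS) simp
  qed
  have stable: "G N' i s = G N i s" if "Re (w i s) + 2 * real N > 0" "N \<le> N'" for N N' i s
    using that(2) by (induction rule: dec_induct) (use that(1) step in auto)
  have G0hol: "G 0 i holomorphic_on {s. Re s > - (a + 2 * real i)}" for i
    unfolding G0[abs_def] w_def
    by (rule mellin_holomorphic[OF R(1,2)]) (use J R in \<open>auto intro!: hol continuous_on_subset[OF cont]\<close>)
  let ?S = "{- of_real a - 2 * of_nat j | j. True} :: complex set"
  have main: "(z \<notin> ?S \<longrightarrow> G N i analytic_on {z}) \<and> (\<exists>g. g analytic_on {z} \<and> (\<forall>\<^sub>F s in at z. G N i s = g s / (s - z)))"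
    if "Re (w i z) + 2 * real N > 0" for N i z
    using that
  proof (induction N arbitrary: i)
    case 0
    have "G 0 i analytic_on {z}"
    proof (rule analytic_on_subset)
      show "G 0 i analytic_on {s. Re s > - (a + 2 * real i)}"
        using G0hol[of i] by (subst analytic_on_open) (auto simp: open_halfspace_Re_gt)
    qed (use 0 in \<open>auto simp: w_def\<close>)
    then show ?case
      by (auto intro!: exI[of _ "\<lambda>s. G 0 i s * (s - z)"] analytic_intros simp: eventually_at_filter)
  next
    case (Suc N)
    define A where "A s = of_real R powr w i s * Hs i s R" for s
    have "A holomorphic_on UNIV"
      using R J hol[of R i] unfolding A_def w_def powr_def by (auto intro!: holomorphic_intros)
    then have A: "A analytic_on {z}" by (metis analytic_on_open analytic_on_subset open_UNIV subset_UNIV)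
    have GA: "G (Suc N) i s = (A s - G N (Suc i) s) / w i s" for s by (simp add: GS A_def)
    have IH: "z \<notin> ?S \<Longrightarrow> G N (Suc i) analytic_on {z}" "\<exists>g. g analytic_on {z} \<and> (\<forall>\<^sub>F s in at z. G N (Suc i) s = g s / (s - z))"
      using Suc.IH[of "Suc i"] Suc.prems by (auto simp: wS)
    show ?case
    proof (cases "w i z = 0")
      case False
      then have wa: "(\<lambda>s. inverse (w i s)) analytic_on {z}" unfolding w_def by (auto intro!: analytic_intros)
      obtain g where g: "g analytic_on {z}" "\<forall>\<^sub>F s in at z. G N (Suc i) s = g s / (s - z)" using IH(2) by blast
      have "\<forall>\<^sub>F s in at z. G (Suc N) i s = ((A s * (s - z) - g s) * inverse (w i s)) / (s - z)"
        using g(2) eventually_neq_at_within[of z z UNIV]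
      proof eventually_elim
        case (elim s)
        have "((A s * (s - z) - g s) * inverse (w i s)) / (s - z) = (A s * (s - z) / (s - z) - g s / (s - z)) * inverse (w i s)"
          by (simp only: times_divide_eq_left diff_divide_distrib[symmetric])
        also have "A s * (s - z) / (s - z) = A s" using elim by simp
        also have "g s / (s - z) = G N (Suc i) s" using elim by simp
        finally show ?case by (simp only: GA divide_inverse)
      qed
      moreover have "(\<lambda>s. (A s * (s - z) - g s) * inverse (w i s)) analytic_on {z}"
        by (intro analytic_intros A g(1) wa)
      moreover have "G (Suc N) i analytic_on {z}" if "z \<notin> ?S"
        using analytic_on_mult[OF analytic_on_diff[OF A IH(1)[OF that]] wa] unfolding GA[abs_def] divide_inverse .
      ultimately show ?thesis by blast
    next
      \<comment> \<open>At the zero of the outer denominator the inner term is still given by its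
        convergent integral: the next Mellin variable is 2 at \<open>z\<close> and has positive real
        part on the unit disc around it. Hence no double pole arises.\<close>
      case True
      then have "z + (of_real a + 2 * of_nat i) = 0" by (simp add: w_def)
      then have zS: "z = - of_real a - 2 * of_nat i" by (simp only: eq_neg_iff_add_eq_0[symmetric]) simp
      then have "z \<in> ?S" by blast
      have near: "Re (w (Suc i) s) > 0" if "s \<in> ball z 1" for s
        using that abs_Re_le_cmod[of "z - s"] zS by (auto simp: w_def dist_norm)
      have "G N (Suc i) s = G 0 (Suc i) s" if "s \<in> ball z 1" for s
        using stable[of "Suc i" s 0 N] near[OF that] by simp
      moreover have "G 0 (Suc i) holomorphic_on ball z 1"
      proof (rule holomorphic_on_subset[OF G0hol], rule subsetI)
        fix s assume "s \<in> ball z 1"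
        from near[OF this] show "s \<in> {s. Re s > - (a + 2 * real (Suc i))}" by (simp add: w_def)
      qed
      ultimately have "G N (Suc i) holomorphic_on ball z 1" by (metis holomorphic_transform)
      then have "G N (Suc i) analytic_on {z}" by (auto simp: analytic_at intro!: exI[of _ "ball z 1"])
      with A have "(\<lambda>s. A s - G N (Suc i) s) analytic_on {z}" by (intro analytic_intros)
      moreover have "w i s = s - z" for s unfolding zS w_def by simp
      ultimately show ?thesis using \<open>z \<in> ?S\<close> by (auto simp: GA)
    qed
  qed
  \<comment> \<open>The number of integrations by parts depends on \<open>s\<close> and is large
    enough to reach it. Near a given point \<open>f\<close> agrees with the version for one fixed
    number, from which analyticity is read off.\<close>
  define f where "f s = G (nat \<lceil>\<bar>Re s + a\<bar>\<rceil> + 1) 0 s" for s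
  have f_eq: "f s = G N 0 s" if "Re s + a + 2 * real N > 0" for N s
  proof -
    define M where "M = nat \<lceil>\<bar>Re s + a\<bar>\<rceil> + 1"
    have "real M \<ge> \<bar>Re s + a\<bar> + 1" unfolding M_def by linarith
    then have "Re (w 0 s) + 2 * real M > 0" by (simp add: w_def)
    from stable[OF this, of "max M N"] stable[of 0 s N "max M N"] that show ?thesis
      unfolding f_def M_def[symmetric] by (simp add: w_def)
  qed
  have "(z \<notin> ?S \<longrightarrow> f analytic_on {z}) \<and> (\<exists>g. g analytic_on {z} \<and> (\<forall>\<^sub>F s in at z. f s = g s / (s - z)))" for z
  proof -
    define N where "N = nat \<lceil>\<bar>Re z + a\<bar>\<rceil> + 2"
    have N: "real N \<ge> \<bar>Re z + a\<bar> + 2" unfolding N_def by linarith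
    have eq: "f s = G N 0 s" if "s \<in> ball z 1" for s
    proof -
      have "\<bar>Re z - Re s\<bar> < 1" using that abs_Re_le_cmod[of "z - s"] by (simp add: dist_norm)
      with N show ?thesis by (intro f_eq) linarith
    qed
    have ev: "\<forall>\<^sub>F s in nhds z. s \<in> ball z 1" by (intro eventually_nhds_in_open) auto
    have "f analytic_on {z} \<longleftrightarrow> G N 0 analytic_on {z}"
      by (rule analytic_at_cong) (use ev eq in \<open>auto elim: eventually_mono\<close>)
    moreover have ev2: "\<forall>\<^sub>F s in at z. f s = G N 0 s"
      using ev eq by (auto simp: eventually_at_filter elim: eventually_mono)
    moreover have "Re (w 0 z) + 2 * real N > 0" using N by (simp add: w_def)
    note M = main[OF this]
    moreover obtain g where "g analytic_on {z}" "\<forall>\<^sub>F s in at z. G N 0 s = g s / (s - z)" using M by blast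
    moreover from this(2) ev2 have "\<forall>\<^sub>F s in at z. f s = g s / (s - z)" by eventually_elim simp
    ultimately show ?thesis by blast
  qed
  then have "simple_poles_in ?S f" by (simp add: simple_poles_in_def)
  moreover have "f s = mellin R (s + of_real a) (H s)" if "Re s > - a" for s
    using f_eq[of s 0] that by (simp add: G0 w_def Hs0)
  ultimately show ?thesis by blast
qed

text \<open>The abstract form of the contribution of the diagonal: \<open>Q \<times> (0,R]\<close> are blown-up coordinates, \<open>exp \<circ> l\<close>
  is the blown-up distance, and \<open>\<sigma>\<close> is the reflection of the blow-up.\<close>

lemma blowup_continuation:
  fixes c :: "'i \<Rightarrow> 'p::euclidean_space \<Rightarrow> real \<Rightarrow> real" and l :: "'p \<Rightarrow> real \<Rightarrow> real" and q :: "'i \<Rightarrow> complex \<Rightarrow> complex"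
  assumes J: "J = {-e<..<e}" and R: "0 < R" "R \<le> 1" "R < e"
    and M: "sets M = sets borel" "emeasure M P0 < \<infinity>" and P0: "compact P0" and P: "P \<in> sets borel" "P \<subseteq> P0"
    and q: "\<And>i. i \<in> I \<Longrightarrow> q i holomorphic_on UNIV"
    and c: "\<And>i. i \<in> I \<Longrightarrow> sm P0 J (c i)" and ll: "sm P0 J l"
    and \<sigma>: "distr M borel \<sigma> = M" "\<sigma> \<in> borel \<rightarrow>\<^sub>M borel" "\<And>p. \<sigma> p \<in> P \<longleftrightarrow> p \<in> P"
    and sym: "\<And>i p r. i \<in> I \<Longrightarrow> p \<in> P \<Longrightarrow> r \<in> J \<Longrightarrow> c i (\<sigma> p) (-r) = c i p r" "\<And>p r. p \<in> P \<Longrightarrow> r \<in> J \<Longrightarrow> l (\<sigma> p) (-r) = l p r"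
  shows "\<exists>f. simple_poles_in {- of_real a - 2 * of_nat j | j. True} f \<and>
    (\<forall>s. Re s > - a \<longrightarrow> f s = mellin R (s + of_real a) (\<lambda>r. \<integral>p. indicator P p *\<^sub>R ((\<Sum>i\<in>I. q i s * of_real (c i p r)) * exp (s * of_real (l p r))) \<partial>M))"
proof -
  define F where "F p s r = (\<Sum>i\<in>I. q i s * of_real (c i p r)) * exp (s * of_real (l p r))" for p and s :: complex and r
  have oJ: "open J" using J by simp
  have ckF: "ck n (P0 \<times> UNIV) J (\<lambda>x. F (fst x) (snd x))" for n
  proof -
    have ckx: "ck n (P0 \<times> (UNIV::complex set)) J (\<lambda>x r. of_real (u (fst x) r) :: complex)" if "sm P0 J u" for u
    proof (rule ck_linear[OF bounded_linear_of_real])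
      show "ck n (P0 \<times> (UNIV::complex set)) J (\<lambda>x r. u (fst x) r)"
        by (rule ck_param) (use that in \<open>auto simp: sm_def intro: continuous_intros\<close>)
    qed
    have "ck n (P0 \<times> (UNIV::complex set)) J (\<lambda>x r. snd x)" by (rule ck_const) (intro continuous_intros)
    moreover have "ck n (P0 \<times> (UNIV::complex set)) J (\<lambda>x r. q i (snd x))" if "i \<in> I" for i
      by (rule ck_const) (intro continuous_on_compose2[OF holomorphic_on_imp_continuous_on[OF q[OF that]]] continuous_intros, auto)
    ultimately show ?thesis unfolding F_def by (intro ck_mult ck_exp ck_sum ckx c ll)
  qed
  define H where "H s r = (\<integral>p. indicator P p *\<^sub>R F p s r \<partial>M)" for s r
  have "sm UNIV J H" unfolding sm_def H_def
    using ck_lebesgue_integral[OF M P0 P oJ ckF] by blast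
  moreover have "(\<lambda>s. H s r) holomorphic_on UNIV" if r: "r \<in> J" for r
    unfolding H_def
  proof (rule holomorphic_on_lebesgue_integral)
    note cl = continuous_on_lebesgue_integral[OF M P0 P oJ ck_continuous[OF ckF]]
    show "(\<lambda>s. indicator P p *\<^sub>R F p s r) holomorphic_on UNIV" for p
      unfolding F_def scaleR_conv_of_real by (intro holomorphic_intros q)
    show "(\<lambda>p. indicator P p *\<^sub>R F p s r) \<in> borel_measurable M" for s
      using cl(1)[OF r] by (rule borel_measurable_integrable)
    fix s :: complex
    have "cball s 1 \<times> {r} \<subseteq> UNIV \<times> J" using r by auto
    from cl(2)[OF compact_Times[OF compact_cball] this] obtain B where
      B: "\<And>p t. p \<in> P0 \<Longrightarrow> t \<in> cball s 1 \<Longrightarrow> norm (F p t r) \<le> B" by fastforce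
    have "emeasure M P < \<infinity>" using emeasure_mono[OF P(2), of M] M P0 by (auto simp: compact_imp_closed)
    then have "integrable M (\<lambda>p. indicator P p * B)" using M(1) P(1) by (intro integrable_mult_left integrable_real_indicator) auto
    moreover have "norm (indicator P p *\<^sub>R F p t r) \<le> indicator P p * B" if "t \<in> cball s 1" for p t
      using B[OF _ that] P(2) by (auto simp: indicator_def)
    ultimately show "\<exists>d>0. \<exists>g. cball s d \<subseteq> UNIV \<and> integrable M g \<and> (\<forall>p\<in>space M. \<forall>t\<in>cball s d. norm (indicator P p *\<^sub>R F p t r) \<le> g p)"
      by (intro exI[of _ 1] exI[of _ "\<lambda>p. indicator P p * B"] conjI ballI) auto
  qed auto
  moreover have "H s (-r) = H s r" if r: "r \<in> J" for s r
  proof -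
    have r': "-r \<in> J" using r J by auto
    have m: "(\<lambda>p. indicator P p *\<^sub>R F p s (-r)) \<in> borel_measurable M"
      using continuous_on_lebesgue_integral(1)[OF M P0 P oJ ck_continuous[OF ckF] r'] by (rule borel_measurable_integrable)
    have \<sigma>m: "\<sigma> \<in> M \<rightarrow>\<^sub>M borel" using \<sigma>(2) M(1) measurable_cong_sets by blast
    have "H s (-r) = (\<integral>p. indicator P p *\<^sub>R F p s (-r) \<partial>distr M borel \<sigma>)" by (simp add: H_def \<sigma>(1))
    also have "\<dots> = (\<integral>p. indicator P (\<sigma> p) *\<^sub>R F (\<sigma> p) s (-r) \<partial>M)"
      using m M(1) by (intro integral_distr[OF \<sigma>m]) (simp cong: measurable_cong_sets)
    also have "\<dots> = H s r" unfolding H_def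
      by (intro Bochner_Integration.integral_cong refl) (use \<sigma>(3) sym r in \<open>auto simp: indicator_def F_def\<close>)
    finally show ?thesis .
  qed
  ultimately have "even_family J H" by (auto simp: even_family_def)
  from mellin_continuation[OF J R this, of a] show ?thesis unfolding H_def F_def .
qed

section \<open>Charts of a submanifold\<close>

text \<open>The recursion of \<open>iter_dderiv\<close> adds derivatives on the outside, whereas
  smoothness of \<open>dderiv f v\<close> requires one to be split off on the inside.\<close>

lemma iter_dderiv_append: "iter_dderiv (vs @ [v]) f = iter_dderiv vs (dderiv f v)"
  by (induction vs) auto

lemma smooth_on_dderiv: "smooth_on U f \<Longrightarrow> smooth_on U (dderiv f v)"
  unfolding smooth_on_def iter_dderiv_append[symmetric] by blast

lemma smooth_on_imp_continuous_on: "smooth_on U f \<Longrightarrow> continuous_on U f"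
  unfolding smooth_on_def by (metis iter_dderiv.simps(1))

lemma smooth_on_has_vector_derivative:
  assumes "smooth_on U f" "x \<in> U"
  shows "((\<lambda>t. f (x + t *\<^sub>R v)) has_vector_derivative dderiv f v x) (at 0)"
proof -
  from assms have "(\<lambda>t::real. f (x + t *\<^sub>R v)) differentiable (at 0)"
    unfolding smooth_on_def by (metis iter_dderiv.simps(1))
  then show ?thesis unfolding dderiv_def vector_derivative_works .
qed

lemma smooth_on_has_vector_derivative':
  assumes "smooth_on U f" "x + t *\<^sub>R v \<in> U"
  shows "((\<lambda>t. f (x + t *\<^sub>R v)) has_vector_derivative dderiv f v (x + t *\<^sub>R v)) (at t)"
proof -
  have "((\<lambda>s. s - t) has_vector_derivative 1) (at t)" by (auto intro!: derivative_eq_intros)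
  from vector_diff_chain_at[OF this, of "\<lambda>s. f ((x + t *\<^sub>R v) + s *\<^sub>R v)" "dderiv f v (x + t *\<^sub>R v)"]
    smooth_on_has_vector_derivative[OF assms]
  show ?thesis by (simp add: o_def algebra_simps)
qed

lemma norm_sum_coords_le:
  fixes h :: "'n::euclidean_space"
  assumes "B \<subseteq> Basis"
  shows "norm (\<Sum>b\<in>B. (h \<bullet> b) *\<^sub>R b) \<le> real DIM('n) * norm h"
proof -
  have "norm (\<Sum>b\<in>B. (h \<bullet> b) *\<^sub>R b) \<le> (\<Sum>b\<in>B. norm h)"
    using assms Basis_le_norm[of _ h] by (intro sum_norm_le) (auto simp: norm_Basis)
  also have "\<dots> \<le> real DIM('n) * norm h"
    using card_mono[OF finite_Basis assms] by (simp add: mult_right_mono)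
  finally show ?thesis .
qed

text \<open>Continuous partial derivatives give a total derivative. The increment is built up one
  coordinate at a time, by induction over the set \<open>B\<close> of coordinates already moved,
  with the mean value inequality for each new one.\<close>

lemma smooth_on_has_derivative_sum:
  fixes f :: "'n::euclidean_space \<Rightarrow> 'b::real_normed_vector"
  assumes f: "smooth_on U f" and U: "open U" and x: "x \<in> U"
  shows "(f has_derivative (\<lambda>h. \<Sum>b\<in>Basis. (h \<bullet> b) *\<^sub>R dderiv f b x)) (at x)"
proof -
  have "\<forall>\<epsilon>>0. \<exists>d>0. \<forall>h. norm h < d \<longrightarrow>
      norm (f (x + (\<Sum>b\<in>B. (h \<bullet> b) *\<^sub>R b)) - f x - (\<Sum>b\<in>B. (h \<bullet> b) *\<^sub>R dderiv f b x)) \<le> \<epsilon> * norm h"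
    if "finite B" "B \<subseteq> Basis" for B :: "'n set"
    using that
  proof (induction B rule: finite_induct)
    case empty
    then show ?case by (auto intro!: exI[of _ 1])
  next
    case (insert c B)
    show ?case
    proof (intro allI impI)
      fix \<epsilon> :: real assume \<epsilon>: "\<epsilon> > 0"
      have "B \<subseteq> Basis" using insert by auto
      from insert.IH[OF this, rule_format, of "\<epsilon>/2"] \<epsilon> obtain d1 where d1: "d1 > 0" "\<And>h. norm h < d1 \<Longrightarrow>
          norm (f (x + (\<Sum>b\<in>B. (h \<bullet> b) *\<^sub>R b)) - f x - (\<Sum>b\<in>B. (h \<bullet> b) *\<^sub>R dderiv f b x)) \<le> (\<epsilon>/2) * norm h"
        by auto
      have "isCont (dderiv f c) x"
        using smooth_on_imp_continuous_on[OF smooth_on_dderiv[OF f]] U x by (simp add: continuous_on_eq_continuous_at)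
      then obtain d2 where d2: "d2 > 0" "\<And>y. dist y x < d2 \<Longrightarrow> dist (dderiv f c y) (dderiv f c x) < \<epsilon>/2"
        using \<epsilon> unfolding continuous_at_eps_delta by (metis half_gt_zero)
      obtain d3 where d3: "d3 > 0" "ball x d3 \<subseteq> U" using U x open_contains_ball by blast
      \<comment> \<open>A partial sum of coordinates is bounded by \<open>DIM('n)\<close> times the
        norm of \<open>h\<close>, and one further coordinate step adds at most that norm once
        more.\<close>
      define D where "D = real DIM('n) + 1"
      have D: "D > 0" by (simp add: D_def)
      define d where "d = min d1 (min d2 d3 / D)"
      have "d > 0" using d1 d2 d3 D by (simp add: d_def)
      moreover have "norm (f (x + (\<Sum>b\<in>insert c B. (h \<bullet> b) *\<^sub>R b)) - f x - (\<Sum>b\<in>insert c B. (h \<bullet> b) *\<^sub>R dderiv f b x)) \<le> \<epsilon> * norm h"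
        if h: "norm h < d" for h
      proof -
        define p where "p = x + (\<Sum>b\<in>B. (h \<bullet> b) *\<^sub>R b)"
        have c: "c \<in> Basis" "B \<subseteq> Basis" using insert by auto
        have near: "dist (p + t *\<^sub>R c) x < min d2 d3" if "\<bar>t\<bar> \<le> \<bar>h \<bullet> c\<bar>" for t
        proof -
          have "norm (p + t *\<^sub>R c - x) \<le> norm (\<Sum>b\<in>B. (h \<bullet> b) *\<^sub>R b) + norm (t *\<^sub>R c)"
            unfolding p_def using norm_triangle_ineq[of "\<Sum>b\<in>B. (h \<bullet> b) *\<^sub>R b" "t *\<^sub>R c"] by (simp add: algebra_simps)
          also have "\<dots> \<le> real DIM('n) * norm h + norm h"
            using norm_sum_coords_le[OF c(2), of h] that Basis_le_norm[OF c(1), of h] c(1) by (intro add_mono) auto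
          also have "\<dots> = D * norm h" by (simp add: D_def algebra_simps)
          also have "\<dots> < min d2 d3" using h D by (simp add: d_def field_simps)
          finally show ?thesis by (simp add: dist_norm)
        qed
        \<comment> \<open>With the expected linear term subtracted, the derivative along the segment
          is at most \<open>\<epsilon> / 2\<close>, so the mean value inequality bounds the error
          itself.\<close>
        define g where "g t = f (p + t *\<^sub>R c) - t *\<^sub>R dderiv f c x" for t
        have "norm (g (h \<bullet> c) - g 0) \<le> (\<epsilon>/2) * norm (h \<bullet> c - 0)"
        proof (rule differentiable_bound[OF convex_closed_segment[of 0 "h \<bullet> c"]])
          fix t assume t: "t \<in> closed_segment 0 (h \<bullet> c)"
          then have t': "\<bar>t\<bar> \<le> \<bar>h \<bullet> c\<bar>" by (auto simp: closed_segment_eq_real_ivl split: if_splits)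
          then have "p + t *\<^sub>R c \<in> U" using near[OF t'] d3 by (auto simp: dist_commute subset_iff)
          from smooth_on_has_vector_derivative'[OF f this]
          have "(g has_vector_derivative (dderiv f c (p + t *\<^sub>R c) - dderiv f c x)) (at t)"
            unfolding g_def by (auto intro!: derivative_eq_intros)
          then show "(g has_derivative (\<lambda>s. s *\<^sub>R (dderiv f c (p + t *\<^sub>R c) - dderiv f c x))) (at t within closed_segment 0 (h \<bullet> c))"
            unfolding has_vector_derivative_def by (rule has_derivative_at_withinI)
          have le: "norm (dderiv f c (p + t *\<^sub>R c) - dderiv f c x) \<le> \<epsilon>/2"
            using d2(2)[of "p + t *\<^sub>R c"] near[OF t'] by (simp add: dist_norm)
          show "onorm (\<lambda>s. s *\<^sub>R (dderiv f c (p + t *\<^sub>R c) - dderiv f c x)) \<le> \<epsilon>/2"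
          proof (rule onorm_bound)
            show "norm (s *\<^sub>R (dderiv f c (p + t *\<^sub>R c) - dderiv f c x)) \<le> \<epsilon>/2 * norm s" for s
              using mult_right_mono[OF le abs_ge_zero[of s]] by (simp add: mult.commute)
          qed (use \<epsilon> in simp)
        qed auto
        then have "norm (g (h \<bullet> c) - g 0) \<le> (\<epsilon>/2) * norm h"
          using Basis_le_norm[OF c(1), of h] \<epsilon> by (auto intro: order.trans mult_left_mono)
        moreover have "norm (f p - f x - (\<Sum>b\<in>B. (h \<bullet> b) *\<^sub>R dderiv f b x)) \<le> (\<epsilon>/2) * norm h"
          unfolding p_def using h by (intro d1(2)) (simp add: d_def)
        ultimately have "norm ((g (h \<bullet> c) - g 0) + (f p - f x - (\<Sum>b\<in>B. (h \<bullet> b) *\<^sub>R dderiv f b x))) \<le> \<epsilon> * norm h"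
          by (intro order.trans[OF norm_triangle_ineq]) simp
        also have "(g (h \<bullet> c) - g 0) + (f p - f x - (\<Sum>b\<in>B. (h \<bullet> b) *\<^sub>R dderiv f b x)) =
           f (x + (\<Sum>b\<in>insert c B. (h \<bullet> b) *\<^sub>R b)) - f x - (\<Sum>b\<in>insert c B. (h \<bullet> b) *\<^sub>R dderiv f b x)"
          using insert(1,2) by (simp add: g_def p_def algebra_simps)
        finally show ?thesis .
      qed
      ultimately show "\<exists>d>0. \<forall>h. norm h < d \<longrightarrow> norm (f (x + (\<Sum>b\<in>insert c B. (h \<bullet> b) *\<^sub>R b)) - f x - (\<Sum>b\<in>insert c B. (h \<bullet> b) *\<^sub>R dderiv f b x)) \<le> \<epsilon> * norm h"
        by blast
    qed
  qed
  from this[OF finite_Basis order.refl] have *: "\<forall>\<epsilon>>0. \<exists>d>0. \<forall>h. norm h < d \<longrightarrow>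
      norm (f (x + h) - f x - (\<Sum>b\<in>Basis. (h \<bullet> b) *\<^sub>R dderiv f b x)) \<le> \<epsilon> * norm h"
    by (simp add: euclidean_representation)
  show ?thesis unfolding has_derivative_within_alt
  proof (intro conjI allI impI)
    show "bounded_linear (\<lambda>h. \<Sum>b\<in>Basis. (h \<bullet> b) *\<^sub>R dderiv f b x)"
      by (intro bounded_linear_sum bounded_linear_scaleR_const bounded_linear_inner_left)
    fix \<epsilon> :: real assume "\<epsilon> > 0"
    with * obtain d where "d > 0" "\<And>h. norm h < d \<Longrightarrow> norm (f (x + h) - f x - (\<Sum>b\<in>Basis. (h \<bullet> b) *\<^sub>R dderiv f b x)) \<le> \<epsilon> * norm h" by blast
    from this(1) this(2)[of "_ - x"] show "\<exists>d>0. \<forall>y\<in>UNIV. norm (y - x) < d \<longrightarrow>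
        norm (f y - f x - (\<Sum>b\<in>Basis. ((y - x) \<bullet> b) *\<^sub>R dderiv f b x)) \<le> \<epsilon> * norm (y - x)" by auto
  qed
qed

text \<open>\<open>dderiv\<close> is a derivative along a line, so linearity in the direction is not
  built in; it follows from the existence of the total derivative.\<close>

lemma dderiv_eq_sum:
  assumes "smooth_on U f" "open U" "x \<in> U"
  shows "dderiv f v x = (\<Sum>b\<in>Basis. (v \<bullet> b) *\<^sub>R dderiv f b x)"
proof -
  have "((\<lambda>t. x + t *\<^sub>R v) has_derivative (\<lambda>t. t *\<^sub>R v)) (at 0)" by (auto intro!: derivative_eq_intros)
  from has_derivative_compose[OF this, of f "\<lambda>h. \<Sum>b\<in>Basis. (h \<bullet> b) *\<^sub>R dderiv f b x"] smooth_on_has_derivative_sum[OF assms]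
  have "((\<lambda>t. f (x + t *\<^sub>R v)) has_derivative (\<lambda>t. \<Sum>b\<in>Basis. (t *\<^sub>R v \<bullet> b) *\<^sub>R dderiv f b x)) (at 0)"
    by simp
  then have "((\<lambda>t. f (x + t *\<^sub>R v)) has_vector_derivative (\<Sum>b\<in>Basis. (v \<bullet> b) *\<^sub>R dderiv f b x)) (at 0)"
    by (simp add: has_vector_derivative_def scaleR_sum_right)
  from vector_derivative_unique_at[OF smooth_on_has_vector_derivative[OF assms(1,3)] this] show ?thesis .
qed

lemma smooth_on_has_derivative:
  assumes "smooth_on U f" "open U" "x \<in> U"
  shows "(f has_derivative (\<lambda>h. dderiv f h x)) (at x)"
  using smooth_on_has_derivative_sum[OF assms] by (simp add: dderiv_eq_sum[OF assms, symmetric])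

text \<open>The inverse of a chart is defined only on \<open>M\<close>, so the inverse function
  theorem does not apply to it directly. Instead, continuity of \<open>g\<close>, differentiability
  of \<open>f \<circ> g\<close> and a left inverse of \<open>f'\<close> together force
  \<open>g\<close> to be differentiable. This serves transition maps and curves on the
  manifold.\<close>

lemma has_derivative_left_inverse:
  fixes f :: "'n::real_normed_vector \<Rightarrow> 'a::real_normed_vector" and g :: "'x::real_normed_vector \<Rightarrow> 'n"
  assumes f: "(f has_derivative f') (at (g x))" and L: "bounded_linear L" "\<And>z. L (f' z) = z"
    and cont: "continuous (at x within S) g"
    and fg: "((\<lambda>y. f (g y)) has_derivative D) (at x within S)"
  shows "(g has_derivative (\<lambda>y. L (D y))) (at x within S)"
  unfolding has_derivative_within_alt
proof (intro conjI allI impI)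
  interpret D: bounded_linear D using fg by (rule has_derivative_bounded_linear)
  interpret L: bounded_linear L by fact
  show "bounded_linear (\<lambda>y. L (D y))" using bounded_linear_compose[OF L(1) D.bounded_linear_axioms] by simp
  obtain K where K: "K > 0" "\<And>z. norm (L z) \<le> norm z * K" using L.pos_bounded by blast
  obtain KD where KD: "KD > 0" "\<And>z. norm (D z) \<le> norm z * KD" using D.pos_bounded by blast
  \<comment> \<open>A Lipschitz constant for \<open>g\<close> at \<open>x\<close>: once
    \<open>e1 * K \<le> 1/2\<close>, half of the increment of \<open>g\<close> is absorbed on the
    left, which doubles the remaining constant \<open>KD * K + K\<close>.\<close>
  define C where "C = 2 * (KD * K + K)"
  have C: "C > 0" using K KD by (simp add: C_def add_pos_pos)
  fix e :: real assume e: "e > 0"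
  define e1 where "e1 = min (1 / (2 * K)) (e / (2 * K * C))"
  define e2 where "e2 = min 1 (e / (2 * K))"
  have e1: "e1 > 0" "e1 * K \<le> 1/2" "e1 * K * C \<le> e/2" using e K C by (auto simp: e1_def min_def field_simps)
  have e2: "e2 > 0" "e2 \<le> 1" "e2 * K \<le> e / 2" using e K by (auto simp: e2_def min_def field_simps)
  obtain d1 where d1: "d1 > 0" "\<And>z. norm (z - g x) < d1 \<Longrightarrow> norm (f z - f (g x) - f' (z - g x)) \<le> e1 * norm (z - g x)"
    using f e1(1) unfolding has_derivative_within_alt by blast
  obtain d2 where d2: "d2 > 0" "\<And>y. y \<in> S \<Longrightarrow> norm (y - x) < d2 \<Longrightarrow> norm (f (g y) - f (g x) - D (y - x)) \<le> e2 * norm (y - x)"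
    using fg e2(1) unfolding has_derivative_within_alt by blast
  obtain d3 where d3: "d3 > 0" "\<And>y. y \<in> S \<Longrightarrow> norm (y - x) < d3 \<Longrightarrow> norm (g y - g x) < d1"
    using cont d1(1) unfolding continuous_within_eps_delta dist_norm by metis
  have "norm (g y - g x - L (D (y - x))) \<le> e * norm (y - x)" if y: "y \<in> S" "norm (y - x) < min d2 d3" for y
  proof -
    have a: "norm (L (f (g y) - f (g x)) - (g y - g x)) \<le> e1 * K * norm (g y - g x)"
    proof -
      have "L (f (g y) - f (g x)) - (g y - g x) = L (f (g y) - f (g x) - f' (g y - g x))"
        by (simp add: L.diff L(2))
      also have "norm \<dots> \<le> e1 * norm (g y - g x) * K"
        using K(2)[of "f (g y) - f (g x) - f' (g y - g x)"] d1(2)[OF d3(2)[of y]] y K(1)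
        by (auto intro: order.trans mult_right_mono)
      finally show ?thesis by (simp add: ac_simps)
    qed
    have b: "norm (L (f (g y) - f (g x)) - L (D (y - x))) \<le> e2 * K * norm (y - x)"
    proof -
      have "norm (L (f (g y) - f (g x) - D (y - x))) \<le> e2 * norm (y - x) * K"
        using K(2)[of "f (g y) - f (g x) - D (y - x)"] d2(2)[of y] y K(1)
        by (auto intro: order.trans mult_right_mono)
      then show ?thesis by (simp add: L.diff ac_simps)
    qed
    have m: "norm (g y - g x - L (D (y - x))) \<le> e1 * K * norm (g y - g x) + e2 * K * norm (y - x)"
      using a b norm_triangle_ineq4[of "L (f (g y) - f (g x)) - L (D (y - x))" "L (f (g y) - f (g x)) - (g y - g x)"]
      by (simp add: algebra_simps)
    have "norm (g y - g x) \<le> norm (g y - g x - L (D (y - x))) + norm (L (D (y - x)))"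
      using norm_triangle_ineq[of "g y - g x - L (D (y - x))" "L (D (y - x))"] by simp
    moreover have "norm (L (D (y - x))) \<le> KD * K * norm (y - x)"
      using K(2)[of "D (y - x)"] KD(2)[of "y - x"] K(1) by (auto intro: order.trans mult_right_mono simp: ac_simps)
    moreover have "e1 * K * norm (g y - g x) \<le> 1/2 * norm (g y - g x)" using e1(2) by (intro mult_right_mono) auto
    moreover have "e2 * K * norm (y - x) \<le> K * norm (y - x)" using e2 K by (intro mult_right_mono) auto
    ultimately have "norm (g y - g x) \<le> C * norm (y - x)" using m by (simp add: C_def algebra_simps)
    then have "e1 * K * norm (g y - g x) \<le> e1 * K * (C * norm (y - x))" using e1 K by (intro mult_left_mono) auto
    also have "\<dots> \<le> e/2 * norm (y - x)" using mult_right_mono[OF e1(3), of "norm (y - x)"] by (simp add: ac_simps)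
    finally have "e1 * K * norm (g y - g x) \<le> e/2 * norm (y - x)" .
    moreover have "e2 * K * norm (y - x) \<le> e/2 * norm (y - x)" using e2 by (intro mult_right_mono) auto
    ultimately show ?thesis using m by simp
  qed
  then show "\<exists>d>0. \<forall>y\<in>S. norm (y - x) < d \<longrightarrow> norm (g y - g x - L (D (y - x))) \<le> e * norm (y - x)"
    using d2(1) d3(1) by (intro exI[of _ "min d2 d3"]) auto
qed

lemma local_paramD:
  assumes "local_param M V \<phi>"
  shows "open V" "smooth_on V \<phi>" "inj_on \<phi> V" "continuous_on (\<phi> ` V) (inv_into V \<phi>)" "continuous_on V \<phi>"
    "\<exists>U. open U \<and> \<phi> ` V = M \<inter> U"
    "\<And>x. x \<in> V \<Longrightarrow> (\<phi> has_derivative (\<lambda>h. dderiv \<phi> h x)) (at x)"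
    "\<And>x v. x \<in> V \<Longrightarrow> dderiv \<phi> v x = (\<Sum>b\<in>Basis. (v \<bullet> b) *\<^sub>R dderiv \<phi> b x)"
    "\<And>x. x \<in> V \<Longrightarrow> linear (\<lambda>h. dderiv \<phi> h x)"
  using assms smooth_on_has_derivative[of V \<phi>] dderiv_eq_sum[of V \<phi>]
  by (auto simp: local_param_def smooth_on_imp_continuous_on intro: has_derivative_linear)

lemma local_param_inj_deriv:
  fixes \<phi> :: "'n::euclidean_space \<Rightarrow> 'a::euclidean_space"
  assumes "local_param M V \<phi>" "x \<in> V"
  shows "inj (\<lambda>h. dderiv \<phi> h x)"
proof -
  have lin: "linear (\<lambda>h. dderiv \<phi> h x)" using local_paramD(9)[OF assms] .
  have ind: "independent ((\<lambda>b. dderiv \<phi> b x) ` Basis)" and inj: "inj_on (\<lambda>b. dderiv \<phi> b x) Basis"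
    using assms by (auto simp: local_param_def)
  have "h = 0" if "dderiv \<phi> h x = 0" for h
  proof -
    have "0 = (\<Sum>b\<in>Basis. (h \<bullet> b) *\<^sub>R dderiv \<phi> b x)" using that local_paramD(8)[OF assms, of h] by simp
    also have "\<dots> = (\<Sum>v\<in>(\<lambda>b. dderiv \<phi> b x) ` Basis. (h \<bullet> inv_into Basis (\<lambda>b. dderiv \<phi> b x) v) *\<^sub>R v)"
      by (subst sum.reindex[OF inj]) (auto intro!: sum.cong simp: inv_into_f_f[OF inj])
    finally have *: "(\<Sum>v\<in>(\<lambda>b. dderiv \<phi> b x) ` Basis. (h \<bullet> inv_into Basis (\<lambda>b. dderiv \<phi> b x) v) *\<^sub>R v) = 0" by simp
    have "h \<bullet> b = 0" if b: "b \<in> Basis" for b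
      using independentD[OF ind _ order.refl *, of "dderiv \<phi> b x"] b by (simp add: inv_into_f_f[OF inj])
    then show ?thesis using euclidean_all_zero_iff by blast
  qed
  then show ?thesis by (auto simp: linear_injective_0[OF lin])
qed

lemma local_param_left_inverse:
  fixes \<phi> :: "'n::euclidean_space \<Rightarrow> 'a::euclidean_space"
  assumes "local_param M V \<phi>" "x \<in> V"
  obtains L where "bounded_linear L" "\<And>z. L (dderiv \<phi> z x) = z"
proof -
  from linear_injective_left_inverse[OF local_paramD(9)[OF assms] local_param_inj_deriv[OF assms]]
  obtain L where "linear L" "L \<circ> (\<lambda>h. dderiv \<phi> h x) = id" by blast
  then show thesis by (intro that[of L]) (auto simp: linear_conv_bounded_linear fun_eq_iff)
qed

section \<open>Change of variables and Gram determinants\<close>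

text \<open>The library proves the change of variables formula on \<open>real ^ 'm\<close> only; the type of
  Cartesian indices below provides, for every Euclidean space, such a coordinate space.\<close>

typedef (overloaded) ('n::euclidean_space) bidx = "Basis :: 'n set" morphisms bvec bidx
  using nonempty_Basis by blast

lemma bvec_Basis [simp]: "bvec i \<in> Basis"
  by (rule bvec)

lemma bij_bvec: "bij_betw (bvec :: 'n::euclidean_space bidx \<Rightarrow> 'n) UNIV Basis"
  unfolding bij_betw_def inj_on_def
  using type_definition.Rep_range[OF type_definition_bidx] by (auto simp: bvec_inject)

lemma sum_bvec: "(\<Sum>i\<in>UNIV. f (bvec i)) = (\<Sum>b\<in>(Basis::'n::euclidean_space set). f b)"
  using sum.reindex_bij_betw[OF bij_bvec] .

lemma prod_bvec: "(\<Prod>i\<in>UNIV. f (bvec i)) = (\<Prod>b\<in>(Basis::'n::euclidean_space set). f b)"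
  using prod.reindex_bij_betw[OF bij_bvec] .

instance bidx :: (euclidean_space) finite
  using bij_betw_finite[OF bij_bvec] by intro_classes simp

text \<open>An enumeration of the finite index type provides the well-order that the change of
  variables formula asks of its index type.\<close>

instantiation bidx :: (euclidean_space) wellorder
begin

definition "i \<le> j \<longleftrightarrow> to_nat_on (UNIV :: 'a bidx set) i \<le> to_nat_on UNIV j"
definition "i < j \<longleftrightarrow> to_nat_on (UNIV :: 'a bidx set) i < to_nat_on UNIV j"

instance
proof
  fix P :: "'a bidx \<Rightarrow> bool" and a :: "'a bidx"
  assume "\<And>x. (\<And>y. y < x \<Longrightarrow> P y) \<Longrightarrow> P x"
  then show "P a"
    using measure_induct_rule[of "to_nat_on (UNIV :: 'a bidx set)" P a] by (auto simp: less_bidx_def)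
qed (auto simp: less_eq_bidx_def less_bidx_def countable_finite)

end

lemma inner_bvec: "(bvec i :: 'n::euclidean_space) \<bullet> bvec j = (if i = j then 1 else 0)"
  using bij_bvec by (auto simp: inner_Basis bvec_inject)

definition of_bidx :: "real ^ 'n bidx \<Rightarrow> 'n::euclidean_space" where
  "of_bidx y = (\<Sum>i\<in>UNIV. (y $ i) *\<^sub>R bvec i)"

definition to_bidx :: "'n::euclidean_space \<Rightarrow> real ^ 'n bidx" where
  "to_bidx x = (\<chi> i. x \<bullet> bvec i)"

lemma of_bidx_inner [simp]: "of_bidx y \<bullet> bvec i = y $ i"
  unfolding of_bidx_def inner_sum_left by (simp add: inner_bvec if_distrib cong: if_cong)

lemma to_of_bidx [simp]: "to_bidx (of_bidx y) = y"
  by (simp add: to_bidx_def vec_eq_iff)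

lemma of_to_bidx [simp]: "of_bidx (to_bidx x) = x"
  unfolding of_bidx_def to_bidx_def using sum_bvec[of "\<lambda>b. (x \<bullet> b) *\<^sub>R b"] by (simp add: euclidean_representation)

lemma bounded_linear_of_bidx: "bounded_linear of_bidx"
  unfolding of_bidx_def by (intro bounded_linear_sum bounded_linear_scaleR_const bounded_linear_vec_nth)

lemma bounded_linear_to_bidx: "bounded_linear (to_bidx :: 'n::euclidean_space \<Rightarrow> _)"
  unfolding linear_conv_bounded_linear[symmetric] to_bidx_def
  by (auto intro!: linearI simp: vec_eq_iff inner_add_left)

lemma of_bidx_axis [simp]: "of_bidx (axis i 1) = bvec i"
proof -
  have "axis i 1 = to_bidx (bvec i)" by (simp add: to_bidx_def axis_def vec_eq_iff inner_bvec eq_commute)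
  then show ?thesis by simp
qed

lemma borel_measurable_of_bidx [measurable]: "of_bidx \<in> borel \<rightarrow>\<^sub>M borel"
  using bounded_linear_of_bidx by (intro borel_measurable_continuous_onI linear_continuous_on)

lemma lborel_of_bidx: "distr lborel borel of_bidx = (lborel :: 'n::euclidean_space measure)"
proof (rule lborel_eqI[symmetric])
  fix l u :: 'n assume le: "\<And>b. b \<in> Basis \<Longrightarrow> l \<bullet> b \<le> u \<bullet> b"
  have eq: "of_bidx -` box l u = box (to_bidx l) (to_bidx u)"
  proof (intro set_eqI)
    fix y
    have "(\<forall>b\<in>Basis. l \<bullet> b < of_bidx y \<bullet> b \<and> of_bidx y \<bullet> b < u \<bullet> b) \<longleftrightarrow> (\<forall>i. l \<bullet> bvec i < y $ i \<and> y $ i < u \<bullet> bvec i)"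
      using bij_bvec[where 'n='n] unfolding bij_betw_def by (metis UNIV_I imageE bvec_Basis of_bidx_inner)
    moreover have "y \<in> box (to_bidx l) (to_bidx u) \<longleftrightarrow> (\<forall>i. l \<bullet> bvec i < y $ i \<and> y $ i < u \<bullet> bvec i)"
      by (simp add: mem_box_cart to_bidx_def)
    ultimately show "y \<in> of_bidx -` box l u \<longleftrightarrow> y \<in> box (to_bidx l) (to_bidx u)"
      by (simp add: mem_box)
  qed
  have B: "(Basis :: (real ^ 'n bidx) set) = (\<lambda>i. axis i 1) ` UNIV" by (auto simp: Basis_vec_def)
  have "emeasure (distr lborel borel of_bidx) (box l u) = emeasure lborel (box (to_bidx l) (to_bidx u))"
    by (subst emeasure_distr) (auto simp: eq)
  also have "\<dots> = ennreal (\<Prod>b\<in>Basis. (to_bidx u - to_bidx l) \<bullet> b)"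
    using le by (intro emeasure_lborel_box) (auto simp: B inner_axis to_bidx_def)
  also have "(\<Prod>b\<in>Basis. (to_bidx u - to_bidx l) \<bullet> b) = (\<Prod>i\<in>UNIV. (u - l) \<bullet> bvec i)"
    unfolding B by (subst prod.reindex) (auto simp: inj_on_def axis_eq_axis inner_axis to_bidx_def inner_diff_left)
  also have "\<dots> = (\<Prod>b\<in>Basis. (u - l) \<bullet> b)" by (rule prod_bvec)
  finally show "emeasure (distr lborel borel of_bidx) (box l u) = (\<Prod>b\<in>Basis. (u - l) \<bullet> b)" .
qed simp

lemma nn_integral_of_bidx:
  fixes f :: "'n::euclidean_space \<Rightarrow> ennreal"
  assumes "f \<in> borel_measurable borel"
  shows "(\<integral>\<^sup>+x. f x \<partial>lborel) = (\<integral>\<^sup>+y. f (of_bidx y) \<partial>lborel)"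
  by (subst lborel_of_bidx[symmetric], subst nn_integral_distr) (use assms in auto)

text \<open>Links gauge integrals with nonnegative Lebesgue integrals. The value
  \<open>\<infinity>\<close> for the non-integrable case makes the identity unconditional, so that
  change of variables can be stated without integrability.\<close>

lemma set_nn_integral_eq_integral:
  fixes h :: "'m::euclidean_space \<Rightarrow> real"
  assumes S: "S \<in> sets borel" and nn: "\<And>x. x \<in> S \<Longrightarrow> 0 \<le> h x"
    and meas: "(\<lambda>x. indicator S x * h x) \<in> borel_measurable borel"
  shows "(\<integral>\<^sup>+x\<in>S. ennreal (h x) \<partial>lborel) = (if h absolutely_integrable_on S then ennreal (integral S h) else \<infinity>)"
proof (cases "h absolutely_integrable_on S")
  case True
  then have "(h has_integral integral S h) S" by (simp add: absolutely_integrable_on_def integrable_integral)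
  from nn_integral_has_integral_lebesgue'[OF nn this] True show ?thesis by simp
next
  case False
  have "(\<integral>\<^sup>+x\<in>S. ennreal (h x) \<partial>lborel) = \<infinity>"
  proof (rule ccontr)
    assume "(\<integral>\<^sup>+x\<in>S. ennreal (h x) \<partial>lborel) \<noteq> \<infinity>"
    moreover have "(\<integral>\<^sup>+x\<in>S. ennreal (h x) \<partial>lborel) = (\<integral>\<^sup>+x. ennreal (norm (indicator S x * h x)) \<partial>lborel)"
      using nn by (intro nn_integral_cong) (auto simp: indicator_def)
    ultimately have "integrable lborel (\<lambda>x. indicator S x * h x)"
      using meas by (intro integrableI_bounded) (auto simp: top.not_eq_extremum)
    then have "set_integrable lborel S h" by (simp add: set_integrable_def)
    from set_borel_integral_eq_integral(1)[OF this] have "h absolutely_integrable_on S"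
      using nn by (intro nonnegative_absolutely_integrable_1) auto
    with False show False by simp
  qed
  with False show ?thesis by simp
qed

lemma nn_change_of_variables_cart:
  fixes g :: "real^'m::{finite,wellorder} \<Rightarrow> real^'m::_" and f :: "real^'m::_ \<Rightarrow> real"
  assumes S: "S \<in> sets borel" "g ` S \<in> sets borel"
    and der: "\<And>x. x \<in> S \<Longrightarrow> (g has_derivative g' x) (at x within S)" and inj: "inj_on g S"
    and nn: "\<And>y. y \<in> g ` S \<Longrightarrow> 0 \<le> f y"
    and m1: "(\<lambda>y. indicator (g ` S) y * f y) \<in> borel_measurable borel"
    and m2: "(\<lambda>x. indicator S x * (\<bar>det (matrix (g' x))\<bar> * f (g x))) \<in> borel_measurable borel"
  shows "(\<integral>\<^sup>+y\<in>g ` S. ennreal (f y) \<partial>lborel) = (\<integral>\<^sup>+x\<in>S. ennreal (\<bar>det (matrix (g' x))\<bar> * f (g x)) \<partial>lborel)"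
proof -
  \<comment> \<open>The formula is applied to vector-valued integrands, so the real density is
    viewed as a vector of dimension one.\<close>
  define F where "F y = (vec (f y) :: real^1)" for y
  have "S \<in> sets lebesgue" using S by auto
  note cv = has_absolute_integral_change_of_variables[OF this der inj, of F]
  have F: "(\<lambda>x. \<bar>det (matrix (g' x))\<bar> *\<^sub>R F (g x)) = (\<lambda>x. vec (\<bar>det (matrix (g' x))\<bar> * f (g x)))"
    by (auto simp: F_def vec_eq_iff)
  have 1: "(\<lambda>x. vec (h x) :: real^1) absolutely_integrable_on T \<longleftrightarrow> h absolutely_integrable_on T" for h :: "real^'m::_ \<Rightarrow> real" and T
    by (simp add: absolutely_integrable_on_1_iff)
  have 2: "integral T (\<lambda>x. vec (h x) :: real^1) = vec (integral T h)" for h :: "real^'m::_ \<Rightarrow> real" and T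
    by (simp add: integral_on_1_eq vec_eq_iff)
  have "(\<lambda>x. \<bar>det (matrix (g' x))\<bar> * f (g x)) absolutely_integrable_on S \<longleftrightarrow> f absolutely_integrable_on g ` S"
    using cv unfolding F unfolding F_def 1 by blast
  moreover have "integral S (\<lambda>x. \<bar>det (matrix (g' x))\<bar> * f (g x)) = integral (g ` S) f" if "f absolutely_integrable_on g ` S"
  proof -
    have "vec (integral S (\<lambda>x. \<bar>det (matrix (g' x))\<bar> * f (g x))) = (vec (integral (g ` S) f) :: real^1)"
      using cv[of "vec (integral (g ` S) f)"] that unfolding F unfolding F_def 1 2 by blast
    then show ?thesis by (simp add: vec_eq_iff)
  qed
  ultimately show ?thesis
    using nn by (subst (1 2) set_nn_integral_eq_integral) (use S m1 m2 in auto)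
qed

definition jac :: "('n::euclidean_space \<Rightarrow> 'n) \<Rightarrow> real" where
  "jac T = det (\<chi> i j. T (bvec j) \<bullet> bvec i)"

text \<open>Conjugation with the coordinate maps \<open>of_bidx\<close> and \<open>to_bidx\<close>,
  which preserve Lebesgue measure, transports the Cartesian formula; the matrix determinant becomes
  \<open>jac\<close>.\<close>

lemma nn_change_of_variables:
  fixes g :: "'n::euclidean_space \<Rightarrow> 'n" and f :: "'n \<Rightarrow> real"
  assumes S: "S \<in> sets borel" "g ` S \<in> sets borel"
    and der: "\<And>x. x \<in> S \<Longrightarrow> (g has_derivative g' x) (at x within S)" and inj: "inj_on g S"
    and nn: "\<And>y. y \<in> g ` S \<Longrightarrow> 0 \<le> f y"
    and m1: "(\<lambda>y. indicator (g ` S) y * f y) \<in> borel_measurable borel"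
    and m2: "(\<lambda>x. indicator S x * (\<bar>jac (g' x)\<bar> * f (g x))) \<in> borel_measurable borel"
  shows "(\<integral>\<^sup>+y\<in>g ` S. ennreal (f y) \<partial>lborel) = (\<integral>\<^sup>+x\<in>S. ennreal (\<bar>jac (g' x)\<bar> * f (g x)) \<partial>lborel)"
proof -
  define T where "T = of_bidx -` S"
  define G where "G = to_bidx \<circ> g \<circ> of_bidx"
  define G' where "G' y = to_bidx \<circ> g' (of_bidx y) \<circ> of_bidx" for y
  have mat: "det (matrix (G' y)) = jac (g' (of_bidx y))" for y
    unfolding matrix_def G'_def jac_def by (simp add: to_bidx_def)
  have img: "G ` T = of_bidx -` (g ` S)"
  proof (intro equalityI subsetI)
    fix y assume "y \<in> of_bidx -` (g ` S)"
    then obtain x where "x \<in> S" "of_bidx y = g x" by blast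
    then show "y \<in> G ` T" unfolding T_def G_def
      by (intro image_eqI[of _ _ "to_bidx x"]) (auto, metis to_of_bidx)
  qed (auto simp: T_def G_def)
  have bT: "T \<in> sets borel" "G ` T \<in> sets borel" unfolding img unfolding T_def
    using measurable_sets[OF borel_measurable_of_bidx] S by auto
  have i1: "indicator T y = (indicator S (of_bidx y) :: real)" "indicator (G ` T) y = (indicator (g ` S) (of_bidx y) :: real)" for y
    unfolding img by (auto simp: T_def indicator_def)
  have "(\<integral>\<^sup>+y\<in>g ` S. ennreal (f y) \<partial>lborel) = (\<integral>\<^sup>+y. ennreal (indicator (g ` S) y * f y) \<partial>lborel)"
    by (intro nn_integral_cong) (auto simp: indicator_def)
  also have "\<dots> = (\<integral>\<^sup>+y. ennreal (indicator (g ` S) (of_bidx y) * f (of_bidx y)) \<partial>lborel)"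
    using m1 by (intro nn_integral_of_bidx) auto
  also have "\<dots> = (\<integral>\<^sup>+y\<in>G ` T. ennreal (f (of_bidx y)) \<partial>lborel)"
    unfolding i1(2)[symmetric] by (intro nn_integral_cong) (auto simp: indicator_def)
  also have "\<dots> = (\<integral>\<^sup>+x\<in>T. ennreal (\<bar>det (matrix (G' x))\<bar> * f (of_bidx (G x))) \<partial>lborel)"
  proof (rule nn_change_of_variables_cart[OF bT])
    fix y assume y: "y \<in> T"
    have "(g has_derivative g' (of_bidx y)) (at (of_bidx y) within of_bidx ` T)"
      using der[of "of_bidx y"] y by (auto simp: T_def intro: has_derivative_subset)
    from has_derivative_in_compose[OF bounded_linear_imp_has_derivative[OF bounded_linear_of_bidx] this]
    have "((\<lambda>x. g (of_bidx x)) has_derivative (\<lambda>x. g' (of_bidx y) (of_bidx x))) (at y within T)" .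
    from bounded_linear.has_derivative[OF bounded_linear_to_bidx this]
    show "(G has_derivative G' y) (at y within T)" by (simp add: G_def G'_def o_def)
  next
    show "inj_on G T" using inj unfolding inj_on_def G_def T_def by (metis (no_types, lifting) comp_apply of_to_bidx to_of_bidx vimageE)
    show "y \<in> G ` T \<Longrightarrow> 0 \<le> f (of_bidx y)" for y using nn unfolding img by auto
    show "(\<lambda>y. indicator (G ` T) y * f (of_bidx y)) \<in> borel_measurable borel"
      unfolding i1 using measurable_compose[OF borel_measurable_of_bidx m1] .
    show "(\<lambda>x. indicator T x * (\<bar>det (matrix (G' x))\<bar> * f (of_bidx (G x)))) \<in> borel_measurable borel"
      unfolding i1 mat G_def using measurable_compose[OF borel_measurable_of_bidx m2] by simp
  qed
  also have "\<dots> = (\<integral>\<^sup>+x. ennreal (indicator S (of_bidx x) * (\<bar>jac (g' (of_bidx x))\<bar> * f (g (of_bidx x)))) \<partial>lborel)"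
    unfolding mat i1[symmetric] by (intro nn_integral_cong) (auto simp: indicator_def G_def)
  also have "\<dots> = (\<integral>\<^sup>+x. ennreal (indicator S x * (\<bar>jac (g' x)\<bar> * f (g x))) \<partial>lborel)"
    by (rule nn_integral_of_bidx[symmetric]) (use m2 in auto)
  also have "\<dots> = (\<integral>\<^sup>+x\<in>S. ennreal (\<bar>jac (g' x)\<bar> * f (g x)) \<partial>lborel)"
    by (intro nn_integral_cong) (auto simp: indicator_def)
  finally show ?thesis .
qed

section \<open>Gram matrices of linear maps\<close>

definition gram :: "('n::euclidean_space \<Rightarrow> 'a::euclidean_space) \<Rightarrow> real ^ 'n bidx ^ 'n bidx" where
  "gram D = (\<chi> i j. D (bvec i) \<bullet> D (bvec j))"

text \<open>Permutations of \<open>Basis\<close> correspond to permutations of the index type, with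
  the same sign. This opens the Leibniz sum to the rules for determinants: multiplicativity,
  Cramer's rule, kernels of singular matrices.\<close>

lemma gram_det_eq: "gram_det \<phi> x = det (gram (\<lambda>h. dderiv \<phi> h x))"
proof -
  let ?t = "\<lambda>h. dderiv \<phi> h x"
  have bb: "bij_betw bvec UNIV (Basis :: 'a set)" by (rule bij_bvec)
  have bi: "bij_betw (bidx :: 'a \<Rightarrow> 'a bidx) Basis UNIV"
    by (rule bij_betw_byWitness[where f'=bvec]) (auto simp: bvec_inverse bidx_inverse)
  have "(\<Sum>p | p permutes (UNIV :: 'a bidx set). of_int (sign p) * (\<Prod>i\<in>UNIV. ?t (bvec i) \<bullet> ?t (bvec (p i)))) =
        (\<Sum>p | p permutes (Basis :: 'a set). of_int (sign p) * (\<Prod>b\<in>Basis. ?t b \<bullet> ?t (p b)))"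
  proof (rule sum.reindex_bij_witness[of _ "map_permutation Basis bidx" "map_permutation UNIV bvec"])
    fix p :: "'a bidx \<Rightarrow> 'a bidx" assume p: "p \<in> {p. p permutes UNIV}"
    show "map_permutation UNIV bvec p \<in> {p. p permutes Basis}" using map_permutation_permutes[OF bb] p by auto
    show "map_permutation Basis bidx (map_permutation UNIV bvec p) = p"
      using map_permutation_compose_inv[OF bb] p by (auto simp: bvec_inverse)
    have "sign (map_permutation UNIV bvec p) = sign p"
      using bb p by (intro sign_map_permutation) (auto simp: bij_betw_def)
    moreover have "(\<Prod>b\<in>Basis. ?t b \<bullet> ?t (map_permutation UNIV bvec p b)) = (\<Prod>i\<in>UNIV. ?t (bvec i) \<bullet> ?t (bvec (p i)))"
      using bb by (subst prod_bvec[symmetric]) (auto simp: map_permutation_apply bij_betw_def)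
    ultimately show "of_int (sign (map_permutation UNIV bvec p)) * (\<Prod>b\<in>Basis. ?t b \<bullet> ?t (map_permutation UNIV bvec p b)) =
       of_int (sign p) * (\<Prod>i\<in>UNIV. ?t (bvec i) \<bullet> ?t (bvec (p i)))" by simp
  next
    fix p :: "'a \<Rightarrow> 'a" assume p: "p \<in> {p. p permutes Basis}"
    show "map_permutation Basis bidx p \<in> {p. p permutes UNIV}" using map_permutation_permutes[OF bi] p by auto
    show "map_permutation UNIV bvec (map_permutation Basis bidx p) = p"
      using map_permutation_compose_inv[OF bi] p by (auto simp: bidx_inverse)
  qed
  then show ?thesis by (simp add: gram_det_def det_def gram_def)
qed

lemma gram_mult_vec:
  assumes "linear D"
  shows "gram D *v y = (\<chi> i. D (bvec i) \<bullet> D (of_bidx y))"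
  unfolding gram_def matrix_vector_mult_def of_bidx_def
  by (auto simp: vec_eq_iff linear_sum[OF assms] linear_scale[OF assms] inner_sum_right mult.commute)

lemma gram_quadratic:
  assumes "linear D"
  shows "y \<bullet> (gram D *v y) = (norm (D (of_bidx y)))\<^sup>2"
proof -
  have "y \<bullet> (gram D *v y) = (\<Sum>i\<in>UNIV. y $ i * (D (bvec i) \<bullet> D (of_bidx y)))"
    by (simp add: gram_mult_vec[OF assms] inner_vec_def)
  also have "\<dots> = (\<Sum>i\<in>UNIV. y $ i *\<^sub>R D (bvec i)) \<bullet> D (of_bidx y)" by (simp add: inner_sum_left)
  also have "(\<Sum>i\<in>UNIV. y $ i *\<^sub>R D (bvec i)) = D (of_bidx y)"
    by (simp add: of_bidx_def linear_sum[OF assms] linear_scale[OF assms])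
  finally show ?thesis by (simp add: power2_norm_eq_inner)
qed

text \<open>Deform the Gram matrix to the identity through positive definite matrices.\<close>

lemma gram_pos:
  fixes D :: "'n::euclidean_space \<Rightarrow> 'a::euclidean_space"
  assumes lin: "linear D" and inj: "inj D"
  shows "det (gram D) > 0"
proof -
  define A where "A t = (\<chi> i j. (1 - t) * (mat 1 :: real ^ 'n bidx ^ 'n bidx) $ i $ j + t * gram D $ i $ j)" for t :: real
  have Av: "A t *v y = (1 - t) *\<^sub>R y + t *\<^sub>R (gram D *v y)" for t y
  proof -
    have "A t = (1 - t) *\<^sub>R mat 1 + t *\<^sub>R gram D" by (simp add: A_def vec_eq_iff)
    then show ?thesis by (simp add: matrix_vector_mult_add_rdistrib scaleR_matrix_vector_assoc[symmetric])
  qed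
  have nz: "det (A t) \<noteq> 0" if t: "0 \<le> t" "t \<le> 1" for t
  proof
    assume "det (A t) = 0"
    then obtain y where y: "y \<noteq> 0" "A t *v y = 0"
      using invertible_det_nz[of "A t"] invertible_left_inverse[of "A t"] matrix_left_invertible_ker[of "A t"] by metis
    then have "0 = (1 - t) * (norm y)\<^sup>2 + t * (norm (D (of_bidx y)))\<^sup>2"
      using Av[of t y] gram_quadratic[OF lin, of y]
      by (metis (no_types) inner_add_right inner_scaleR_right inner_zero_right power2_norm_eq_inner)
    moreover have "D (of_bidx y) \<noteq> 0"
    proof
      assume "D (of_bidx y) = 0"
      then have "of_bidx y = 0" using inj lin linear_injective_0 by blast
      then have "y = 0" using to_of_bidx[of y] by (simp add: to_bidx_def vec_eq_iff)
      with y show False by simp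
    qed
    moreover have "(1 - t) * (norm y)\<^sup>2 \<ge> 0" "t * (norm (D (of_bidx y)))\<^sup>2 \<ge> 0" using t by auto
    ultimately have "(1 - t) * (norm y)\<^sup>2 = 0" "t * (norm (D (of_bidx y)))\<^sup>2 = 0" by linarith+
    with y \<open>D (of_bidx y) \<noteq> 0\<close> show False by auto
  qed
  have c: "continuous_on {0..1} (\<lambda>t. det (A t))" unfolding det_def A_def by (intro continuous_intros)
  have A0: "A 0 = mat 1" and A1: "A 1 = gram D" by (simp_all add: A_def vec_eq_iff)
  show ?thesis
  proof (rule ccontr)
    assume "\<not> ?thesis"
    then have "det (A 1) \<le> 0" "0 \<le> det (A 0)" by (simp_all add: A0 A1)
    from IVT2'[OF this _ c] obtain t where "0 \<le> t" "t \<le> 1" "det (A t) = 0" by auto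
    with nz show False by blast
  qed
qed

text \<open>With \<open>A\<close> the matrix of \<open>T\<close>, the Gram matrix of
  \<open>D \<circ> T\<close> is the transpose of \<open>A\<close> times \<open>gram D\<close> times
  \<open>A\<close>. After taking roots this is the factor by which the area densities of two charts
  differ.\<close>

lemma gram_compose:
  fixes D :: "'n::euclidean_space \<Rightarrow> 'a::euclidean_space" and T :: "'n \<Rightarrow> 'n"
  assumes "linear D"
  shows "det (gram (\<lambda>h. D (T h))) = (jac T)\<^sup>2 * det (gram D)"
proof -
  define A where "A = (\<chi> i j. T (bvec j) \<bullet> bvec i)"
  have T: "D (T (bvec j)) = (\<Sum>k\<in>UNIV. A $ k $ j *\<^sub>R D (bvec k))" for j
  proof -
    have "T (bvec j) = (\<Sum>k\<in>UNIV. (T (bvec j) \<bullet> bvec k) *\<^sub>R bvec k)"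
      using sum_bvec[of "\<lambda>b. (T (bvec j) \<bullet> b) *\<^sub>R b"] by (simp add: euclidean_representation)
    then have "D (T (bvec j)) = D (\<Sum>k\<in>UNIV. (T (bvec j) \<bullet> bvec k) *\<^sub>R bvec k)" by simp
    then show ?thesis by (simp add: A_def linear_sum[OF assms] linear_scale[OF assms])
  qed
  have "gram (\<lambda>h. D (T h)) = transpose A ** gram D ** A"
    unfolding gram_def T
    by (simp add: vec_eq_iff matrix_matrix_mult_def transpose_def inner_sum_left inner_sum_right sum_distrib_left sum_distrib_right ac_simps)
  then show ?thesis by (simp add: det_mul det_transpose power2_eq_square jac_def A_def)
qed

section \<open>The surface measure\<close>

abbreviation area_density :: "('n::euclidean_space \<Rightarrow> 'a::euclidean_space) \<Rightarrow> 'n \<Rightarrow> real" where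
  "area_density \<phi> x \<equiv> sqrt (gram_det \<phi> x)"

lemma gram_det_pos:
  assumes "local_param M V \<phi>" "x \<in> V"
  shows "gram_det \<phi> x > 0"
  unfolding gram_det_eq by (rule gram_pos[OF local_paramD(9)[OF assms] local_param_inj_deriv[OF assms]])

lemma continuous_on_area_density:
  assumes "local_param M V \<phi>"
  shows "continuous_on V (area_density \<phi>)"
  unfolding gram_det_def using smooth_on_imp_continuous_on[OF smooth_on_dderiv[OF local_paramD(2)[OF assms]]]
  by (intro continuous_intros) auto

lemma borel_chart_preimage:
  assumes "local_param M V \<phi>" "E \<in> sets borel" "E \<subseteq> V" "A \<in> sets borel"
  shows "{x \<in> E. \<phi> x \<in> A} \<in> sets borel"
proof -
  have "\<phi> \<in> restrict_space borel V \<rightarrow>\<^sub>M borel"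
    by (rule borel_measurable_continuous_on_restrict[OF local_paramD(5)[OF assms(1)]])
  from measurable_sets[OF this assms(4)] have "\<phi> -` A \<inter> V \<in> sets (restrict_space borel V)"
    by (simp add: space_restrict_space)
  then have "\<phi> -` A \<inter> V \<in> sets borel"
    using local_paramD(1)[OF assms(1)] by (subst (asm) sets_restrict_space_iff) auto
  then have "E \<inter> (\<phi> -` A \<inter> V) \<in> sets borel" using assms(2) by auto
  also have "E \<inter> (\<phi> -` A \<inter> V) = {x \<in> E. \<phi> x \<in> A}" using assms(3) by auto
  finally show ?thesis .
qed

lemma borel_chart_range:
  assumes "local_param M V \<phi>" "closed M"
  shows "\<phi> ` V \<in> sets borel"
  using local_paramD(6)[OF assms(1)] assms(2) by (auto intro!: sets.Int)

lemma borel_chart_image: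
  assumes "local_param M V \<phi>" "closed M" "E \<in> sets borel" "E \<subseteq> V"
  shows "\<phi> ` E \<in> sets borel"
proof -
  have "inv_into V \<phi> \<in> restrict_space borel (\<phi> ` V) \<rightarrow>\<^sub>M borel"
    by (rule borel_measurable_continuous_on_restrict[OF local_paramD(4)[OF assms(1)]])
  from measurable_sets[OF this assms(3)] have "inv_into V \<phi> -` E \<inter> \<phi> ` V \<in> sets (restrict_space borel (\<phi> ` V))"
    by (simp add: space_restrict_space)
  then have "inv_into V \<phi> -` E \<inter> \<phi> ` V \<in> sets borel"
    using borel_chart_range[OF assms(1,2)] by (subst (asm) sets_restrict_space_iff) auto
  also have "inv_into V \<phi> -` E \<inter> \<phi> ` V = \<phi> ` E"
    using assms(4) local_paramD(3)[OF assms(1)] by (auto simp: inv_into_f_f subset_iff)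
  finally show ?thesis .
qed

text \<open>On an open neighbourhood \<open>N\<close> of \<open>x\<close> the map
  \<open>\<phi>\<close> factors through \<open>\<psi>\<close>. Differentiability of the transition
  map comes from \<open>has_derivative_left_inverse\<close>, and the chain rule with
  \<open>gram_compose\<close> compares the densities.\<close>

lemma chart_transition:
  fixes \<phi> \<psi> :: "'n::euclidean_space \<Rightarrow> 'a::euclidean_space"
  assumes \<phi>: "local_param M V \<phi>" and \<psi>: "local_param M W \<psi>" and x: "x \<in> V" "\<phi> x \<in> \<psi> ` W"
  shows "\<exists>T. ((\<lambda>y. inv_into W \<psi> (\<phi> y)) has_derivative T) (at x) \<and>
    area_density \<phi> x = \<bar>jac T\<bar> * area_density \<psi> (inv_into W \<psi> (\<phi> x))"
proof -
  define \<tau> where "\<tau> y = inv_into W \<psi> (\<phi> y)" for y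
  have \<tau>W: "\<tau> y \<in> W" "\<psi> (\<tau> y) = \<phi> y" if "\<phi> y \<in> \<psi> ` W" for y
    using that by (auto simp: \<tau>_def inv_into_into f_inv_into_f)
  obtain U where U: "open U" "\<psi> ` W = M \<inter> U" using local_paramD(6)[OF \<psi>] by blast
  define N where "N = V \<inter> \<phi> -` U"
  have N: "open N" unfolding N_def
    using continuous_open_preimage[OF local_paramD(5,1)[OF \<phi>] U(1)] .
  have xN: "x \<in> N" using x U by (auto simp: N_def)
  have Nim: "\<phi> y \<in> \<psi> ` W" if "y \<in> N" for y
    using that local_paramD(6)[OF \<phi>] U(2) by (auto simp: N_def)
  have "continuous_on N \<tau>" unfolding \<tau>_def
    by (rule continuous_on_compose2[OF local_paramD(4)[OF \<psi>] continuous_on_subset[OF local_paramD(5)[OF \<phi>]]])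
      (use Nim in \<open>auto simp: N_def\<close>)
  then have cont: "continuous (at x) \<tau>" using N xN by (simp add: continuous_on_eq_continuous_at)
  have z: "\<tau> x \<in> W" "\<psi> (\<tau> x) = \<phi> x" using \<tau>W x by auto
  obtain L where L: "bounded_linear L" "\<And>h. L (dderiv \<psi> h (\<tau> x)) = h" using local_param_left_inverse[OF \<psi> z(1)] by blast
  define T where "T h = L (dderiv \<phi> h x)" for h
  have d\<phi>: "((\<lambda>y. \<psi> (\<tau> y)) has_derivative (\<lambda>h. dderiv \<phi> h x)) (at x)"
    using local_paramD(7)[OF \<phi> x(1)] N xN by (rule has_derivative_transform_within_open) (use Nim \<tau>W in auto)
  have d\<tau>: "(\<tau> has_derivative T) (at x)"
    unfolding T_def by (rule has_derivative_left_inverse[OF local_paramD(7)[OF \<psi> z(1)] L cont d\<phi>])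
  have "((\<lambda>y. \<psi> (\<tau> y)) has_derivative (\<lambda>h. dderiv \<psi> (T h) (\<tau> x))) (at x)"
    by (rule has_derivative_compose[OF d\<tau> local_paramD(7)[OF \<psi> z(1)]])
  from has_derivative_unique[OF d\<phi> this] have "(\<lambda>h. dderiv \<phi> h x) = (\<lambda>h. dderiv \<psi> (T h) (\<tau> x))" .
  then have "gram_det \<phi> x = (jac T)\<^sup>2 * gram_det \<psi> (\<tau> x)"
    unfolding gram_det_eq using gram_compose[OF local_paramD(9)[OF \<psi> z(1)], of T] by simp
  then have "area_density \<phi> x = \<bar>jac T\<bar> * area_density \<psi> (\<tau> x)" by (simp add: real_sqrt_mult)
  with d\<tau> show ?thesis unfolding \<tau>_def by blast
qed

lemma chart_area_independent:
  fixes \<phi> \<psi> :: "'n::euclidean_space \<Rightarrow> 'a::euclidean_space"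
  assumes \<phi>: "local_param M V \<phi>" and \<psi>: "local_param M W \<psi>"
    and E: "E \<in> sets borel" "E \<subseteq> V" and F: "F \<in> sets borel" "F \<subseteq> W" and eq: "\<phi> ` E = \<psi> ` F"
  shows "(\<integral>\<^sup>+x\<in>E. ennreal (area_density \<phi> x) \<partial>lborel) = (\<integral>\<^sup>+x\<in>F. ennreal (area_density \<psi> x) \<partial>lborel)"
proof -
  define \<tau> where "\<tau> y = inv_into W \<psi> (\<phi> y)" for y
  have im: "\<phi> x \<in> \<psi> ` W" if "x \<in> E" for x using that eq F by blast
  have "\<forall>x\<in>E. \<exists>T. (\<tau> has_derivative T) (at x) \<and> area_density \<phi> x = \<bar>jac T\<bar> * area_density \<psi> (\<tau> x)"
    using chart_transition[OF \<phi> \<psi>] E im unfolding \<tau>_def by blast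
  then obtain T where T: "\<And>x. x \<in> E \<Longrightarrow> (\<tau> has_derivative T x) (at x)"
    "\<And>x. x \<in> E \<Longrightarrow> area_density \<phi> x = \<bar>jac (T x)\<bar> * area_density \<psi> (\<tau> x)" by metis
  have \<tau>: "\<psi> (\<tau> x) = \<phi> x" if "x \<in> E" for x using im[OF that] by (simp add: \<tau>_def f_inv_into_f)
  have inj: "inj_on \<tau> E"
    by (rule inj_onI) (metis E(2) \<tau> inj_onD local_paramD(3)[OF \<phi>] subsetD)
  have img: "\<tau> ` E = F"
  proof
    show "\<tau> ` E \<subseteq> F"
    proof
      fix z assume "z \<in> \<tau> ` E"
      then obtain x where x: "x \<in> E" "z = \<tau> x" by blast
      then obtain y where y: "y \<in> F" "\<phi> x = \<psi> y" using eq by blast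
      then have "z = y" using x F local_paramD(3)[OF \<psi>] by (auto simp: \<tau>_def inv_into_f_f)
      with y show "z \<in> F" by simp
    qed
    show "F \<subseteq> \<tau> ` E"
    proof
      fix y assume y: "y \<in> F"
      then obtain x where x: "x \<in> E" "\<psi> y = \<phi> x" using eq by blast
      then have "\<tau> x = y" using y F local_paramD(3)[OF \<psi>] by (auto simp: \<tau>_def inv_into_f_f[symmetric] simp flip: x(2))
      with x show "y \<in> \<tau> ` E" by blast
    qed
  qed
  have m: "(\<lambda>x. indicator E x * area_density k x) \<in> borel_measurable borel"
    if "local_param M V k" "E \<in> sets borel" "E \<subseteq> V" for k :: "'n \<Rightarrow> 'a" and E and V :: "'n set"
    using borel_measurable_continuous_on_indicator[OF that(2) continuous_on_subset[OF continuous_on_area_density[OF that(1)] that(3)]]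
    by simp
  have "(\<integral>\<^sup>+y\<in>\<tau> ` E. ennreal (area_density \<psi> y) \<partial>lborel) = (\<integral>\<^sup>+x\<in>E. ennreal (\<bar>jac (T x)\<bar> * area_density \<psi> (\<tau> x)) \<partial>lborel)"
  proof (rule nn_change_of_variables[OF E(1) _ _ inj])
    show "\<tau> ` E \<in> sets borel" using img F by simp
    show "(\<tau> has_derivative T x) (at x within E)" if "x \<in> E" for x using T(1)[OF that] by (rule has_derivative_at_withinI)
    show "0 \<le> area_density \<psi> y" if "y \<in> \<tau> ` E" for y
      using gram_det_pos[OF \<psi>, of y] that img F by auto
    show "(\<lambda>y. indicator (\<tau> ` E) y * area_density \<psi> y) \<in> borel_measurable borel" unfolding img by (rule m[OF \<psi> F])
    \<comment> \<open>The Jacobian factor is not examined by itself: on \<open>E\<close> its product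
      with the density of \<open>\<psi>\<close> is the density of \<open>\<phi>\<close>, which is
      continuous.\<close>
    have "(\<lambda>x. indicator E x * (\<bar>jac (T x)\<bar> * area_density \<psi> (\<tau> x))) = (\<lambda>x. indicator E x * area_density \<phi> x)"
      using T(2) by (auto simp: indicator_def fun_eq_iff)
    then show "(\<lambda>x. indicator E x * (\<bar>jac (T x)\<bar> * area_density \<psi> (\<tau> x))) \<in> borel_measurable borel" using m[OF \<phi> E] by simp
  qed
  also have "\<dots> = (\<integral>\<^sup>+x\<in>E. ennreal (area_density \<phi> x) \<partial>lborel)"
    using T(2) by (intro nn_integral_cong) (auto simp: indicator_def)
  finally show ?thesis by (simp add: img)
qed

text \<open>The property under the \<open>THE\<close> of \<open>surface_measure\<close>, isolated so
  that existence and uniqueness can be stated.\<close>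

definition is_surface_measure :: "'n::euclidean_space itself \<Rightarrow> 'a::euclidean_space set \<Rightarrow> 'a measure \<Rightarrow> bool" where
  "is_surface_measure _ M \<mu> \<longleftrightarrow> sets \<mu> = sets borel \<and> emeasure \<mu> (UNIV - M) = 0 \<and>
     (\<forall>V (\<phi>::'n \<Rightarrow> 'a) E. local_param M V \<phi> \<longrightarrow> E \<in> sets lborel \<longrightarrow> E \<subseteq> V \<longrightarrow>
        emeasure \<mu> (\<phi> ` E) = (\<integral>\<^sup>+x\<in>E. ennreal (area_density \<phi> x) \<partial>lborel))"

text \<open>Extension by 0 turns a chart, whose values outside \<open>V\<close> are arbitrary, into
  a Borel map on the whole space, as a push-forward requires.\<close>

definition chart_ext :: "'n::euclidean_space set \<Rightarrow> ('n \<Rightarrow> 'a::euclidean_space) \<Rightarrow> 'n \<Rightarrow> 'a" where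
  "chart_ext V \<phi> x = indicator V x *\<^sub>R \<phi> x"

definition chart_measure :: "'n::euclidean_space set \<Rightarrow> ('n \<Rightarrow> 'a::euclidean_space) \<Rightarrow> 'n set \<Rightarrow> 'a measure" where
  "chart_measure V \<phi> E = distr (density lborel (\<lambda>x. indicator E x * ennreal (area_density \<phi> x))) borel (chart_ext V \<phi>)"

lemma chart_ext_measurable [measurable]:
  assumes "local_param M V \<phi>"
  shows "chart_ext V \<phi> \<in> borel \<rightarrow>\<^sub>M borel"
  unfolding chart_ext_def
  using local_paramD(1,5)[OF assms] by (intro borel_measurable_continuous_on_indicator) auto

lemma area_density_measurable:
  assumes "local_param M V \<phi>" "E \<in> sets borel" "E \<subseteq> V"
  shows "(\<lambda>x. indicator E x * ennreal (area_density \<phi> x)) \<in> borel_measurable borel"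
proof -
  have "(\<lambda>x. indicator E x *\<^sub>R area_density \<phi> x) \<in> borel_measurable borel"
    by (rule borel_measurable_continuous_on_indicator[OF assms(2) continuous_on_subset[OF continuous_on_area_density[OF assms(1)] assms(3)]])
  then have "(\<lambda>x. ennreal (indicator E x *\<^sub>R area_density \<phi> x)) \<in> borel_measurable borel" by simp
  also have "(\<lambda>x. ennreal (indicator E x *\<^sub>R area_density \<phi> x)) = (\<lambda>x. indicator E x * ennreal (area_density \<phi> x))"
    by (auto simp: indicator_def fun_eq_iff)
  finally show ?thesis .
qed

lemma nn_integral_chart_measure:
  assumes p: "local_param M V \<phi>" and E: "E \<in> sets borel" "E \<subseteq> V" and h: "h \<in> borel_measurable borel"
  shows "(\<integral>\<^sup>+u. h u \<partial>chart_measure V \<phi> E) = (\<integral>\<^sup>+x. indicator E x * ennreal (area_density \<phi> x) * h (\<phi> x) \<partial>lborel)"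
proof -
  note m = area_density_measurable[OF p E] chart_ext_measurable[OF p]
  have "(\<integral>\<^sup>+u. h u \<partial>chart_measure V \<phi> E) = (\<integral>\<^sup>+x. indicator E x * ennreal (area_density \<phi> x) * h (chart_ext V \<phi> x) \<partial>lborel)"
    unfolding chart_measure_def using m h by (subst nn_integral_distr) (auto simp: nn_integral_density)
  also have "\<dots> = (\<integral>\<^sup>+x. indicator E x * ennreal (area_density \<phi> x) * h (\<phi> x) \<partial>lborel)"
    using E(2) by (intro nn_integral_cong) (auto simp: indicator_def chart_ext_def)
  finally show ?thesis .
qed

lemma sets_chart_measure [simp]: "sets (chart_measure V \<phi> E) = sets borel" "space (chart_measure V \<phi> E) = UNIV"
  by (simp_all add: chart_measure_def)

lemma emeasure_chart_measure:
  assumes p: "local_param M V \<phi>" and E: "E \<in> sets borel" "E \<subseteq> V" and A: "A \<in> sets borel"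
  shows "emeasure (chart_measure V \<phi> E) A = (\<integral>\<^sup>+x\<in>{x\<in>E. \<phi> x \<in> A}. ennreal (area_density \<phi> x) \<partial>lborel)"
proof -
  have "emeasure (chart_measure V \<phi> E) A = (\<integral>\<^sup>+u. indicator A u \<partial>chart_measure V \<phi> E)" using A by simp
  also have "\<dots> = (\<integral>\<^sup>+x. indicator E x * ennreal (area_density \<phi> x) * indicator A (\<phi> x) \<partial>lborel)"
    using A by (intro nn_integral_chart_measure[OF p E]) auto
  also have "\<dots> = (\<integral>\<^sup>+x\<in>{x\<in>E. \<phi> x \<in> A}. ennreal (area_density \<phi> x) \<partial>lborel)"
    by (intro nn_integral_cong) (auto simp: indicator_def)
  finally show ?thesis .
qed

text \<open>The balls of radius \<open>\<epsilon> i\<close> cover, while the doubled closed balls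
  still lie in the charts: near the diagonal the second point may leave the small ball by less than
  its radius. The bound \<open>\<epsilon> i \<le> 1\<close> keeps the cut-off radius of the Mellin
  transform below 1.\<close>

locale atlas =
  fixes M :: "'a::euclidean_space set" and m :: nat and V :: "nat \<Rightarrow> 'n::euclidean_space set"
    and \<phi> :: "nat \<Rightarrow> 'n \<Rightarrow> 'a" and c :: "nat \<Rightarrow> 'n" and \<epsilon> :: "nat \<Rightarrow> real"
  assumes compact: "compact M"
    and param: "\<And>i. i < m \<Longrightarrow> local_param M (V i) (\<phi> i)"
    and eps: "\<And>i. i < m \<Longrightarrow> 0 < \<epsilon> i" "\<And>i. i < m \<Longrightarrow> \<epsilon> i \<le> 1"
    and cball_V: "\<And>i. i < m \<Longrightarrow> cball (c i) (2 * \<epsilon> i) \<subseteq> V i"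
    and cover: "M = (\<Union>i<m. \<phi> i ` ball (c i) (\<epsilon> i))"
begin

lemma ball_V: "i < m \<Longrightarrow> ball (c i) (\<epsilon> i) \<subseteq> V i"
  using cball_V[of i] eps(1)[of i] by (force simp: subset_iff)

lemma closed_M: "closed M" using compact by (rule compact_imp_closed)

section \<open>Disjoint Borel pieces and the area measure assembled from them\<close>

definition "piece i = \<phi> i ` ball (c i) (\<epsilon> i) - (\<Union>j<i. \<phi> j ` ball (c j) (\<epsilon> j))"

definition "core i = {x \<in> ball (c i) (\<epsilon> i). \<phi> i x \<in> piece i}"

lemma piece_borel: "i < m \<Longrightarrow> piece i \<in> sets borel"
  unfolding piece_def using borel_chart_image[OF param closed_M _ ball_V] by (intro sets.Diff sets.finite_UN) auto

lemma core_borel: "i < m \<Longrightarrow> core i \<in> sets borel"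
  unfolding core_def by (rule borel_chart_preimage[OF param _ ball_V piece_borel]) auto

lemma core_ball: "core i \<subseteq> ball (c i) (\<epsilon> i)" by (auto simp: core_def)

lemma core_V: "i < m \<Longrightarrow> core i \<subseteq> V i" using core_ball ball_V by blast

lemma image_core: "\<phi> i ` core i = piece i" by (auto simp: core_def piece_def)

lemma piece_disjoint: "disjoint_family_on piece {..<m}"
proof -
  have "piece i \<inter> piece j = {}" if "i < j" for i j using that by (auto simp: piece_def)
  then show ?thesis unfolding disjoint_family_on_def by (metis Int_commute linorder_neqE_nat)
qed

lemma Union_piece: "(\<Union>i<m. piece i) = M"
proof
  show "(\<Union>i<m. piece i) \<subseteq> M" unfolding cover by (auto simp: piece_def)
  show "M \<subseteq> (\<Union>i<m. piece i)"
  proof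
    fix u assume "u \<in> M"
    then obtain i where i: "i < m" "u \<in> \<phi> i ` ball (c i) (\<epsilon> i)" unfolding cover by blast
    define k where "k = (LEAST k. u \<in> \<phi> k ` ball (c k) (\<epsilon> k))"
    have "u \<in> \<phi> k ` ball (c k) (\<epsilon> k)" "k \<le> i" unfolding k_def using i(2) by (rule LeastI, rule Least_le)
    moreover have "u \<notin> \<phi> j ` ball (c j) (\<epsilon> j)" if "j < k" for j using that not_less_Least unfolding k_def by blast
    ultimately show "u \<in> (\<Union>i<m. piece i)" using i(1) by (auto simp: piece_def intro!: bexI[of _ k])
  qed
qed

definition area :: "'a measure" where
  "area = measure_of UNIV (sets borel) (\<lambda>A. \<Sum>i<m. emeasure (chart_measure (V i) (\<phi> i) (core i)) A)"

lemma sets_area [simp]: "sets area = sets borel" "space area = UNIV"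
  using sets.sigma_sets_eq[of "borel :: 'a measure"] by (simp_all add: area_def)

lemma emeasure_area:
  assumes "A \<in> sets borel"
  shows "emeasure area A = (\<Sum>i<m. emeasure (chart_measure (V i) (\<phi> i) (core i)) A)"
proof (rule emeasure_measure_of[OF area_def])
  show "countably_additive (sets area) (\<lambda>A. \<Sum>i<m. emeasure (chart_measure (V i) (\<phi> i) (core i)) A)"
  proof (rule countably_additiveI)
    fix A :: "nat \<Rightarrow> 'a set" assume A: "range A \<subseteq> sets area" "disjoint_family A"
    have "(\<Sum>k. \<Sum>i<m. emeasure (chart_measure (V i) (\<phi> i) (core i)) (A k)) = (\<Sum>i<m. \<Sum>k. emeasure (chart_measure (V i) (\<phi> i) (core i)) (A k))"
      by (rule suminf_sum) simp
    also have "\<dots> = (\<Sum>i<m. emeasure (chart_measure (V i) (\<phi> i) (core i)) (\<Union>k. A k))"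
      using A by (intro sum.cong refl suminf_emeasure) auto
    finally show "(\<Sum>k. \<Sum>i<m. emeasure (chart_measure (V i) (\<phi> i) (core i)) (A k)) = (\<Sum>i<m. emeasure (chart_measure (V i) (\<phi> i) (core i)) (\<Union>k. A k))" .
  qed
qed (use assms in \<open>auto simp: positive_def\<close>)

lemma nn_integral_pieces:
  assumes F: "F \<in> sets borel" and A: "\<And>i. i < m \<Longrightarrow> A i \<in> sets borel" "disjoint_family_on A {..<m}" "F = (\<Union>i<m. A i)"
    and h: "(\<lambda>x. indicator F x * h x) \<in> borel_measurable borel"
  shows "(\<integral>\<^sup>+x\<in>F. h x \<partial>lborel) = (\<Sum>i<m. \<integral>\<^sup>+x\<in>A i. h x \<partial>lborel)"
proof -
  have "(\<integral>\<^sup>+x\<in>F. h x \<partial>lborel) = (\<integral>\<^sup>+x. (\<Sum>i<m. indicator (A i) x * (indicator F x * h x)) \<partial>lborel)"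
  proof (intro nn_integral_cong)
    fix x
    have "indicator F x = (\<Sum>i<m. indicator (A i) x :: ennreal)"
      unfolding A(3) by (rule indicator_UN_disjoint) (use A in auto)
    then have "(\<Sum>i<m. indicator (A i) x * (indicator F x * h x)) = indicator F x * (indicator F x * h x)"
      by (simp add: sum_distrib_right)
    then show "h x * indicator F x = (\<Sum>i<m. indicator (A i) x * (indicator F x * h x))" by (simp add: indicator_def)
  qed
  also have "\<dots> = (\<Sum>i<m. \<integral>\<^sup>+x. indicator (A i) x * (indicator F x * h x) \<partial>lborel)"
    using A h by (intro nn_integral_sum) auto
  also have "\<dots> = (\<Sum>i<m. \<integral>\<^sup>+x\<in>A i. h x \<partial>lborel)"
    using A(3) by (intro sum.cong refl nn_integral_cong) (auto simp: indicator_def)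
  finally show ?thesis .
qed

text \<open>Existence. An arbitrary chart \<open>\<psi>\<close> is cut along the pieces, and on each
  of them \<open>chart_area_independent\<close> trades \<open>\<phi> i\<close> for
  \<open>\<psi>\<close>.\<close>

lemma is_surface_measure_area: "is_surface_measure TYPE('n) M area"
  unfolding is_surface_measure_def
proof (intro conjI allI impI)
  have "emeasure (chart_measure (V i) (\<phi> i) (core i)) (UNIV - M) = 0" if "i < m" for i
  proof -
    have "{x \<in> core i. \<phi> i x \<in> UNIV - M} = {}" using Union_piece that by (auto simp: core_def)
    moreover have "UNIV - M \<in> sets borel" using closed_M by (intro sets.Diff) auto
    ultimately show ?thesis by (subst emeasure_chart_measure[OF param[OF that] core_borel[OF that] core_V[OF that]]) auto
  qed
  then show "emeasure area (UNIV - M) = 0" using closed_M by (subst emeasure_area) auto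
  fix W :: "'n set" and \<psi> :: "'n \<Rightarrow> 'a" and E
  assume \<psi>: "local_param M W \<psi>" and "E \<in> sets lborel" and EW: "E \<subseteq> W"
  then have E: "E \<in> sets borel" by simp
  have im: "\<psi> ` E \<in> sets borel" by (rule borel_chart_image[OF \<psi> closed_M E EW])
  define A where "A i = {x \<in> E. \<psi> x \<in> piece i}" for i
  have "emeasure area (\<psi> ` E) = (\<Sum>i<m. \<integral>\<^sup>+x\<in>{x\<in>core i. \<phi> i x \<in> \<psi> ` E}. ennreal (area_density (\<phi> i) x) \<partial>lborel)"
    unfolding emeasure_area[OF im] by (intro sum.cong refl emeasure_chart_measure[OF param core_borel core_V im]) auto
  also have "\<dots> = (\<Sum>i<m. \<integral>\<^sup>+x\<in>A i. ennreal (area_density \<psi> x) \<partial>lborel)"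
  proof (intro sum.cong refl)
    fix i assume "i \<in> {..<m}"
    then have i: "i < m" by simp
    show "(\<integral>\<^sup>+x\<in>{x\<in>core i. \<phi> i x \<in> \<psi> ` E}. ennreal (area_density (\<phi> i) x) \<partial>lborel) = (\<integral>\<^sup>+x\<in>A i. ennreal (area_density \<psi> x) \<partial>lborel)"
    proof (rule chart_area_independent[OF param[OF i] \<psi>])
      show "{x\<in>core i. \<phi> i x \<in> \<psi> ` E} \<in> sets borel" by (rule borel_chart_preimage[OF param[OF i] core_borel[OF i] core_V[OF i] im])
      show "A i \<in> sets borel" unfolding A_def by (rule borel_chart_preimage[OF \<psi> E EW piece_borel[OF i]])
      show "\<phi> i ` {x\<in>core i. \<phi> i x \<in> \<psi> ` E} = \<psi> ` A i"
      proof -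
        have "\<phi> i ` {x\<in>core i. \<phi> i x \<in> \<psi> ` E} = \<phi> i ` core i \<inter> \<psi> ` E" by auto
        also have "\<dots> = \<psi> ` A i" unfolding image_core A_def by auto
        finally show ?thesis .
      qed
    qed (use core_V[OF i] EW in \<open>auto simp: A_def\<close>)
  qed
  also have "\<dots> = (\<integral>\<^sup>+x\<in>E. ennreal (area_density \<psi> x) \<partial>lborel)"
  proof (rule nn_integral_pieces[of E A "\<lambda>x. ennreal (area_density \<psi> x)", symmetric, OF E])
    show "A i \<in> sets borel" if "i < m" for i
      using borel_chart_preimage[OF \<psi> E EW piece_borel[OF that]] by (simp add: A_def)
    show "disjoint_family_on A {..<m}"
    proof (unfold disjoint_family_on_def, intro ballI impI)
      fix i j assume "i \<in> {..<m}" "j \<in> {..<m}" "i \<noteq> j"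
      from disjoint_family_onD[OF piece_disjoint this] show "A i \<inter> A j = {}" unfolding A_def by blast
    qed
    have "\<psi> x \<in> M" if "x \<in> E" for x using local_paramD(6)[OF \<psi>] EW that by blast
    then have "\<exists>i<m. \<psi> x \<in> piece i" if "x \<in> E" for x using Union_piece that by blast
    then show "E = (\<Union>i<m. A i)" unfolding A_def by auto
    show "(\<lambda>x. indicator E x * ennreal (area_density \<psi> x)) \<in> borel_measurable borel"
      by (rule area_density_measurable[OF \<psi> E EW])
  qed
  finally show "emeasure area (\<psi> ` E) = (\<integral>\<^sup>+x\<in>E. ennreal (area_density \<psi> x) \<partial>lborel)" .
qed simp

text \<open>The chart formula fixes the measure of every Borel subset of a piece, finitely many
  disjoint pieces exhaust \<open>M\<close>, and the complement of \<open>M\<close> is null.\<close>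

lemma is_surface_measure_unique:
  assumes "is_surface_measure TYPE('n) M \<mu>"
  shows "\<mu> = area"
proof (rule measure_eqI)
  have *: "emeasure \<nu> A = (\<Sum>i<m. \<integral>\<^sup>+x\<in>{x\<in>core i. \<phi> i x \<in> A}. ennreal (area_density (\<phi> i) x) \<partial>lborel)"
    if \<nu>: "is_surface_measure TYPE('n) M \<nu>" and A: "A \<in> sets borel" for \<nu> A
  proof -
    have sets: "sets \<nu> = sets borel" and null: "emeasure \<nu> (UNIV - M) = 0" using \<nu> by (auto simp: is_surface_measure_def)
    have "emeasure \<nu> A = emeasure \<nu> (A \<inter> M) + emeasure \<nu> (A - M)"
      using A closed_M sets by (subst plus_emeasure) (auto intro!: arg_cong[of _ _ "emeasure \<nu>"])
    also have "emeasure \<nu> (A - M) \<le> emeasure \<nu> (UNIV - M)" using A closed_M sets by (intro emeasure_mono) auto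
    then have "emeasure \<nu> (A - M) = 0" using null by simp
    also have "emeasure \<nu> (A \<inter> M) = emeasure \<nu> (\<Union>i<m. A \<inter> piece i)" using Union_piece by (intro arg_cong[of _ _ "emeasure \<nu>"]) auto
    also have "\<dots> = (\<Sum>i<m. emeasure \<nu> (A \<inter> piece i))"
    proof (rule sum_emeasure[symmetric])
      show "(\<lambda>i. A \<inter> piece i) ` {..<m} \<subseteq> sets \<nu>" using A piece_borel sets by auto
      show "disjoint_family_on (\<lambda>i. A \<inter> piece i) {..<m}"
      proof (unfold disjoint_family_on_def, intro ballI impI)
        fix i j assume "i \<in> {..<m}" "j \<in> {..<m}" "i \<noteq> j"
        from disjoint_family_onD[OF piece_disjoint this] show "A \<inter> piece i \<inter> (A \<inter> piece j) = {}" by blast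
      qed
    qed simp
    also have "\<dots> = (\<Sum>i<m. \<integral>\<^sup>+x\<in>{x\<in>core i. \<phi> i x \<in> A}. ennreal (area_density (\<phi> i) x) \<partial>lborel)"
    proof (intro sum.cong refl)
      fix i assume "i \<in> {..<m}"
      then have i: "i < m" by simp
      have "A \<inter> piece i = \<phi> i ` {x\<in>core i. \<phi> i x \<in> A}" using image_core[of i] by auto
      moreover have "{x\<in>core i. \<phi> i x \<in> A} \<in> sets lborel"
        using borel_chart_preimage[OF param[OF i] core_borel[OF i] core_V[OF i] A] by simp
      moreover have "{x\<in>core i. \<phi> i x \<in> A} \<subseteq> V i" using core_V[OF i] by blast
      ultimately show "emeasure \<nu> (A \<inter> piece i) = (\<integral>\<^sup>+x\<in>{x\<in>core i. \<phi> i x \<in> A}. ennreal (area_density (\<phi> i) x) \<partial>lborel)"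
        using \<nu> param[OF i] unfolding is_surface_measure_def by simp
    qed
    finally show ?thesis by simp
  qed
  show "sets \<mu> = sets area" using assms by (simp add: is_surface_measure_def)
  then show "emeasure \<mu> A = emeasure area A" if "A \<in> sets \<mu>" for A
    using *[OF assms] *[OF is_surface_measure_area] that by simp
qed

lemma surface_measure_eq_area: "surface_measure TYPE('n) M = area"
  unfolding surface_measure_def
  by (rule the_equality) (use is_surface_measure_area is_surface_measure_unique in \<open>auto simp: is_surface_measure_def\<close>)

lemma finite_area: "emeasure area UNIV < \<infinity>"
proof -
  have "emeasure (chart_measure (V i) (\<phi> i) (core i)) UNIV < \<infinity>" if i: "i < m" for i
  proof -
    have "continuous_on (cball (c i) (2 * \<epsilon> i)) (area_density (\<phi> i))"
      using continuous_on_area_density[OF param[OF i]] cball_V[OF i] by (rule continuous_on_subset)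
    then have "bounded (area_density (\<phi> i) ` cball (c i) (2 * \<epsilon> i))"
      by (intro compact_imp_bounded compact_continuous_image) auto
    then obtain B where B: "\<And>x. x \<in> cball (c i) (2 * \<epsilon> i) \<Longrightarrow> area_density (\<phi> i) x \<le> B"
      unfolding bounded_iff by (metis image_eqI real_norm_def abs_le_D1)
    have sub: "core i \<subseteq> cball (c i) (2 * \<epsilon> i)" using core_ball[of i] eps(1)[OF i] by (force simp: subset_iff)
    have "emeasure (chart_measure (V i) (\<phi> i) (core i)) UNIV = (\<integral>\<^sup>+x\<in>core i. ennreal (area_density (\<phi> i) x) \<partial>lborel)"
      by (subst emeasure_chart_measure[OF param[OF i] core_borel[OF i] core_V[OF i]]) auto
    also have "\<dots> \<le> (\<integral>\<^sup>+x. ennreal B * indicator (cball (c i) (2 * \<epsilon> i)) x \<partial>lborel)"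
      using B sub by (intro nn_integral_mono) (auto simp: indicator_def intro!: ennreal_leI)
    also have "\<dots> = ennreal B * emeasure lborel (cball (c i) (2 * \<epsilon> i))" by (simp add: nn_integral_cmult_indicator)
    also have "\<dots> < \<infinity>" using emeasure_bounded_finite[OF bounded_cball, of "c i" "2 * \<epsilon> i"]
      by (simp add: ennreal_mult_less_top)
    finally show ?thesis .
  qed
  then show ?thesis by (subst emeasure_area) (auto simp: less_top[symmetric])
qed

text \<open>The formula for sets identifies the restriction of \<open>area\<close> to a chart image
  with a push-forward measure; equal measures have equal integrals.\<close>

lemma nn_integral_area_chart:
  fixes \<psi> :: "'n \<Rightarrow> 'a"
  assumes p: "local_param M W \<psi>" and E: "E \<in> sets borel" "E \<subseteq> W" and h: "h \<in> borel_measurable borel"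
  shows "(\<integral>\<^sup>+u. indicator (\<psi> ` E) u * h u \<partial>area) = (\<integral>\<^sup>+x. indicator E x * ennreal (area_density \<psi> x) * h (\<psi> x) \<partial>lborel)"
proof -
  have im: "\<psi> ` E \<in> sets borel" by (rule borel_chart_image[OF p closed_M E])
  have "density area (indicator (\<psi> ` E)) = chart_measure W \<psi> E"
  proof (rule measure_eqI)
    fix A assume "A \<in> sets (density area (indicator (\<psi> ` E)))"
    then have A: "A \<in> sets borel" by simp
    have "emeasure (density area (indicator (\<psi> ` E))) A = emeasure area (\<psi> ` E \<inter> A)"
      using A im by (subst emeasure_density) (auto simp: indicator_inter_arith[symmetric] intro!: borel_measurable_indicator)
    also have "\<psi> ` E \<inter> A = \<psi> ` {x\<in>E. \<psi> x \<in> A}" by auto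
    also have "emeasure area \<dots> = (\<integral>\<^sup>+x\<in>{x\<in>E. \<psi> x \<in> A}. ennreal (area_density \<psi> x) \<partial>lborel)"
    proof -
      have "{x\<in>E. \<psi> x \<in> A} \<in> sets lborel" using borel_chart_preimage[OF p E A] by simp
      moreover have "{x\<in>E. \<psi> x \<in> A} \<subseteq> W" using E by blast
      ultimately show ?thesis using is_surface_measure_area p unfolding is_surface_measure_def by simp
    qed
    also have "\<dots> = emeasure (chart_measure W \<psi> E) A" by (rule emeasure_chart_measure[symmetric, OF p E A])
    finally show "emeasure (density area (indicator (\<psi> ` E))) A = emeasure (chart_measure W \<psi> E) A" .
  qed simp
  from arg_cong[OF this, of "\<lambda>N. \<integral>\<^sup>+u. h u \<partial>N"] show ?thesis
    using im h by (simp add: nn_integral_density borel_measurable_indicator nn_integral_chart_measure[OF p E h] cong: measurable_cong_sets)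
qed

end

text \<open>Since inverse charts are continuous, the image of a small ball is relatively open in
  \<open>M\<close>, and compactness selects finitely many such images.\<close>

lemma atlas_exists:
  fixes M :: "'a::euclidean_space set"
  assumes M: "smooth_submanifold TYPE('n::euclidean_space) M" and C: "compact M"
  shows "\<exists>m V (\<phi> :: nat \<Rightarrow> 'n \<Rightarrow> 'a) c \<epsilon>. atlas M m V \<phi> c \<epsilon>"
proof -
  have "\<exists>V (\<phi> :: 'n \<Rightarrow> 'a) c \<epsilon> U. local_param M V \<phi> \<and> 0 < \<epsilon> \<and> \<epsilon> \<le> 1 \<and> cball c (2 * \<epsilon>) \<subseteq> V \<and> open U \<and> p \<in> U \<and> \<phi> ` ball c \<epsilon> = M \<inter> U" if p: "p \<in> M" for p
  proof -
    obtain V and \<phi> :: "'n \<Rightarrow> 'a" where V: "local_param M V \<phi>" "p \<in> \<phi> ` V" using M p unfolding smooth_submanifold_def by blast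
    then obtain c where c: "c \<in> V" "\<phi> c = p" by blast
    obtain e where e: "e > 0" "cball c e \<subseteq> V" using local_paramD(1)[OF V(1)] c(1) open_contains_cball by blast
    define \<epsilon> where "\<epsilon> = min 1 (e/2)"
    have \<epsilon>: "0 < \<epsilon>" "\<epsilon> \<le> 1" "cball c (2 * \<epsilon>) \<subseteq> V" using e by (auto simp: \<epsilon>_def subset_iff)
    obtain U where U: "open U" "\<phi> ` V = M \<inter> U" using local_paramD(6)[OF V(1)] by blast
    obtain A where A: "open A" "A \<inter> \<phi> ` V = inv_into V \<phi> -` ball c \<epsilon> \<inter> \<phi> ` V"
      using local_paramD(4)[OF V(1)] unfolding continuous_on_open_invariant by blast
    have bV: "ball c \<epsilon> \<subseteq> V" using \<epsilon> by (force simp: subset_iff)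
    have "\<phi> ` ball c \<epsilon> = inv_into V \<phi> -` ball c \<epsilon> \<inter> \<phi> ` V"
      using bV local_paramD(3)[OF V(1)] by (auto simp: inv_into_f_f subset_iff simp del: mem_ball)
    also have "\<dots> = A \<inter> \<phi> ` V" by (rule A(2)[symmetric])
    also have "\<dots> = M \<inter> (U \<inter> A)" unfolding U(2) by auto
    finally have im: "\<phi> ` ball c \<epsilon> = M \<inter> (U \<inter> A)" .
    have "p \<in> \<phi> ` ball c \<epsilon>" using c \<epsilon> by auto
    then show ?thesis using V(1) \<epsilon> open_Int[OF U(1) A(1)] im
      by (intro exI[of _ V] exI[of _ \<phi>] exI[of _ c] exI[of _ \<epsilon>] exI[of _ "U \<inter> A"]) auto
  qed
  \<comment> \<open>Chart domain, chart, centre, radius and open set are packed into one tuple so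
    that a single choice function yields all of them.\<close>
  then have "\<forall>p\<in>M. \<exists>w. local_param M (fst w) (fst (snd w) :: 'n \<Rightarrow> 'a) \<and> 0 < fst (snd (snd (snd w))) \<and> fst (snd (snd (snd w))) \<le> 1 \<and>
      cball (fst (snd (snd w))) (2 * fst (snd (snd (snd w)))) \<subseteq> fst w \<and> open (snd (snd (snd (snd w)))) \<and> p \<in> snd (snd (snd (snd w))) \<and>
      fst (snd w) ` ball (fst (snd (snd w))) (fst (snd (snd (snd w)))) = M \<inter> snd (snd (snd (snd w)))"
    (is "\<forall>p\<in>M. \<exists>w. ?Q p w") by simp
  from bchoice[OF this] obtain w where w: "\<forall>p\<in>M. ?Q p (w p)" by blast
  define V where "V p = fst (w p)" for p
  define \<phi> where "\<phi> p = fst (snd (w p))" for p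
  define c where "c p = fst (snd (snd (w p)))" for p
  define \<epsilon> where "\<epsilon> p = fst (snd (snd (snd (w p))))" for p
  define U where "U p = snd (snd (snd (snd (w p))))" for p
  have 1: "\<And>p. p \<in> M \<Longrightarrow> local_param M (V p) (\<phi> p)" "\<And>p. p \<in> M \<Longrightarrow> 0 < \<epsilon> p" "\<And>p. p \<in> M \<Longrightarrow> \<epsilon> p \<le> 1"
    "\<And>p. p \<in> M \<Longrightarrow> cball (c p) (2 * \<epsilon> p) \<subseteq> V p"
    and 2: "\<And>p. p \<in> M \<Longrightarrow> open (U p)" "\<And>p. p \<in> M \<Longrightarrow> p \<in> U p" "\<And>p. p \<in> M \<Longrightarrow> \<phi> p ` ball (c p) (\<epsilon> p) = M \<inter> U p"
    using w by (simp_all add: V_def \<phi>_def c_def \<epsilon>_def U_def)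
  obtain T where T: "T \<subseteq> M" "finite T" "M \<subseteq> (\<Union>p\<in>T. U p)"
    using compactE_image[OF C, of M U] 2 by blast
  obtain h :: "nat \<Rightarrow> 'a" where h: "bij_betw h {0..<card T} T" using ex_bij_betw_nat_finite[OF T(2)] by blast
  have hM: "h i \<in> M" if "i < card T" for i using h that T(1) by (auto simp: bij_betw_def)
  have "M = (\<Union>p\<in>T. M \<inter> U p)" using T(3) by blast
  also have "\<dots> = (\<Union>p\<in>T. \<phi> p ` ball (c p) (\<epsilon> p))" using 2(3) T(1) by (intro SUP_cong refl) auto
  also have "\<dots> = (\<Union>i<card T. \<phi> (h i) ` ball (c (h i)) (\<epsilon> (h i)))"
  proof -
    have "T = h ` {..<card T}" using h unfolding bij_betw_def by (simp add: lessThan_atLeast0)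
    from arg_cong[OF this, of "\<lambda>S. \<Union>p\<in>S. \<phi> p ` ball (c p) (\<epsilon> p)"] show ?thesis by simp
  qed
  finally have "atlas M (card T) (\<lambda>i. V (h i)) (\<lambda>i. \<phi> (h i)) (\<lambda>i. c (h i)) (\<lambda>i. \<epsilon> (h i))"
    by unfold_locales (use 1 hM C in auto)
  then show ?thesis by blast
qed

section \<open>The double coaxial derivative of a power of the distance\<close>

lemma dderivI: "((\<lambda>t. f (x + t *\<^sub>R v)) has_vector_derivative D) (at 0) \<Longrightarrow> dderiv f v x = D"
  unfolding dderiv_def by (rule vector_derivative_at)

lemma dderiv_cong_open:
  assumes "open S" "x \<in> S" "\<And>y. y \<in> S \<Longrightarrow> f y = g y"
  shows "dderiv f v x = dderiv g v x"
proof -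
  have "open ((\<lambda>t::real. x + t *\<^sub>R v) -` S)"
    using assms(1) by (intro open_vimage continuous_intros) auto
  then have "\<forall>\<^sub>F t in nhds 0. t \<in> (\<lambda>t::real. x + t *\<^sub>R v) -` S"
    using assms(2) by (intro eventually_nhds_in_open) auto
  then have "\<forall>\<^sub>F t in nhds 0. f (x + t *\<^sub>R v) = g (x + t *\<^sub>R v)"
    by eventually_elim (use assms(3) in auto)
  then show ?thesis unfolding dderiv_def by (intro vector_derivative_cong_eq) (auto simp: assms)
qed

definition npow :: "complex \<Rightarrow> 'a::real_normed_vector \<Rightarrow> complex" where
  "npow a x = of_real (norm x) powr a"

text \<open>Written with the squared norm, the exponent involves no root and is smooth wherever
  \<open>x \<bullet> x\<close> stays positive. This is the shape in which the kernel is blown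
  up.\<close>

lemma npow_exp:
  fixes x :: "'a::real_inner"
  assumes "x \<noteq> 0"
  shows "npow a x = exp (a * of_real (ln (x \<bullet> x) / 2))"
proof -
  have l: "ln (norm x) = ln (x \<bullet> x) / 2"
    using assms by (simp add: norm_eq_sqrt_inner ln_sqrt)
  have "npow a x = exp (a * of_real (ln (norm x)))" using assms by (simp add: npow_def powr_def Ln_of_real)
  then show ?thesis unfolding l .
qed

lemma npow_minus_2:
  fixes x :: "'a::real_inner"
  assumes "x \<noteq> 0"
  shows "npow (a - 2) x = npow a x * of_real (inverse (x \<bullet> x))"
proof -
  have pos: "x \<bullet> x > 0" using assms by simp
  have "exp (- of_real (ln (x \<bullet> x)) :: complex) = of_real (inverse (x \<bullet> x))"
    using pos by (simp add: exp_minus exp_of_real)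
  moreover have "exp ((a - 2) * of_real (ln (x \<bullet> x) / 2)) = exp (a * of_real (ln (x \<bullet> x) / 2)) * exp (- of_real (ln (x \<bullet> x)) :: complex)"
  proof -
    have "(a - 2) * of_real (ln (x \<bullet> x) / 2) = a * of_real (ln (x \<bullet> x) / 2) + - of_real (ln (x \<bullet> x))"
      by (simp add: field_simps)
    then show ?thesis unfolding exp_add[symmetric] by (rule arg_cong)
  qed
  ultimately show ?thesis by (simp only: npow_exp[OF assms])
qed

lemma has_vector_derivative_npow:
  fixes x d :: "'a::real_inner"
  assumes x: "x \<noteq> 0"
  shows "((\<lambda>t. npow a (x + t *\<^sub>R d)) has_vector_derivative (a * of_real (x \<bullet> d) * npow (a - 2) x)) (at 0)"
proof -
  have pos: "x \<bullet> x > 0" using x by simp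
  define h where "h t = (x + t *\<^sub>R d) \<bullet> (x + t *\<^sub>R d)" for t
  have h: "h t = x \<bullet> x + 2 * t * (x \<bullet> d) + t\<^sup>2 * (d \<bullet> d)" for t
    by (simp add: h_def algebra_simps power2_eq_square inner_commute)
  have "(h has_real_derivative 2 * (x \<bullet> d)) (at 0)" unfolding h[abs_def] by (auto intro!: derivative_eq_intros)
  then have "((\<lambda>t. ln (h t) / 2) has_real_derivative (x \<bullet> d) * inverse (x \<bullet> x)) (at 0)"
    using pos by (auto intro!: derivative_eq_intros simp: h field_simps)
  then have "((\<lambda>t. of_real (ln (h t) / 2) :: complex) has_vector_derivative of_real ((x \<bullet> d) * inverse (x \<bullet> x))) (at 0)"
    by (rule has_vector_derivative_of_real)
  then have "((\<lambda>t. a * of_real (ln (h t) / 2)) has_vector_derivative a * of_real ((x \<bullet> d) * inverse (x \<bullet> x))) (at 0)"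
    by (rule has_vector_derivative_mult_right)
  from field_vector_diff_chain_at[OF this DERIV_exp]
  have "((\<lambda>t. exp (a * of_real (ln (h t) / 2))) has_vector_derivative a * of_real ((x \<bullet> d) * inverse (x \<bullet> x)) * exp (a * of_real (ln (h 0) / 2))) (at 0)"
    by (simp add: o_def)
  also have "a * of_real ((x \<bullet> d) * inverse (x \<bullet> x)) * exp (a * of_real (ln (h 0) / 2)) = a * of_real (x \<bullet> d) * npow (a - 2) x"
  proof -
    have "exp (a * of_real (ln (h 0) / 2)) = npow a x" by (simp add: npow_exp[OF x] h)
    then show ?thesis by (simp only: npow_minus_2[OF x] of_real_mult mult_ac)
  qed
  finally have D: "((\<lambda>t. exp (a * of_real (ln (h t) / 2))) has_vector_derivative a * of_real (x \<bullet> d) * npow (a - 2) x) (at 0)" .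
  have "open ((\<lambda>t. x + t *\<^sub>R d) -` (- {0}))" by (intro open_vimage continuous_intros open_Compl closed_singleton)
  from has_vector_derivative_transform_within_open[OF D this] x show ?thesis
    by (auto simp: npow_exp h_def)
qed

lemma has_vector_derivative_inner_line:
  "((\<lambda>t. of_real ((x + t *\<^sub>R d) \<bullet> e) :: complex) has_vector_derivative of_real (d \<bullet> e)) (at 0)"
  by (rule has_vector_derivative_of_real) (auto intro!: derivative_eq_intros simp: inner_add_left)

section \<open>Orthogonal projections and their traces\<close>

definition orthonormal :: "'a::euclidean_space set \<Rightarrow> bool" where
  "orthonormal B \<longleftrightarrow> finite B \<and> pairwise orthogonal B \<and> (\<forall>b\<in>B. norm b = 1)"

definition onproj :: "'a::euclidean_space set \<Rightarrow> 'a \<Rightarrow> 'a" where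
  "onproj B y = (\<Sum>b\<in>B. (y \<bullet> b) *\<^sub>R b)"

lemma linear_onproj: "linear (onproj B)"
  unfolding onproj_def by (rule linearI) (simp_all add: inner_add_left scaleR_add_left sum.distrib scaleR_sum_right)

lemma orthonormal_inner:
  assumes "orthonormal B" "b \<in> B" "c \<in> B"
  shows "b \<bullet> c = (if b = c then 1 else 0)"
  using assms by (auto simp: orthonormal_def pairwise_def orthogonal_def norm_eq_1)

lemma onproj_inner: "onproj B y \<bullet> z = (\<Sum>b\<in>B. (y \<bullet> b) * (z \<bullet> b))"
  by (simp only: onproj_def inner_sum_left inner_scaleR_left inner_commute[of z])

lemma onproj_inner_sym: "onproj B y \<bullet> z = y \<bullet> onproj B z"
  by (simp add: onproj_inner inner_commute[of y] mult.commute)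

lemma onproj_inner_basis:
  assumes "orthonormal B" "b \<in> B"
  shows "onproj B y \<bullet> b = y \<bullet> b"
proof -
  have "onproj B y \<bullet> b = (\<Sum>c\<in>B. if c = b then y \<bullet> b else 0)"
    unfolding onproj_inner using orthonormal_inner[OF assms] by (intro sum.cong) (auto split: if_splits)
  then show ?thesis using assms by (simp add: orthonormal_def)
qed

lemma onproj_idem:
  assumes "orthonormal B"
  shows "onproj B (onproj B y) = onproj B y"
  unfolding onproj_def[of B "onproj B y"] using onproj_inner_basis[OF assms] by (simp add: onproj_def)

lemma norm_onproj:
  assumes "orthonormal B"
  shows "(norm (onproj B y))\<^sup>2 = (\<Sum>b\<in>B. (y \<bullet> b)\<^sup>2)"
proof -
  have "(norm (onproj B y))\<^sup>2 = onproj B (onproj B y) \<bullet> y" by (simp add: power2_norm_eq_inner onproj_inner_sym)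
  then show ?thesis by (simp add: onproj_idem[OF assms] onproj_inner power2_eq_square)
qed

lemma norm_onproj_le:
  assumes "orthonormal B"
  shows "norm (onproj B y) \<le> norm y"
proof -
  have "(norm (onproj B y))\<^sup>2 = onproj B (onproj B y) \<bullet> y" by (simp add: power2_norm_eq_inner onproj_inner_sym)
  also have "\<dots> \<le> norm (onproj B y) * norm y" unfolding onproj_idem[OF assms] by (rule norm_cauchy_schwarz)
  finally show ?thesis by (cases "onproj B y = 0") (auto simp: power2_eq_square)
qed

definition tr :: "('a::euclidean_space \<Rightarrow> 'a) \<Rightarrow> real" where
  "tr P = (\<Sum>i\<in>Basis. P i \<bullet> i)"

text \<open>For a symmetric \<open>P\<close>, such as an orthogonal projection, this is the trace of
  \<open>P \<circ> Q\<close>.\<close>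

definition tr2 :: "('a::euclidean_space \<Rightarrow> 'a) \<Rightarrow> ('a \<Rightarrow> 'a) \<Rightarrow> real" where
  "tr2 P Q = (\<Sum>i\<in>Basis. P i \<bullet> Q i)"

lemma tr_onproj:
  assumes "orthonormal B"
  shows "tr (onproj B) = (\<Sum>b\<in>B. 1)"
proof -
  have "tr (onproj B) = (\<Sum>b\<in>B. \<Sum>i\<in>Basis. (b \<bullet> i) * (b \<bullet> i))"
    unfolding tr_def onproj_inner by (subst sum.swap) (simp add: inner_commute)
  also have "\<dots> = (\<Sum>b\<in>B. b \<bullet> b)" by (simp add: euclidean_inner[symmetric])
  finally show ?thesis using assms by (simp add: orthonormal_inner)
qed

lemma tr2_onproj: "tr2 (onproj B) Q = (\<Sum>b\<in>B. Q b \<bullet> b)" if Q: "linear Q"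
proof -
  have "tr2 (onproj B) Q = (\<Sum>b\<in>B. \<Sum>i\<in>Basis. (b \<bullet> i) * (Q i \<bullet> b))"
    unfolding tr2_def onproj_inner by (subst sum.swap) (simp add: inner_commute)
  also have "\<dots> = (\<Sum>b\<in>B. Q (\<Sum>i\<in>Basis. (b \<bullet> i) *\<^sub>R i) \<bullet> b)"
    by (simp add: linear_sum[OF Q] linear_scale[OF Q] inner_sum_left)
  finally show ?thesis by (simp add: euclidean_representation)
qed

text \<open>Sorting the double derivative by powers of the norm yields the exponents
  \<open>s - 4\<close>, \<open>s - 6\<close> and \<open>s - 8\<close>; with the power
  \<open>s\<close> extracted, they become the powers 2, 3, 4 of
  \<open>inverse (y \<bullet> y)\<close>. The geometry sits in \<open>kcoef\<close> and the
  dependence on \<open>s\<close> in the factors \<open>kpoly\<close>, the split that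
  \<open>blowup_continuation\<close> expects.\<close>

definition kcoef :: "nat \<Rightarrow> ('a::euclidean_space \<Rightarrow> 'a) \<Rightarrow> ('a \<Rightarrow> 'a) \<Rightarrow> 'a \<Rightarrow> real" where
  "kcoef i P Q y =
    (if i = 0 then (tr P * tr Q + 2 * tr2 P Q) * inverse (y \<bullet> y) ^ 2
     else if i = 1 then (tr Q * (P y \<bullet> P y) + 4 * (P y \<bullet> Q y) + tr P * (Q y \<bullet> Q y)) * inverse (y \<bullet> y) ^ 3
     else (P y \<bullet> P y) * (Q y \<bullet> Q y) * inverse (y \<bullet> y) ^ 4)"

definition kpoly :: "nat \<Rightarrow> complex \<Rightarrow> complex" where
  "kpoly i s = (if i = 0 then s * (s - 2) else if i = 1 then s * (s - 2) * (s - 4) else s * (s - 2) * (s - 4) * (s - 6))"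

text \<open>For the orthogonal projections \<open>P\<close>, \<open>Q\<close> onto the normal spaces at \<open>u\<close>, \<open>v\<close> this is the value of
  \<open>\<Delta>\<^sub>u \<Delta>\<^sub>v \<parallel>v - u\<parallel>\<^sup>s\<close> at \<open>y = v - u\<close>, except that the value \<open>0\<close> is imposed on the diagonal.\<close>

definition kern :: "complex \<Rightarrow> ('a::euclidean_space \<Rightarrow> 'a) \<Rightarrow> ('a \<Rightarrow> 'a) \<Rightarrow> 'a \<Rightarrow> complex" where
  "kern s P Q y = (if y = 0 then 0 else
     (\<Sum>i<3. kpoly i s * of_real (kcoef i P Q y)) * exp (s * of_real (ln (y \<bullet> y) / 2)))"

lemma kpoly_holomorphic: "kpoly i holomorphic_on UNIV"
  unfolding kpoly_def[abs_def] by (cases "i = 0"; cases "i = 1") (auto intro!: holomorphic_intros)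

lemma kcoef_scale:
  assumes "linear P" "linear Q" "\<rho> \<noteq> 0"
  shows "kcoef i P Q (\<rho> *\<^sub>R y) = inverse \<rho> ^ 4 * kcoef i P Q y"
proof -
  define w where "w = inverse (y \<bullet> y)"
  have w: "inverse ((\<rho> *\<^sub>R y) \<bullet> (\<rho> *\<^sub>R y)) = inverse \<rho> ^ 2 * w"
    by (simp add: w_def power2_eq_square)
  have r: "\<rho> ^ 2 * inverse \<rho> ^ 6 = inverse \<rho> ^ 4" "\<rho> ^ 4 * inverse \<rho> ^ 8 = inverse \<rho> ^ 4"
    using assms(3) by (simp_all add: field_simps eval_nat_numeral)
  have i: "P (\<rho> *\<^sub>R y) \<bullet> P (\<rho> *\<^sub>R y) = \<rho> ^ 2 * (P y \<bullet> P y)" "P (\<rho> *\<^sub>R y) \<bullet> Q (\<rho> *\<^sub>R y) = \<rho> ^ 2 * (P y \<bullet> Q y)"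
    "Q (\<rho> *\<^sub>R y) \<bullet> Q (\<rho> *\<^sub>R y) = \<rho> ^ 2 * (Q y \<bullet> Q y)"
    by (simp_all add: linear_scale[OF assms(1)] linear_scale[OF assms(2)] power2_eq_square)
  have "(tr Q * (\<rho> ^ 2 * (P y \<bullet> P y)) + 4 * (\<rho> ^ 2 * (P y \<bullet> Q y)) + tr P * (\<rho> ^ 2 * (Q y \<bullet> Q y))) * (inverse \<rho> ^ 2 * w) ^ 3
      = (\<rho> ^ 2 * inverse \<rho> ^ 6) * ((tr Q * (P y \<bullet> P y) + 4 * (P y \<bullet> Q y) + tr P * (Q y \<bullet> Q y)) * w ^ 3)"
    by (simp add: power_mult_distrib power_mult[symmetric] algebra_simps)
  moreover have "(\<rho> ^ 2 * (P y \<bullet> P y)) * (\<rho> ^ 2 * (Q y \<bullet> Q y)) * (inverse \<rho> ^ 2 * w) ^ 4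
      = (\<rho> ^ 4 * inverse \<rho> ^ 8) * ((P y \<bullet> P y) * (Q y \<bullet> Q y) * w ^ 4)"
    by (simp add: power_mult_distrib power_mult[symmetric] power_add[symmetric] algebra_simps flip: power2_eq_square)
  moreover have "T * (inverse \<rho> ^ 2 * w) ^ 2 = inverse \<rho> ^ 4 * (T * w ^ 2)" for T
    by (simp add: power_mult_distrib power_mult[symmetric])
  ultimately show ?thesis unfolding kcoef_def w i r w_def[symmetric] by auto
qed

lemma kern_scale:
  assumes P: "linear P" "linear Q" and r: "\<rho> > 0"
  shows "kern s P Q (\<rho> *\<^sub>R y) = of_real \<rho> powr (s - 4) * kern s P Q y"
proof (cases "y = 0")
  case False
  then have pos: "y \<bullet> y > 0" by simp
  have "ln ((\<rho> *\<^sub>R y) \<bullet> (\<rho> *\<^sub>R y)) / 2 = ln \<rho> + ln (y \<bullet> y) / 2"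
    using r pos False by (simp add: ln_mult power2_eq_square[symmetric] ln_realpow)
  then have e: "exp (s * of_real (ln ((\<rho> *\<^sub>R y) \<bullet> (\<rho> *\<^sub>R y)) / 2)) = exp (s * of_real (ln \<rho>)) * exp (s * of_real (ln (y \<bullet> y) / 2))"
  proof -
    assume l: "ln ((\<rho> *\<^sub>R y) \<bullet> (\<rho> *\<^sub>R y)) / 2 = ln \<rho> + ln (y \<bullet> y) / 2"
    show ?thesis unfolding l exp_add[symmetric] of_real_add distrib_left ..
  qed
  have p: "of_real \<rho> powr (s - 4) = exp (s * of_real (ln \<rho>)) * of_real (inverse \<rho> ^ 4)"
  proof -
    have "exp (4 * of_real (ln \<rho>) :: complex) = of_real (\<rho> ^ 4)"
      using r by (metis exp_of_real of_real_mult of_real_numeral exp_of_nat_mult exp_ln of_nat_numeral of_real_power)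
    then show ?thesis using r by (simp add: powr_def Ln_of_real left_diff_distrib exp_diff field_simps)
  qed
  have "(\<Sum>i<3. kpoly i s * of_real (kcoef i P Q (\<rho> *\<^sub>R y))) = of_real (inverse \<rho> ^ 4) * (\<Sum>i<3. kpoly i s * of_real (kcoef i P Q y))"
    using r by (simp add: kcoef_scale[OF P] sum_distrib_left mult.left_commute)
  then show ?thesis using False r e p by (simp add: kern_def)
qed (simp add: kern_def)

lemma kcoef_minus:
  assumes "linear P" "linear Q"
  shows "kcoef i P Q (- y) = kcoef i P Q y"
  using kcoef_scale[OF assms, of "-1" i y] by simp

text \<open>Reconciles the form of the kernel used for the continuation with the powers of the norm
  that differentiation produces.\<close>

lemma kern_npow:
  fixes y :: "'a::euclidean_space"
  assumes "y \<noteq> 0"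
  shows "kern s P Q y = s * (s - 2) *
    (of_real (tr P * tr Q + 2 * tr2 P Q) * npow (s - 4) y
     + (s - 4) * of_real (tr Q * (P y \<bullet> P y) + 4 * (P y \<bullet> Q y) + tr P * (Q y \<bullet> Q y)) * npow (s - 6) y
     + (s - 4) * (s - 6) * of_real ((P y \<bullet> P y) * (Q y \<bullet> Q y)) * npow (s - 8) y)"
proof -
  define \<nu> where "\<nu> = (of_real (inverse (y \<bullet> y)) :: complex)"
  have 2: "npow (s - 2) y = npow s y * \<nu>" using npow_minus_2[OF assms, of s] by (simp add: \<nu>_def)
  have 4: "npow (s - 4) y = npow s y * \<nu> ^ 2" using npow_minus_2[OF assms, of "s - 2"] 2 by (simp add: \<nu>_def power2_eq_square)
  have 6: "npow (s - 6) y = npow s y * \<nu> ^ 3" using npow_minus_2[OF assms, of "s - 4"] 4 by (simp add: \<nu>_def power2_eq_square power3_eq_cube)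
  have 8: "npow (s - 8) y = npow s y * \<nu> ^ 4" using npow_minus_2[OF assms, of "s - 6"] 6 by (simp add: \<nu>_def power4_eq_xxxx power3_eq_cube)
  have e: "exp (s * of_real (ln (y \<bullet> y) / 2)) = npow s y" using npow_exp[OF assms, of s] by simp
  have n: "of_real (inverse (y \<bullet> y) ^ k) = \<nu> ^ k" for k by (simp add: \<nu>_def)
  have "kern s P Q y = (\<Sum>i<3. kpoly i s * of_real (kcoef i P Q y)) * npow s y"
    unfolding kern_def e using assms by simp
  also have "(\<Sum>i<3. kpoly i s * of_real (kcoef i P Q y)) =
     s * (s - 2) * (of_real (tr P * tr Q + 2 * tr2 P Q) * \<nu> ^ 2)
     + s * (s - 2) * (s - 4) * (of_real (tr Q * (P y \<bullet> P y) + 4 * (P y \<bullet> Q y) + tr P * (Q y \<bullet> Q y)) * \<nu> ^ 3)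
     + s * (s - 2) * (s - 4) * (s - 6) * (of_real ((P y \<bullet> P y) * (Q y \<bullet> Q y)) * \<nu> ^ 4)"
    by (simp only: n[symmetric] of_real_mult[symmetric]) (simp add: numeral_3_eq_3 kpoly_def kcoef_def)
  finally show ?thesis unfolding 4 6 8 by (simp only: algebra_simps)
qed

section \<open>Second derivatives of the power in either variable\<close>

lemma double_derivative_inner:
  fixes v w c :: "'a::euclidean_space"
  assumes "v \<noteq> w" "norm c = 1"
  shows "dderiv (dderiv (\<lambda>z. Nfun s (z - w)) c) c v =
    s * npow (s - 2) (v - w) + s * (s - 2) * of_real (((v - w) \<bullet> c)\<^sup>2) * npow (s - 4) (v - w)"
proof -
  have 1: "dderiv (\<lambda>z. Nfun s (z - w)) c z = s * of_real ((z - w) \<bullet> c) * npow (s - 2) (z - w)" if "z \<in> - {w}" for z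
  proof (rule dderivI)
    have "z - w \<noteq> 0" using that by simp
    from has_vector_derivative_npow[OF this, of s c]
    show "((\<lambda>t. Nfun s (z + t *\<^sub>R c - w)) has_vector_derivative s * of_real ((z - w) \<bullet> c) * npow (s - 2) (z - w)) (at 0)"
      by (simp add: Nfun_def npow_def add_diff_eq diff_add_eq)
  qed
  have "dderiv (dderiv (\<lambda>z. Nfun s (z - w)) c) c v = dderiv (\<lambda>z. s * (of_real ((z - w) \<bullet> c) * npow (s - 2) (z - w))) c v"
    by (rule dderiv_cong_open[of "- {w}"]) (use assms 1 in auto)
  also have "\<dots> = s * npow (s - 2) (v - w) + s * (s - 2) * of_real (((v - w) \<bullet> c)\<^sup>2) * npow (s - 4) (v - w)"
  proof (rule dderivI)
    have y: "v - w \<noteq> 0" using assms by simp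
    have cc: "c \<bullet> c = 1" using assms(2) by (simp add: norm_eq_1)
    have "((\<lambda>t. s * (of_real ((v - w + t *\<^sub>R c) \<bullet> c) * npow (s - 2) (v - w + t *\<^sub>R c))) has_vector_derivative
        s * (of_real ((v - w + 0 *\<^sub>R c) \<bullet> c) * ((s - 2) * of_real ((v - w) \<bullet> c) * npow (s - 2 - 2) (v - w))
           + of_real (c \<bullet> c) * npow (s - 2) (v - w + 0 *\<^sub>R c))) (at 0)"
      by (intro has_vector_derivative_mult_right has_vector_derivative_mult has_vector_derivative_inner_line has_vector_derivative_npow[OF y])
    then show "((\<lambda>t. s * (of_real ((v + t *\<^sub>R c - w) \<bullet> c) * npow (s - 2) (v + t *\<^sub>R c - w))) has_vector_derivative
       s * npow (s - 2) (v - w) + s * (s - 2) * of_real (((v - w) \<bullet> c)\<^sup>2) * npow (s - 4) (v - w)) (at 0)"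
      by (simp add: cc add_diff_eq diff_add_eq power2_eq_square algebra_simps)
  qed
  finally show ?thesis .
qed

text \<open>\<open>G\<close> is what the coaxial derivative at \<open>v\<close> returns as a
  function of \<open>w\<close>, with \<open>k\<close> for the trace of \<open>Q\<close>. The
  projection \<open>Q\<close> belongs to \<open>v\<close> and stays fixed while \<open>w\<close>
  moves, and \<open>v - w\<close> moves in direction \<open>- b\<close>. Symmetry and idempotence of
  \<open>Q\<close> reduce \<open>Q y \<bullet> Q b\<close> to
  \<open>Q y \<bullet> b\<close>.\<close>

lemma double_derivative_outer:
  fixes u v b :: "'a::euclidean_space" and Q :: "'a \<Rightarrow> 'a" and k :: real and s :: complex
  assumes uv: "u \<noteq> v" and b: "norm b = 1" and Q: "linear Q" and sym: "\<And>y z. Q y \<bullet> z = y \<bullet> Q z" "\<And>y. Q (Q y) = Q y"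
  defines "G \<equiv> \<lambda>w. s * of_real k * npow (s - 2) (v - w) + s * (s - 2) * (of_real (Q (v - w) \<bullet> Q (v - w)) * npow (s - 4) (v - w))"
  shows "dderiv (dderiv G b) b u = s * (s - 2) *
    (of_real (k + 2 * (Q b \<bullet> b)) * npow (s - 4) (v - u)
     + (s - 4) * of_real (k * ((v - u) \<bullet> b)\<^sup>2 + 4 * (Q (v - u) \<bullet> b) * ((v - u) \<bullet> b) + Q (v - u) \<bullet> Q (v - u)) * npow (s - 6) (v - u)
     + (s - 4) * (s - 6) * of_real (((v - u) \<bullet> b)\<^sup>2 * (Q (v - u) \<bullet> Q (v - u))) * npow (s - 8) (v - u))"
proof -
  have bb: "b \<bullet> b = 1" using b by (simp add: norm_eq_1)
  have qb: "Q y \<bullet> Q b = Q y \<bullet> b" for y using sym by metis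
  have line: "v - (w + t *\<^sub>R b) = (v - w) + t *\<^sub>R (- b)" for w t by simp
  have dq: "((\<lambda>t. of_real (Q (y + t *\<^sub>R (- b)) \<bullet> Q (y + t *\<^sub>R (- b))) :: complex) has_vector_derivative of_real (- 2 * (Q y \<bullet> b))) (at 0)" for y
  proof (rule has_vector_derivative_of_real)
    have "(\<lambda>t. Q (y + t *\<^sub>R (- b)) \<bullet> Q (y + t *\<^sub>R (- b))) = (\<lambda>t. Q y \<bullet> Q y - 2 * t * (Q y \<bullet> b) + t\<^sup>2 * (Q b \<bullet> b))"
      by (auto simp: linear_add[OF Q] linear_scale[OF Q] linear_neg[OF Q] linear_diff[OF Q] inner_diff_left inner_diff_right qb inner_commute[of "Q b" "Q y"] power2_eq_square algebra_simps)
    then show "((\<lambda>t. Q (y + t *\<^sub>R (- b)) \<bullet> Q (y + t *\<^sub>R (- b))) has_real_derivative - 2 * (Q y \<bullet> b)) (at 0)"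
      by (auto intro!: derivative_eq_intros)
  qed
  have dqb: "((\<lambda>t. of_real (Q (y + t *\<^sub>R (- b)) \<bullet> b) :: complex) has_vector_derivative of_real (- (Q b \<bullet> b))) (at 0)" for y
  proof (rule has_vector_derivative_of_real)
    have "(\<lambda>t. Q (y + t *\<^sub>R (- b)) \<bullet> b) = (\<lambda>t. Q y \<bullet> b - t * (Q b \<bullet> b))"
      by (auto simp: linear_add[OF Q] linear_scale[OF Q] linear_neg[OF Q] linear_diff[OF Q] inner_diff_left)
    then show "((\<lambda>t. Q (y + t *\<^sub>R (- b)) \<bullet> b) has_real_derivative - (Q b \<bullet> b)) (at 0)"
      by (auto intro!: derivative_eq_intros)
  qed
  define G1 where "G1 y = of_real k * (of_real (y \<bullet> b) * npow (s - 4) y)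
      + (2 * (of_real (Q y \<bullet> b) * npow (s - 4) y) + (s - 4) * (of_real (Q y \<bullet> Q y) * (of_real (y \<bullet> b) * npow (s - 6) y)))" for y
  have 1: "dderiv G b w = - (s * (s - 2)) * G1 (v - w)" if "w \<in> - {v}" for w
  proof (rule dderivI)
    define y where "y = v - w"
    have y: "y \<noteq> 0" using that by (simp add: y_def)
    have "((\<lambda>t. s * of_real k * npow (s - 2) (y + t *\<^sub>R (- b)) + s * (s - 2) * (of_real (Q (y + t *\<^sub>R (- b)) \<bullet> Q (y + t *\<^sub>R (- b))) * npow (s - 4) (y + t *\<^sub>R (- b))))
      has_vector_derivative
       (s * of_real k * ((s - 2) * of_real (y \<bullet> (- b)) * npow (s - 2 - 2) y)
        + s * (s - 2) * (of_real (Q (y + 0 *\<^sub>R (- b)) \<bullet> Q (y + 0 *\<^sub>R (- b))) * ((s - 4) * of_real (y \<bullet> (- b)) * npow (s - 4 - 2) y)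
            + of_real (- 2 * (Q y \<bullet> b)) * npow (s - 4) (y + 0 *\<^sub>R (- b))))) (at 0)"
      by (intro has_vector_derivative_add has_vector_derivative_mult_right has_vector_derivative_mult dq has_vector_derivative_npow[OF y])
    then show "((\<lambda>t. G (w + t *\<^sub>R b)) has_vector_derivative - (s * (s - 2)) * G1 (v - w)) (at 0)"
      unfolding G_def line y_def[symmetric] by (rule has_vector_derivative_eq_rhs) (simp add: G1_def algebra_simps)
  qed
  have "dderiv (dderiv G b) b u = dderiv (\<lambda>w. - (s * (s - 2)) * G1 (v - w)) b u"
    by (rule dderiv_cong_open[of "- {v}"]) (use uv 1 in auto)
  also have "\<dots> = s * (s - 2) *
    (of_real (k + 2 * (Q b \<bullet> b)) * npow (s - 4) (v - u)
     + (s - 4) * of_real (k * ((v - u) \<bullet> b)\<^sup>2 + 4 * (Q (v - u) \<bullet> b) * ((v - u) \<bullet> b) + Q (v - u) \<bullet> Q (v - u)) * npow (s - 6) (v - u)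
     + (s - 4) * (s - 6) * of_real (((v - u) \<bullet> b)\<^sup>2 * (Q (v - u) \<bullet> Q (v - u))) * npow (s - 8) (v - u))"
  proof (rule dderivI)
    define y where "y = v - u"
    have y: "y \<noteq> 0" using uv by (simp add: y_def)
    note D = has_vector_derivative_add has_vector_derivative_mult_right has_vector_derivative_mult dq dqb has_vector_derivative_npow[OF y] has_vector_derivative_inner_line
    have "((\<lambda>t. - (s * (s - 2)) * G1 (y + t *\<^sub>R (- b))) has_vector_derivative
       - (s * (s - 2)) * (of_real k * (of_real ((y + 0 *\<^sub>R (- b)) \<bullet> b) * ((s - 4) * of_real (y \<bullet> (- b)) * npow (s - 4 - 2) y) + of_real ((- b) \<bullet> b) * npow (s - 4) (y + 0 *\<^sub>R (- b)))
        + (2 * (of_real (Q (y + 0 *\<^sub>R (- b)) \<bullet> b) * ((s - 4) * of_real (y \<bullet> (- b)) * npow (s - 4 - 2) y) + of_real (- (Q b \<bullet> b)) * npow (s - 4) (y + 0 *\<^sub>R (- b)))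
         + (s - 4) * (of_real (Q (y + 0 *\<^sub>R (- b)) \<bullet> Q (y + 0 *\<^sub>R (- b))) *
              (of_real ((y + 0 *\<^sub>R (- b)) \<bullet> b) * ((s - 6) * of_real (y \<bullet> (- b)) * npow (s - 6 - 2) y) + of_real ((- b) \<bullet> b) * npow (s - 6) (y + 0 *\<^sub>R (- b)))
            + of_real (- 2 * (Q y \<bullet> b)) * (of_real ((y + 0 *\<^sub>R (- b)) \<bullet> b) * npow (s - 6) (y + 0 *\<^sub>R (- b))))))) (at 0)"
      unfolding G1_def by (intro D)
    then show "((\<lambda>t. - (s * (s - 2)) * G1 (v - (u + t *\<^sub>R b))) has_vector_derivative
      s * (s - 2) *
    (of_real (k + 2 * (Q b \<bullet> b)) * npow (s - 4) (v - u)
     + (s - 4) * of_real (k * ((v - u) \<bullet> b)\<^sup>2 + 4 * (Q (v - u) \<bullet> b) * ((v - u) \<bullet> b) + Q (v - u) \<bullet> Q (v - u)) * npow (s - 6) (v - u)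
     + (s - 4) * (s - 6) * of_real (((v - u) \<bullet> b)\<^sup>2 * (Q (v - u) \<bullet> Q (v - u))) * npow (s - 8) (v - u))) (at 0)"
      unfolding line y_def[symmetric] by (rule has_vector_derivative_eq_rhs) (simp add: bb power2_eq_square algebra_simps)
  qed
  finally show ?thesis .
qed

text \<open>The basis chosen in \<open>coaxial_deriv\<close>. Nothing is known about how it varies
  with \<open>u\<close>, so all regularity is proved for the projection \<open>nproj\<close> onto
  its span instead.\<close>

definition normal_basis :: "'a::euclidean_space set \<Rightarrow> 'a \<Rightarrow> 'a set" where
  "normal_basis M u = (SOME B. B \<subseteq> normal_space M u \<and> pairwise orthogonal B \<and> (\<forall>b\<in>B. norm b = 1)
                     \<and> span B = normal_space M u)"

lemma coaxial_deriv_eq: "coaxial_deriv M u \<phi> = (\<Sum>b\<in>normal_basis M u. dderiv (dderiv \<phi> b) b u)"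
  unfolding coaxial_deriv_def normal_basis_def Let_def ..

lemma subspace_normal_space: "subspace (normal_space M u)"
  unfolding normal_space_def subspace_def by (auto simp: inner_add_left)

lemma normal_basis:
  shows "orthonormal (normal_basis M u)" "normal_basis M u \<subseteq> normal_space M u" "span (normal_basis M u) = normal_space M u"
proof -
  obtain B where "B \<subseteq> normal_space M u" "pairwise orthogonal B" "\<And>x. x \<in> B \<Longrightarrow> norm x = 1" "span B = normal_space M u"
    using orthonormal_basis_subspace[OF subspace_normal_space] by metis
  then have "\<exists>B. B \<subseteq> normal_space M u \<and> pairwise orthogonal B \<and> (\<forall>b\<in>B. norm b = 1) \<and> span B = normal_space M u" by blast
  from someI_ex[OF this] have B: "normal_basis M u \<subseteq> normal_space M u" "pairwise orthogonal (normal_basis M u)"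
    "\<forall>b\<in>normal_basis M u. norm b = 1" "span (normal_basis M u) = normal_space M u"
    unfolding normal_basis_def by blast+
  have "finite (normal_basis M u)"
    using pairwise_orthogonal_imp_finite[OF B(2)] .
  with B show "orthonormal (normal_basis M u)" "normal_basis M u \<subseteq> normal_space M u" "span (normal_basis M u) = normal_space M u"
    by (auto simp: orthonormal_def)
qed

definition nproj :: "'a::euclidean_space set \<Rightarrow> 'a \<Rightarrow> 'a \<Rightarrow> 'a" where
  "nproj M u = onproj (normal_basis M u)"

text \<open>The inner operator is evaluated at all \<open>w \<noteq> v\<close>, an open set around
  \<open>u\<close>, because the outer one differentiates it. Summation over both bases then leaves
  only traces and projected vectors, in which the bases no longer appear.\<close>

lemma double_coaxial_deriv:
  fixes M :: "'a::euclidean_space set"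
  assumes "u \<noteq> v"
  shows "coaxial_deriv M u (\<lambda>w. coaxial_deriv M v (\<lambda>z. Nfun s (z - w))) = kern s (nproj M u) (nproj M v) (v - u)"
proof -
  let ?B = "normal_basis M u" and ?C = "normal_basis M v"
  let ?P = "nproj M u" and ?Q = "nproj M v"
  note B = normal_basis(1)[of M u] and C = normal_basis(1)[of M v]
  define y where "y = v - u"
  define G where "G w = s * of_real (tr ?Q) * npow (s - 2) (v - w) + s * (s - 2) * (of_real (?Q (v - w) \<bullet> ?Q (v - w)) * npow (s - 4) (v - w))" for w
  have inner: "coaxial_deriv M v (\<lambda>z. Nfun s (z - w)) = G w" if "w \<in> - {v}" for w
  proof -
    have "coaxial_deriv M v (\<lambda>z. Nfun s (z - w)) = (\<Sum>c\<in>?C. s * npow (s - 2) (v - w) + s * (s - 2) * of_real (((v - w) \<bullet> c)\<^sup>2) * npow (s - 4) (v - w))"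
      unfolding coaxial_deriv_eq using C that by (intro sum.cong refl double_derivative_inner) (auto simp: orthonormal_def)
    also have "\<dots> = G w"
      unfolding G_def nproj_def tr_onproj[OF C] power2_norm_eq_inner[symmetric] norm_onproj[OF C]
      by (simp add: sum.distrib sum_distrib_left sum_distrib_right mult.assoc)
    finally show ?thesis .
  qed
  have outer: "dderiv (dderiv (\<lambda>w. coaxial_deriv M v (\<lambda>z. Nfun s (z - w))) b) b u = s * (s - 2) *
    (of_real (tr ?Q + 2 * (?Q b \<bullet> b)) * npow (s - 4) y
     + (s - 4) * of_real (tr ?Q * (y \<bullet> b)\<^sup>2 + 4 * (?Q y \<bullet> b) * (y \<bullet> b) + ?Q y \<bullet> ?Q y) * npow (s - 6) y
     + (s - 4) * (s - 6) * of_real ((y \<bullet> b)\<^sup>2 * (?Q y \<bullet> ?Q y)) * npow (s - 8) y)" if "b \<in> ?B" for b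
  proof -
    have "dderiv (\<lambda>w. coaxial_deriv M v (\<lambda>z. Nfun s (z - w))) b w = dderiv G b w" if "w \<in> - {v}" for w
      by (rule dderiv_cong_open[of "- {v}"]) (use that inner in auto)
    then have "dderiv (dderiv (\<lambda>w. coaxial_deriv M v (\<lambda>z. Nfun s (z - w))) b) b u = dderiv (dderiv G b) b u"
      by (rule dderiv_cong_open[of "- {v}", rotated 2]) (use assms in auto)
    then show ?thesis unfolding y_def G_def
      using double_derivative_outer[OF assms _ linear_onproj[of ?C] onproj_inner_sym onproj_idem[OF C], of b s "tr ?Q"] that B
      by (simp add: nproj_def orthonormal_def)
  qed
  have s1: "(\<Sum>b\<in>?B. (y \<bullet> b)\<^sup>2) = ?P y \<bullet> ?P y"
    using norm_onproj[OF B, of y] by (simp add: nproj_def power2_norm_eq_inner)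
  have s2: "(\<Sum>b\<in>?B. (?Q y \<bullet> b) * (y \<bullet> b)) = ?P y \<bullet> ?Q y"
    by (simp add: nproj_def onproj_inner mult.commute)
  have s3: "(\<Sum>b\<in>?B. ?Q b \<bullet> b) = tr2 ?P ?Q"
    unfolding nproj_def by (rule tr2_onproj[OF linear_onproj, symmetric])
  have s4: "(\<Sum>b\<in>?B. 1) = tr ?P" unfolding nproj_def by (rule tr_onproj[OF B, symmetric])
  have a: "(\<Sum>b\<in>?B. tr ?Q + 2 * (?Q b \<bullet> b)) = tr ?P * tr ?Q + 2 * tr2 ?P ?Q"
    unfolding sum.distrib sum_distrib_left[symmetric] s3 s4[symmetric] by simp
  have b: "(\<Sum>b\<in>?B. tr ?Q * (y \<bullet> b)\<^sup>2 + 4 * (?Q y \<bullet> b) * (y \<bullet> b) + ?Q y \<bullet> ?Q y) =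
      tr ?Q * (?P y \<bullet> ?P y) + 4 * (?P y \<bullet> ?Q y) + tr ?P * (?Q y \<bullet> ?Q y)"
    unfolding sum.distrib mult.assoc sum_distrib_left[symmetric] s1 s2 s4[symmetric] by simp
  have c: "(\<Sum>b\<in>?B. (y \<bullet> b)\<^sup>2 * (?Q y \<bullet> ?Q y)) = (?P y \<bullet> ?P y) * (?Q y \<bullet> ?Q y)"
    unfolding sum_distrib_right[symmetric] s1 ..
  have y: "y \<noteq> 0" using assms by (simp add: y_def)
  have "coaxial_deriv M u (\<lambda>w. coaxial_deriv M v (\<lambda>z. Nfun s (z - w))) = (\<Sum>b\<in>?B. s * (s - 2) *
    (of_real (tr ?Q + 2 * (?Q b \<bullet> b)) * npow (s - 4) y
     + (s - 4) * of_real (tr ?Q * (y \<bullet> b)\<^sup>2 + 4 * (?Q y \<bullet> b) * (y \<bullet> b) + ?Q y \<bullet> ?Q y) * npow (s - 6) y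
     + (s - 4) * (s - 6) * of_real ((y \<bullet> b)\<^sup>2 * (?Q y \<bullet> ?Q y)) * npow (s - 8) y))"
    unfolding coaxial_deriv_eq[of M u] using outer by (intro sum.cong refl) auto
  also have "\<dots> = kern s ?P ?Q y"
    unfolding kern_npow[OF y] a[symmetric] b[symmetric] c[symmetric] of_real_sum
    by (simp only: sum.distrib[symmetric] sum_distrib_left sum_distrib_right)
  finally show ?thesis by (simp add: y_def)
qed

section \<open>Normal projections in a chart\<close>

lemma local_param_image_subset: "local_param M V \<phi> \<Longrightarrow> x \<in> V \<Longrightarrow> \<phi> x \<in> M"
  using local_paramD(6)[of M V \<phi>] by blast

text \<open>The inclusion that needs an argument concerns a curve in \<open>M\<close>, merely
  differentiable at 0. Its coordinates \<open>g\<close> are continuous there since the inverse chart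
  is, hence differentiable by \<open>has_derivative_left_inverse\<close>, and the chain rule
  expresses the velocity through the derivative of the chart.\<close>

lemma tangent_space_chart:
  fixes \<phi> :: "'n::euclidean_space \<Rightarrow> 'a::euclidean_space"
  assumes \<phi>: "local_param M V \<phi>" and x: "x \<in> V"
  shows "tangent_space M (\<phi> x) = range (\<lambda>h. dderiv \<phi> h x)"
proof
  show "range (\<lambda>h. dderiv \<phi> h x) \<subseteq> tangent_space M (\<phi> x)"
  proof
    fix t assume "t \<in> range (\<lambda>h. dderiv \<phi> h x)"
    then obtain h where h: "t = dderiv \<phi> h x" by blast
    have d: "((\<lambda>t. \<phi> (x + t *\<^sub>R h)) has_vector_derivative t) (at 0)"
      unfolding h by (rule smooth_on_has_vector_derivative[OF local_paramD(2)[OF \<phi>] x])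
    have "open ((\<lambda>t::real. x + t *\<^sub>R h) -` V)"
      by (intro open_vimage local_paramD(1)[OF \<phi>] continuous_intros)
    moreover have "0 \<in> (\<lambda>t::real. x + t *\<^sub>R h) -` V" using x by simp
    ultimately obtain e where e: "e > 0" "ball 0 e \<subseteq> (\<lambda>t::real. x + t *\<^sub>R h) -` V" by (rule openE)
    have "\<forall>t. \<bar>t\<bar> < e \<longrightarrow> \<phi> (x + t *\<^sub>R h) \<in> M"
      using e(2) local_param_image_subset[OF \<phi>] by (auto simp: subset_iff)
    moreover have "t = vector_derivative (\<lambda>t. \<phi> (x + t *\<^sub>R h)) (at 0)" using d by (simp add: vector_derivative_at)
    moreover have "(\<lambda>t. \<phi> (x + t *\<^sub>R h)) differentiable (at 0)" using d by (auto simp: has_vector_derivative_def differentiable_def)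
    ultimately show "t \<in> tangent_space M (\<phi> x)" unfolding tangent_space_def using e(1)
      by (intro CollectI exI[of _ "\<lambda>t. \<phi> (x + t *\<^sub>R h)"]) auto
  qed
  show "tangent_space M (\<phi> x) \<subseteq> range (\<lambda>h. dderiv \<phi> h x)"
  proof
    fix t assume "t \<in> tangent_space M (\<phi> x)"
    then obtain \<gamma> :: "real \<Rightarrow> 'a" and e where t: "t = vector_derivative \<gamma> (at 0)" and \<gamma>0: "\<gamma> 0 = \<phi> x"
      and d: "\<gamma> differentiable (at 0)" and e: "e > 0" "\<And>t. \<bar>t\<bar> < e \<Longrightarrow> \<gamma> t \<in> M"
      unfolding tangent_space_def by blast
    have \<gamma>': "(\<gamma> has_derivative (\<lambda>s. s *\<^sub>R t)) (at 0)"
      using d unfolding t by (simp add: vector_derivative_works has_vector_derivative_def)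
    obtain U where U: "open U" "\<phi> ` V = M \<inter> U" using local_paramD(6)[OF \<phi>] by blast
    have c0: "isCont \<gamma> 0" using \<gamma>' by (rule has_derivative_continuous)
    have "\<gamma> 0 \<in> U" using \<gamma>0 U x by blast
    then obtain \<epsilon> where \<epsilon>: "\<epsilon> > 0" "ball (\<gamma> 0) \<epsilon> \<subseteq> U" using U(1) by (meson openE)
    obtain d where d: "d > 0" "\<And>t. dist t 0 < d \<Longrightarrow> dist (\<gamma> t) (\<gamma> 0) < \<epsilon>"
      using c0 \<epsilon>(1) unfolding continuous_at_eps_delta by blast
    have d: "d > 0" "\<And>t. \<bar>t\<bar> < d \<Longrightarrow> \<gamma> t \<in> U"
      using d \<epsilon>(2) by (auto simp: subset_iff dist_commute)
    define S where "S = {- min d e<..<min d e}"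
    have S: "open S" "0 \<in> S" using d e by (auto simp: S_def)
    have im: "\<gamma> s \<in> \<phi> ` V" if "s \<in> S" for s using that d(2)[of s] e(2)[of s] U(2) by (auto simp: S_def abs_less_iff)
    define g where "g s = inv_into V \<phi> (\<gamma> s)" for s
    have g0: "g 0 = x" using \<gamma>0 x local_paramD(3)[OF \<phi>] by (simp add: g_def)
    have \<phi>g: "\<phi> (g s) = \<gamma> s" if "s \<in> S" for s using im[OF that] by (simp add: g_def f_inv_into_f)
    have "continuous (at (\<gamma> 0) within \<gamma> ` S) (inv_into V \<phi>)"
    proof -
      have "continuous_on (\<gamma> ` S) (inv_into V \<phi>)" by (rule continuous_on_subset[OF local_paramD(4)[OF \<phi>]]) (use im in blast)
      then show ?thesis using S(2) by (simp add: continuous_on_eq_continuous_within)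
    qed
    from continuous_within_compose[OF continuous_at_imp_continuous_within[OF c0] this]
    have cg: "continuous (at 0 within S) g" unfolding g_def[abs_def] by (simp add: o_def)
    obtain L where L: "bounded_linear L" "\<And>h. L (dderiv \<phi> h (g 0)) = h" using local_param_left_inverse[OF \<phi>, of "g 0"] x g0 by auto
    have d\<phi>: "(\<phi> has_derivative (\<lambda>h. dderiv \<phi> h (g 0))) (at (g 0))" using local_paramD(7)[OF \<phi>] x g0 by simp
    have "((\<lambda>s. \<phi> (g s)) has_derivative (\<lambda>s. s *\<^sub>R t)) (at 0 within S)"
    proof (rule has_derivative_transform[where f=\<gamma>])
      show "(\<gamma> has_derivative (\<lambda>s. s *\<^sub>R t)) (at 0 within S)" using \<gamma>' by (rule has_derivative_at_withinI)
    qed (use S \<phi>g in auto)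
    from has_derivative_left_inverse[where f=\<phi> and g=g and x=0 and S=S, OF d\<phi> L cg this]
    have dg: "(g has_derivative (\<lambda>s. L (s *\<^sub>R t))) (at 0)" unfolding at_within_open[OF S(2,1)] .
    from has_derivative_compose[where f=g and g=\<phi> and x=0, OF dg d\<phi>]
    have "((\<lambda>s. \<phi> (g s)) has_derivative (\<lambda>s. dderiv \<phi> (L (s *\<^sub>R t)) (g 0))) (at 0)" .
    then have "(\<gamma> has_derivative (\<lambda>s. dderiv \<phi> (L (s *\<^sub>R t)) (g 0))) (at 0)"
    proof (rule has_derivative_transform_within_open)
      show "open S" "0 \<in> S" "\<And>s. s \<in> S \<Longrightarrow> \<phi> (g s) = \<gamma> s" by (use S \<phi>g in auto)
    qed
    from has_derivative_unique[OF \<gamma>' this] have "1 *\<^sub>R t = dderiv \<phi> (L (1 *\<^sub>R t)) (g 0)" by metis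
    then show "t \<in> range (\<lambda>h. dderiv \<phi> h x)" using g0 by auto
  qed
qed

lemma onproj_span:
  assumes "orthonormal B" "y \<in> span B"
  shows "onproj B y = y"
proof -
  have "onproj B b = b" if b: "b \<in> B" for b
  proof -
    have "onproj B b = (\<Sum>c\<in>B. if c = b then b else 0)"
      unfolding onproj_def using orthonormal_inner[OF assms(1) b] by (intro sum.cong) auto
    then show ?thesis using assms(1) b by (simp add: orthonormal_def)
  qed
  from linear_eq_on_span[where g="\<lambda>x. x", OF linear_onproj linear_ident this assms(2)] show ?thesis by simp
qed

text \<open>Cramer's rule for the \<open>k\<close>-th coordinate of the tangential part of
  \<open>y\<close>: the Gram matrix is the matrix of the normal equations. A quotient of
  determinants is visibly smooth in \<open>x\<close>.\<close>

definition chart_coef :: "('n::euclidean_space \<Rightarrow> 'a::euclidean_space) \<Rightarrow> 'n \<Rightarrow> 'a \<Rightarrow> 'n bidx \<Rightarrow> real" where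
  "chart_coef \<phi> x y k =
     det (\<chi> i j. if j = k then y \<bullet> dderiv \<phi> (bvec i) x else dderiv \<phi> (bvec i) x \<bullet> dderiv \<phi> (bvec j) x)
       * inverse (gram_det \<phi> x)"

text \<open>The tangential part \<open>T\<close> is determined by orthogonality of
  \<open>y - T\<close> to all partial derivatives of the chart; the chosen normal basis drops out of
  the projection.\<close>

lemma nproj_chart:
  fixes \<phi> :: "'n::euclidean_space \<Rightarrow> 'a::euclidean_space"
  assumes \<phi>: "local_param M V \<phi>" and x: "x \<in> V"
  shows "nproj M (\<phi> x) y = y - (\<Sum>k\<in>UNIV. chart_coef \<phi> x y k *\<^sub>R dderiv \<phi> (bvec k) x)"
proof -
  define D where "D h = dderiv \<phi> h x" for h
  have linD: "linear D" unfolding D_def by (rule local_paramD(9)[OF \<phi> x])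
  let ?N = "normal_basis M (\<phi> x)"
  have gd: "gram_det \<phi> x = det (gram D)" unfolding gram_det_eq D_def[abs_def] ..
  have nz: "det (gram D) \<noteq> 0" using gram_det_pos[OF \<phi> x] gd by simp
  define a where "a = (\<chi> k. chart_coef \<phi> x y k)"
  have "a = (\<chi> k. det (\<chi> i j. if j = k then (\<chi> i. y \<bullet> D (bvec i)) $ i else gram D $ i $ j) / det (gram D))"
    by (simp add: a_def chart_coef_def gd gram_def D_def divide_inverse cong: if_cong)
  then have "gram D *v a = (\<chi> i. y \<bullet> D (bvec i))" using cramer[OF nz] by blast
  then have i: "D (bvec i) \<bullet> D (of_bidx a) = y \<bullet> D (bvec i)" for i
    unfolding gram_mult_vec[OF linD] by (simp add: vec_eq_iff)
  define T where "T = D (of_bidx a)"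
  have T: "T = (\<Sum>k\<in>UNIV. chart_coef \<phi> x y k *\<^sub>R D (bvec k))"
    by (simp add: T_def of_bidx_def a_def linear_sum[OF linD] linear_scale[OF linD])
  have orth: "(y - T) \<bullet> D h = 0" for h
  proof -
    have "(y - T) \<bullet> D (bvec i) = 0" for i using i[of i] by (simp add: T_def inner_diff_left inner_commute[of "D (of_bidx a)"])
    moreover have "D h = (\<Sum>k\<in>UNIV. (h \<bullet> bvec k) *\<^sub>R D (bvec k))"
      using local_paramD(8)[OF \<phi> x, of h] sum_bvec[of "\<lambda>b. (h \<bullet> b) *\<^sub>R D b"] by (simp add: D_def)
    ultimately show ?thesis by (simp add: inner_sum_right)
  qed
  have tan: "tangent_space M (\<phi> x) = range D" using tangent_space_chart[OF \<phi> x] by (simp add: D_def)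
  have "y - T \<in> normal_space M (\<phi> x)" unfolding normal_space_def tan using orth by auto
  then have 1: "nproj M (\<phi> x) (y - T) = y - T"
    unfolding nproj_def using onproj_span[OF normal_basis(1)] normal_basis(3) by metis
  have "T \<bullet> b = 0" if "b \<in> ?N" for b
    using normal_basis(2)[of M "\<phi> x"] that unfolding normal_space_def tan T_def by (auto simp: inner_commute)
  then have "nproj M (\<phi> x) T = 0" unfolding nproj_def onproj_def by simp
  with 1 have "nproj M (\<phi> x) y = y - T"
    using linear_add[OF linear_onproj, of ?N "y - T" T] by (simp add: nproj_def)
  then show ?thesis by (simp add: T D_def)
qed

text \<open>The type argument is the codomain of the test functions \<open>f\<close>, over which a formula cannot quantify.\<close>

definition smooth_points :: "'q::topological_space set \<Rightarrow> real set \<Rightarrow> 'n::euclidean_space set \<Rightarrow> ('q \<Rightarrow> real \<Rightarrow> 'n) \<Rightarrow> 'a::euclidean_space itself \<Rightarrow> bool" where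
  "smooth_points Q J V z _ \<longleftrightarrow> (\<forall>q\<in>Q. \<forall>r\<in>J. z q r \<in> V) \<and>
     (\<forall>f::'n \<Rightarrow> 'a. smooth_on V f \<longrightarrow> sm Q J (\<lambda>q r. f (z q r)))"

lemma smooth_points_line:
  fixes Q :: "('n::euclidean_space \<times> 'n) set"
  assumes V: "open V" and Q: "\<And>p r. p \<in> Q \<Longrightarrow> r \<in> J \<Longrightarrow> fst p + r *\<^sub>R snd p \<in> V"
  shows "smooth_points Q J V (\<lambda>p r. fst p + r *\<^sub>R snd p) TYPE('a::euclidean_space)"
proof -
  have "ck n Q J (\<lambda>p r. f (fst p + r *\<^sub>R snd p))" if "smooth_on V f" for n and f :: "'n \<Rightarrow> 'a"
    using that
  proof (induction n arbitrary: f)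
    case (0 f)
    have "continuous_on (Q \<times> J) (\<lambda>x. f (fst (fst x) + snd x *\<^sub>R snd (fst x)))"
      by (rule continuous_on_compose2[OF smooth_on_imp_continuous_on[OF 0]]) (auto intro!: continuous_intros Q)
    then show ?case by (simp add: split_def)
  next
    case (Suc n f)
    have c: "continuous_on (Q \<times> J) (\<lambda>(p, r). f (fst p + r *\<^sub>R snd p))"
    proof -
      have "continuous_on (Q \<times> J) (\<lambda>x. f (fst (fst x) + snd x *\<^sub>R snd (fst x)))"
        by (rule continuous_on_compose2[OF smooth_on_imp_continuous_on[OF Suc.prems]]) (auto intro!: continuous_intros Q)
      then show ?thesis by (simp add: split_def)
    qed
    show ?case
    proof (rule ck_SucI[OF _ _ c])
      fix p r assume "p \<in> Q" "r \<in> J"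
      from Q[OF this] show "((\<lambda>r. f (fst p + r *\<^sub>R snd p)) has_vector_derivative
          (\<Sum>b\<in>Basis. (snd p \<bullet> b) *\<^sub>R dderiv f b (fst p + r *\<^sub>R snd p))) (at r)"
        using smooth_on_has_vector_derivative'[OF Suc.prems, of "fst p" r "snd p"] dderiv_eq_sum[OF Suc.prems V, of _ "snd p"] by simp
    next
      show "ck n Q J (\<lambda>p r. \<Sum>b\<in>Basis. (snd p \<bullet> b) *\<^sub>R dderiv f b (fst p + r *\<^sub>R snd p))"
        by (intro ck_sum ck_scaleR ck_const Suc.IH smooth_on_dderiv Suc.prems) (intro continuous_intros)
    qed
  qed
  then show ?thesis using Q by (auto simp: smooth_points_def sm_def)
qed

lemma smooth_points_const:
  fixes g :: "'q::topological_space \<Rightarrow> 'b::euclidean_space"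
  assumes "continuous_on Q g" "\<And>q. q \<in> Q \<Longrightarrow> g q \<in> V"
  shows "smooth_points Q J V (\<lambda>q r. g q) TYPE('a::euclidean_space)"
  unfolding smooth_points_def sm_def
proof (intro conjI ballI allI impI)
  fix f :: "'b \<Rightarrow> 'a" and n assume f: "smooth_on V f"
  have "continuous_on Q (\<lambda>q. f (g q))"
    by (rule continuous_on_compose2[OF smooth_on_imp_continuous_on[OF f] assms(1)]) (use assms(2) in auto)
  then show "ck n Q J (\<lambda>q r. f (g q))" by (rule ck_const)
qed (rule assms(2))

lemma smooth_points_dderiv:
  fixes \<phi> :: "'n::euclidean_space \<Rightarrow> 'a::euclidean_space"
  assumes "local_param M V \<phi>" "smooth_points Q J V z TYPE('a)"
  shows "ck n Q J (\<lambda>q r. dderiv \<phi> v (z q r))"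
  using assms(2) smooth_on_dderiv[OF local_paramD(2)[OF assms(1)]] by (auto simp: smooth_points_def sm_def)

lemma ck_gram_det:
  fixes \<phi> :: "'n::euclidean_space \<Rightarrow> 'a::euclidean_space"
  assumes "local_param M V \<phi>" "smooth_points Q J V z TYPE('a)"
  shows "ck n Q J (\<lambda>q r. gram_det \<phi> (z q r))"
  unfolding gram_det_def
  by (intro ck_sum ck_mult ck_const continuous_on_const ck_prod ck_inner smooth_points_dderiv[OF assms])

lemma ck_area_density:
  fixes \<phi> :: "'n::euclidean_space \<Rightarrow> 'a::euclidean_space"
  assumes J: "open J" and \<phi>: "local_param M V \<phi>" and z: "smooth_points Q J V z TYPE('a)"
  shows "ck n Q J (\<lambda>q r. area_density \<phi> (z q r))"
proof (rule ck_cong[OF J])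
  have pos: "gram_det \<phi> (z q r) > 0" if "q \<in> Q" "r \<in> J" for q r
    using z that gram_det_pos[OF \<phi>] by (auto simp: smooth_points_def)
  \<comment> \<open>The root of a positive function is the exponential of half its logarithm, so
    \<open>ck_exp\<close> and \<open>ck_ln\<close> suffice.\<close>
  show "ck n Q J (\<lambda>q r. exp ((1/2) * ln (gram_det \<phi> (z q r))))"
    by (intro ck_exp ck_mult ck_const continuous_on_const ck_ln ck_gram_det[OF \<phi> z] pos)
  show "exp ((1/2) * ln (gram_det \<phi> (z q r))) = area_density \<phi> (z q r)" if "q \<in> Q" "r \<in> J" for q r
    using pos[OF that] by (simp add: ln_sqrt[symmetric])
qed

lemma ck_nproj:
  fixes \<phi> :: "'n::euclidean_space \<Rightarrow> 'a::euclidean_space"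
  assumes J: "open J" and \<phi>: "local_param M V \<phi>" and z: "smooth_points Q J V z TYPE('a)" and g: "ck n Q J g"
  shows "ck n Q J (\<lambda>q r. nproj M (\<phi> (z q r)) (g q r))"
proof (rule ck_cong[OF J])
  have zV: "z q r \<in> V" if "q \<in> Q" "r \<in> J" for q r using z that by (auto simp: smooth_points_def)
  have nz: "gram_det \<phi> (z q r) \<noteq> 0" if "q \<in> Q" "r \<in> J" for q r
    using gram_det_pos[OF \<phi> zV[OF that]] by simp
  have det: "ck n Q J (\<lambda>q r. det (\<chi> i j. if j = k then g q r \<bullet> dderiv \<phi> (bvec i) (z q r)
       else dderiv \<phi> (bvec i) (z q r) \<bullet> dderiv \<phi> (bvec j) (z q r)))" for k
    unfolding det_def
  proof (intro ck_sum ck_mult ck_const continuous_on_const ck_prod)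
    fix p i
    show "ck n Q J (\<lambda>q r. (\<chi> i j. if j = k then g q r \<bullet> dderiv \<phi> (bvec i) (z q r)
       else dderiv \<phi> (bvec i) (z q r) \<bullet> dderiv \<phi> (bvec j) (z q r)) $ i $ p i)"
      by (cases "p i = k") (simp_all add: ck_inner g smooth_points_dderiv[OF \<phi> z])
  qed
  show "ck n Q J (\<lambda>q r. g q r - (\<Sum>k\<in>UNIV. chart_coef \<phi> (z q r) (g q r) k *\<^sub>R dderiv \<phi> (bvec k) (z q r)))"
    unfolding chart_coef_def
    by (intro ck_diff g ck_sum ck_scaleR ck_mult det ck_inverse nz ck_gram_det[OF \<phi> z] smooth_points_dderiv[OF \<phi> z])
  show "g q r - (\<Sum>k\<in>UNIV. chart_coef \<phi> (z q r) (g q r) k *\<^sub>R dderiv \<phi> (bvec k) (z q r)) = nproj M (\<phi> (z q r)) (g q r)"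
    if "q \<in> Q" "r \<in> J" for q r using nproj_chart[OF \<phi> zV[OF that]] by simp
qed

lemma continuous_on_nproj:
  fixes M :: "'a::euclidean_space set"
  assumes M: "smooth_submanifold TYPE('n::euclidean_space) M"
  shows "continuous_on M (\<lambda>u. nproj M u y)"
  unfolding continuous_on_eq_continuous_within
proof
  fix u assume u: "u \<in> M"
  obtain V and \<phi> :: "'n \<Rightarrow> 'a" where \<phi>: "local_param M V \<phi>" "u \<in> \<phi> ` V" using M u unfolding smooth_submanifold_def by blast
  obtain U where U: "open U" "\<phi> ` V = M \<inter> U" using local_paramD(6)[OF \<phi>(1)] by blast
  \<comment> \<open>The real variable is a dummy here: order 0 amounts to continuity in the
    parameter alone.\<close>
  have "smooth_points V {-1<..<1} V (\<lambda>q r. q) TYPE('a)" by (rule smooth_points_const) (auto intro: continuous_on_id)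
  from ck_continuous[OF ck_nproj[OF _ \<phi>(1) this, of 0 "\<lambda>q r. y"]]
  have c: "continuous_on (V \<times> {-1<..<1}) (\<lambda>(q,r::real). nproj M (\<phi> q) y)" by auto
  have "continuous_on V (\<lambda>q. nproj M (\<phi> q) y)"
    using continuous_on_compose2[OF c, of V "\<lambda>q. (q, 0)"] by (simp add: continuous_on_Pair image_subset_iff)
  from continuous_on_compose2[OF this local_paramD(4)[OF \<phi>(1)]]
  have "continuous_on (\<phi> ` V) (\<lambda>u. nproj M (\<phi> (inv_into V \<phi> u)) y)" by (simp add: image_subset_iff inv_into_into)
  then have "continuous_on (\<phi> ` V) (\<lambda>u. nproj M u y)"
    by (rule continuous_on_eq) (auto simp: f_inv_into_f)
  then have "continuous (at u within M \<inter> U) (\<lambda>u. nproj M u y)" using \<phi>(2) U by (simp add: continuous_on_eq_continuous_within)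
  moreover have "u \<in> U" using \<phi>(2) U by blast
  ultimately show "continuous (at u within M) (\<lambda>u. nproj M u y)"
    using at_within_nhd[OF _ U(1), of u "M \<inter> U" M] by (simp add: Int_assoc)
qed

section \<open>Blowing up the diagonal in a chart\<close>

definition annulus :: "'n::euclidean_space set" where
  "annulus = {k. 1 \<le> norm k \<and> norm k \<le> 2}"

lemma compact_annulus: "compact annulus"
proof -
  have "annulus = cball 0 2 - ball (0::'a) 1" by (auto simp: annulus_def)
  then show ?thesis by (metis compact_cball compact_diff open_ball)
qed

lemma annulus_borel [measurable]: "annulus \<in> sets borel"
  using compact_annulus by (auto intro: borel_closed compact_imp_closed)

text \<open>The vector \<open>Y\<close> of the overview, with \<open>p = (x, k)\<close>: a
  difference quotient of the chart along \<open>k\<close>, completed at \<open>r = 0\<close> by its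
  limit.\<close>

definition blow :: "('n::euclidean_space \<Rightarrow> 'a::euclidean_space) \<Rightarrow> 'n \<times> 'n \<Rightarrow> real \<Rightarrow> 'a" where
  "blow \<phi> p r = (if r = 0 then dderiv \<phi> (snd p) (fst p) else (\<phi> (fst p + r *\<^sub>R snd p) - \<phi> (fst p)) /\<^sub>R r)"

text \<open>The two area densities are included. What remains of the blown-up integrand is then a
  power of \<open>r\<close>, the factors \<open>kpoly\<close> and the exponential of
  \<open>s * blow_dist\<close>.\<close>

definition blow_coef :: "'a::euclidean_space set \<Rightarrow> ('n::euclidean_space \<Rightarrow> 'a) \<Rightarrow> nat \<Rightarrow> 'n \<times> 'n \<Rightarrow> real \<Rightarrow> real" where
  "blow_coef M \<phi> i p r =
     kcoef i (nproj M (\<phi> (fst p))) (nproj M (\<phi> (fst p + r *\<^sub>R snd p))) (blow \<phi> p r)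
       * (area_density \<phi> (fst p) * area_density \<phi> (fst p + r *\<^sub>R snd p))"

definition blow_dist :: "('n::euclidean_space \<Rightarrow> 'a::euclidean_space) \<Rightarrow> 'n \<times> 'n \<Rightarrow> real \<Rightarrow> real" where
  "blow_dist \<phi> p r = ln (blow \<phi> p r \<bullet> blow \<phi> p r) / 2"

locale chart_ball =
  fixes M :: "'a::euclidean_space set" and V :: "'n::euclidean_space set" and \<phi> :: "'n \<Rightarrow> 'a" and c :: 'n and \<epsilon> :: real
  assumes param: "local_param M V \<phi>" and eps: "0 < \<epsilon>" and cball_V: "cball c (2 * \<epsilon>) \<subseteq> V"
begin

text \<open>Vectors in \<open>annulus\<close> have norm at most 2, so half-width
  \<open>\<epsilon> / 2\<close> keeps \<open>x + r k\<close> within \<open>\<epsilon>\<close> of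
  \<open>x\<close> and inside the doubled ball.\<close>

abbreviation "J \<equiv> {- (\<epsilon> / 2)<..<\<epsilon> / 2}"
abbreviation "P0 \<equiv> cball c \<epsilon> \<times> (annulus :: 'n set)"

lemma compact_P0: "compact P0"
  by (intro compact_Times compact_cball compact_annulus)

lemma in_V:
  assumes "p \<in> P0" "r \<in> J"
  shows "fst p + r *\<^sub>R snd p \<in> V" "fst p \<in> V" "fst p + r *\<^sub>R snd p \<in> ball c (2 * \<epsilon>)"
proof -
  have "norm (r *\<^sub>R snd p) \<le> \<bar>r\<bar> * 2" using assms(1) by (auto simp: annulus_def intro!: mult_left_mono)
  also have "\<dots> < \<epsilon>" using assms(2) by auto
  finally have r: "norm (r *\<^sub>R snd p) < \<epsilon>" .
  have x: "norm (c - fst p) \<le> \<epsilon>" using assms(1) by (auto simp: dist_norm)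
  have "norm (c - (fst p + r *\<^sub>R snd p)) \<le> norm (c - fst p) + norm (r *\<^sub>R snd p)"
    using norm_triangle_ineq4[of "c - fst p" "r *\<^sub>R snd p"] by (simp add: algebra_simps)
  with r x show "fst p + r *\<^sub>R snd p \<in> ball c (2 * \<epsilon>)" by (simp add: dist_norm)
  then show "fst p + r *\<^sub>R snd p \<in> V" using cball_V by (auto simp: subset_iff)
  show "fst p \<in> V" using x eps cball_V by (auto simp: subset_iff dist_norm)
qed

lemma points_line: "smooth_points P0 J V (\<lambda>p r. fst p + r *\<^sub>R snd p) TYPE('a)"
  by (rule smooth_points_line[OF local_paramD(1)[OF param]]) (rule in_V(1))

lemma points_base: "smooth_points P0 J V (\<lambda>p r. fst p) TYPE('a)"
  by (rule smooth_points_const) (use in_V(2)[of _ 0] eps in \<open>auto intro!: continuous_intros\<close>)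

lemma ck_blow: "ck n P0 J (blow \<phi>)"
  unfolding blow_def[abs_def]
proof -
  have c: "ck n P0 J (\<lambda>p r. dderiv \<phi> (snd p) (fst p + r *\<^sub>R snd p))"
  proof (rule ck_cong)
    show "ck n P0 J (\<lambda>p r. \<Sum>b\<in>Basis. (snd p \<bullet> b) *\<^sub>R dderiv \<phi> b (fst p + r *\<^sub>R snd p))"
      by (intro ck_sum ck_scaleR ck_const smooth_points_dderiv[OF param points_line]) (intro continuous_intros)
    show "(\<Sum>b\<in>Basis. (snd p \<bullet> b) *\<^sub>R dderiv \<phi> b (fst p + r *\<^sub>R snd p)) = dderiv \<phi> (snd p) (fst p + r *\<^sub>R snd p)"
      if "p \<in> P0" "r \<in> J" for p r
      by (rule local_paramD(8)[OF param in_V(1)[OF that], symmetric])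
  qed simp
  have "ck n P0 J (\<lambda>p r. if r = 0 then (\<lambda>p r. dderiv \<phi> (snd p) (fst p + r *\<^sub>R snd p)) p 0
      else (\<lambda>p r. \<phi> (fst p + r *\<^sub>R snd p) - \<phi> (fst p)) p r /\<^sub>R r)"
  proof (rule ck_hadamard[OF refl _ _ c])
    show "0 < \<epsilon> / 2" using eps by simp
    show "((\<lambda>r. \<phi> (fst p + r *\<^sub>R snd p) - \<phi> (fst p)) has_vector_derivative dderiv \<phi> (snd p) (fst p + r *\<^sub>R snd p)) (at r)"
      if "p \<in> P0" "r \<in> J" for p r
      using smooth_on_has_vector_derivative'[OF local_paramD(2)[OF param] in_V(1)[OF that]]
      by (auto intro!: derivative_eq_intros)
  qed simp
  then show "ck n P0 J (\<lambda>p r. if r = 0 then dderiv \<phi> (snd p) (fst p) else (\<phi> (fst p + r *\<^sub>R snd p) - \<phi> (fst p)) /\<^sub>R r)"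
    by (simp cong: if_cong)
qed

text \<open>Two clauses on charts enter: the derivative is injective, which settles
  \<open>r = 0\<close>, and the chart itself is injective, which settles
  \<open>r \<noteq> 0\<close>. Hence the logarithm in \<open>blow_dist\<close> is smooth.\<close>

lemma blow_nonzero:
  assumes "p \<in> P0" "r \<in> J"
  shows "blow \<phi> p r \<noteq> 0"
proof
  have k: "snd p \<noteq> 0" using assms(1) by (auto simp: annulus_def)
  assume z: "blow \<phi> p r = 0"
  show False
  proof (cases "r = 0")
    case True
    with z have "dderiv \<phi> (snd p) (fst p) = 0" by (simp add: blow_def)
    with local_param_inj_deriv[OF param in_V(2)[OF assms]] local_paramD(9)[OF param in_V(2)[OF assms]] k
    show False using linear_injective_0 by blast
  next
    case False
    with z have "\<phi> (fst p + r *\<^sub>R snd p) = \<phi> (fst p)" by (simp add: blow_def)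
    with inj_onD[OF local_paramD(3)[OF param] _ in_V(1,2)[OF assms]] False k show False by auto
  qed
qed

lemma blow_eq: "r *\<^sub>R blow \<phi> p r = \<phi> (fst p + r *\<^sub>R snd p) - \<phi> (fst p)"
  by (simp add: blow_def)

lemma sm_blow_dist: "sm P0 J (blow_dist \<phi>)"
  unfolding sm_def blow_dist_def[abs_def]
proof
  fix n
  have "ck n P0 J (\<lambda>p r. ln (blow \<phi> p r \<bullet> blow \<phi> p r) * (1/2))"
    by (intro ck_mult ck_ln ck_inner ck_blow ck_const continuous_on_const) (use blow_nonzero in simp)
  then show "ck n P0 J (\<lambda>p r. ln (blow \<phi> p r \<bullet> blow \<phi> p r) / 2)" by simp
qed

lemma sm_blow_coef: "sm P0 J (blow_coef M \<phi> i)"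
  unfolding sm_def blow_coef_def[abs_def]
proof
  fix n
  have P: "ck n P0 J (\<lambda>p r. nproj M (\<phi> (fst p)) (g p r))" if "ck n P0 J g" for g
    by (rule ck_nproj[OF _ param points_base that]) simp
  have Q: "ck n P0 J (\<lambda>p r. nproj M (\<phi> (fst p + r *\<^sub>R snd p)) (g p r))" if "ck n P0 J g" for g
    by (rule ck_nproj[OF _ param points_line that]) simp
  have const: "ck n P0 J (\<lambda>p r. b)" for b :: 'a by (rule ck_const) (rule continuous_on_const)
  have power: "ck n P0 J (\<lambda>p r. g p r ^ k)" if "ck n P0 J g" for g :: "'n \<times> 'n \<Rightarrow> real \<Rightarrow> real" and k
    by (induction k) (auto intro!: ck_mult that ck_const continuous_on_const)
  have inv: "ck n P0 J (\<lambda>p r. inverse (blow \<phi> p r \<bullet> blow \<phi> p r))"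
    by (intro ck_inverse ck_inner ck_blow) (use blow_nonzero in simp)
  have num: "ck n P0 J (\<lambda>p r. x)" for x :: real by (rule ck_const) (rule continuous_on_const)
  have kc: "ck n P0 J (\<lambda>p r. kcoef i (nproj M (\<phi> (fst p))) (nproj M (\<phi> (fst p + r *\<^sub>R snd p))) (blow \<phi> p r))"
    unfolding kcoef_def tr_def tr2_def
    by (cases "i = 0"; cases "i = 1") (simp_all, (intro ck_mult ck_add ck_sum ck_inner P Q const power inv num ck_blow)+)
  show "ck n P0 J (\<lambda>p r. kcoef i (nproj M (\<phi> (fst p))) (nproj M (\<phi> (fst p + r *\<^sub>R snd p))) (blow \<phi> p r)
       * (area_density \<phi> (fst p) * area_density \<phi> (fst p + r *\<^sub>R snd p)))"
    by (intro ck_mult kc ck_area_density[OF _ param points_base] ck_area_density[OF _ param points_line]) auto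
qed

text \<open>The end point \<open>x + r k\<close> is unchanged when \<open>r\<close> and
  \<open>k\<close> both change sign, so only the divisor does; at \<open>r = 0\<close> the reason is
  linearity of the derivative.\<close>

lemma blow_reflect:
  assumes "p \<in> P0" "r \<in> J"
  shows "blow \<phi> (fst p, - snd p) (- r) = - blow \<phi> p r"
  using linear_neg[OF local_paramD(9)[OF param in_V(2)[OF assms]]] by (simp add: blow_def)

lemma blow_coef_reflect:
  assumes "p \<in> P0" "r \<in> J"
  shows "blow_coef M \<phi> i (fst p, - snd p) (- r) = blow_coef M \<phi> i p r"
  unfolding blow_coef_def blow_reflect[OF assms] by (simp add: kcoef_minus linear_onproj nproj_def)

lemma blow_dist_reflect:
  assumes "p \<in> P0" "r \<in> J"
  shows "blow_dist \<phi> (fst p, - snd p) (- r) = blow_dist \<phi> p r"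
  unfolding blow_dist_def blow_reflect[OF assms] by simp

lemma kern_blow:
  assumes "p \<in> P0" "r \<in> J" "r > 0"
  shows "kern s (nproj M (\<phi> (fst p))) (nproj M (\<phi> (fst p + r *\<^sub>R snd p))) (\<phi> (fst p + r *\<^sub>R snd p) - \<phi> (fst p))
      * of_real (area_density \<phi> (fst p) * area_density \<phi> (fst p + r *\<^sub>R snd p))
    = of_real r powr (s - 4) * ((\<Sum>i<3. kpoly i s * of_real (blow_coef M \<phi> i p r)) * exp (s * of_real (blow_dist \<phi> p r)))"
  unfolding blow_eq[symmetric] nproj_def kern_scale[OF linear_onproj linear_onproj assms(3)]
  using blow_nonzero[OF assms(1,2)]
  by (simp add: kern_def blow_coef_def nproj_def blow_dist_def sum_distrib_right sum_distrib_left mult_ac)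

text \<open>The shift is \<open>DIM('n)\<close> from the volume of the dilated annulus and -4 from
  the degree of the kernel; the \<open>1 / r\<close> of the radial average is the -1 built into
  \<open>mellin\<close>. The cut-off \<open>\<epsilon> / 4\<close> lies strictly inside
  \<open>J\<close>, as integration by parts requires.\<close>

definition diag_term :: "'n set \<Rightarrow> complex \<Rightarrow> complex" where
  "diag_term C s = mellin (\<epsilon> / 4) (s + of_real (real DIM('n) - 4))
     (\<lambda>r. \<integral>p. indicator (C \<times> annulus) p *\<^sub>R ((\<Sum>i<3. kpoly i s * of_real (blow_coef M \<phi> i p r)) * exp (s * of_real (blow_dist \<phi> p r))) \<partial>lborel)"

lemma distr_reflect: "distr lborel borel (\<lambda>p :: 'n \<times> 'n. (fst p, - snd p)) = lborel"
proof -
  have neg: "distr lborel borel uminus = (lborel :: 'n measure)"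
    using lborel_affine[of "-1" "0::'n"] by (simp add: density_1 one_ennreal_def[symmetric])
  have "distr lborel borel (\<lambda>p :: 'n \<times> 'n. (fst p, - snd p)) = distr (lborel \<Otimes>\<^sub>M lborel) (borel \<Otimes>\<^sub>M borel) (\<lambda>(x, y). (id x, - y))"
    unfolding lborel_prod borel_prod case_prod_unfold by simp
  also have "\<dots> = distr lborel borel id \<Otimes>\<^sub>M distr lborel borel uminus"
    by (rule pair_measure_distr[symmetric]) (auto simp: neg intro: lborel.sigma_finite_measure_axioms)
  also have "distr lborel borel id = (lborel :: 'n measure)" by (simp add: id_def distr_id2)
  also have "lborel \<Otimes>\<^sub>M distr lborel borel uminus = (lborel :: ('n \<times> 'n) measure)" by (simp add: neg lborel_prod)
  finally show ?thesis .
qed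

lemma diag_term_continuation:
  assumes e1: "\<epsilon> \<le> 1" and C: "C \<in> sets borel" "C \<subseteq> cball c \<epsilon>"
  shows "\<exists>f. simple_poles_in {- of_real (real DIM('n) - 4) - 2 * of_nat j | j. True} f \<and>
    (\<forall>s. Re s > 4 - real DIM('n) \<longrightarrow> f s = diag_term C s)"
proof -
  have "\<exists>f. simple_poles_in {- of_real (real DIM('n) - 4) - 2 * of_nat j | j. True} f \<and>
    (\<forall>s. Re s > - (real DIM('n) - 4) \<longrightarrow> f s = mellin (\<epsilon> / 4) (s + of_real (real DIM('n) - 4))
      (\<lambda>r. \<integral>p. indicator (C \<times> (annulus :: 'n set)) p *\<^sub>R ((\<Sum>i\<in>{..<3}. kpoly i s * of_real (blow_coef M \<phi> i p r)) * exp (s * of_real (blow_dist \<phi> p r))) \<partial>lborel))"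
  proof (rule blowup_continuation[where e="\<epsilon> / 2" and J=J and ?P0.0=P0 and P="C \<times> (annulus :: 'n set)" and M=lborel and I="{..<3}"
      and q=kpoly and c="blow_coef M \<phi>" and l="blow_dist \<phi>" and R="\<epsilon> / 4" and a="real DIM('n) - 4" and \<sigma>="\<lambda>p :: 'n \<times> 'n. (fst p, - snd p)"])
    show "emeasure lborel P0 < \<infinity>" using emeasure_bounded_finite[OF compact_imp_bounded[OF compact_P0]] .
    show "C \<times> (annulus :: 'n set) \<in> sets borel" using C(1) annulus_borel by (auto simp: borel_prod[symmetric])
    show "distr lborel borel (\<lambda>p :: 'n \<times> 'n. (fst p, - snd p)) = lborel" by (rule distr_reflect)
    show "(\<lambda>p :: 'n \<times> 'n. (fst p, - snd p)) \<in> borel \<rightarrow>\<^sub>M borel"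
      by (intro borel_measurable_continuous_onI continuous_intros)
    fix p :: "'n \<times> 'n" and r assume "p \<in> C \<times> (annulus :: 'n set)" and r: "r \<in> J"
    then have p: "p \<in> P0" using C(2) by auto
    show "blow_coef M \<phi> i (fst p, - snd p) (- r) = blow_coef M \<phi> i p r" for i by (rule blow_coef_reflect[OF p r])
    show "blow_dist \<phi> (fst p, - snd p) (- r) = blow_dist \<phi> p r" by (rule blow_dist_reflect[OF p r])
  next
    show "C \<times> (annulus :: 'n set) \<subseteq> P0" using C(2) by auto
    show "(fst p, - snd p) \<in> C \<times> (annulus :: 'n set) \<longleftrightarrow> p \<in> C \<times> (annulus :: 'n set)" for p :: "'n \<times> 'n"
      by (auto simp: annulus_def mem_Times_iff)
  qed (use eps e1 compact_P0 sm_blow_coef sm_blow_dist kpoly_holomorphic in auto)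
  then show ?thesis unfolding diag_term_def by simp
qed

end

section \<open>Polar coordinates with annuli\<close>

text \<open>The annuli \<open>{h. \<rho> \<le> norm h \<le> 2 * \<rho>}\<close>, weighted by \<open>1 / (\<rho> * ln 2)\<close>, average to a weight that is
  constantly 1 near the origin: integrating over them replaces polar coordinates without spheres.\<close>

definition ring :: "real \<Rightarrow> real \<Rightarrow> real \<Rightarrow> real" where
  "ring R \<rho> t = (if 0 < \<rho> \<and> \<rho> \<le> R \<and> \<rho> \<le> t \<and> t \<le> 2 * \<rho> then 1 / (\<rho> * ln 2) else 0)"

lemma ring_measurable [measurable]: "(\<lambda>(\<rho>, t). ring R \<rho> t) \<in> borel_measurable (borel \<Otimes>\<^sub>M borel)"
  unfolding ring_def by measurable

lemma ring_nonneg [simp]: "0 \<le> ring R \<rho> t"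
  by (simp add: ring_def)

definition wt :: "real \<Rightarrow> real \<Rightarrow> ennreal" where
  "wt R t = (\<integral>\<^sup>+\<rho>. ennreal (ring R \<rho> t) \<partial>lborel)"

lemma wt_measurable [measurable]: "wt R \<in> borel_measurable borel"
  unfolding wt_def by measurable

text \<open>The origin of the constant \<open>ln 2\<close>: it is the logarithmic length of an
  interval whose end points have ratio 2.\<close>

lemma nn_integral_inverse_dyadic:
  assumes "t > 0"
  shows "(\<integral>\<^sup>+\<rho>. ennreal (1 / (\<rho> * ln 2)) * indicator {t/2..t} \<rho> \<partial>lborel) = 1"
proof -
  have "(\<integral>\<^sup>+\<rho>. ennreal (1 / (\<rho> * ln 2)) * indicator {t/2..t} \<rho> \<partial>lborel) = ennreal (ln t / ln 2 - ln (t/2) / ln 2)"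
    by (rule nn_integral_FTC_Icc) (use assms in \<open>auto intro!: derivative_eq_intros simp: field_simps\<close>)
  also have "ln t / ln 2 - ln (t/2) / ln (2::real) = 1"
    using assms by (simp add: ln_div field_simps)
  finally show ?thesis by simp
qed

lemma wt_eq_1:
  assumes "0 < t" "t \<le> R"
  shows "wt R t = 1"
proof -
  have "wt R t = (\<integral>\<^sup>+\<rho>. ennreal (1 / (\<rho> * ln 2)) * indicator {t/2..t} \<rho> \<partial>lborel)"
    unfolding wt_def ring_def using assms by (intro nn_integral_cong) (auto simp: indicator_def)
  with nn_integral_inverse_dyadic[OF assms(1)] show ?thesis by simp
qed

lemma wt_le_1: "wt R t \<le> 1"
proof (cases "t > 0")
  case True
  have "wt R t \<le> (\<integral>\<^sup>+\<rho>. ennreal (1 / (\<rho> * ln 2)) * indicator {t/2..t} \<rho> \<partial>lborel)"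
    unfolding wt_def ring_def by (intro nn_integral_mono) (auto simp: indicator_def)
  with nn_integral_inverse_dyadic[OF True] show ?thesis by simp
next
  case False
  then have "ring R \<rho> t = 0" for \<rho> by (auto simp: ring_def)
  then show ?thesis by (simp add: wt_def)
qed

lemma nn_integral_dilation:
  fixes f :: "'n::euclidean_space \<Rightarrow> ennreal"
  assumes [measurable]: "f \<in> borel_measurable borel" and r: "r > 0"
  shows "(\<integral>\<^sup>+y. f y \<partial>lborel) = ennreal (r ^ DIM('n)) * (\<integral>\<^sup>+k. f (x + r *\<^sub>R k) \<partial>lborel)"
proof -
  have "(\<integral>\<^sup>+y. f y \<partial>lborel) = (\<integral>\<^sup>+y. f y \<partial>density (distr lborel borel (\<lambda>k. x + r *\<^sub>R k)) (\<lambda>_. ennreal (\<bar>r\<bar> ^ DIM('n))))"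
    using lborel_affine[of r x] r by simp
  also have "\<dots> = ennreal (r ^ DIM('n)) * (\<integral>\<^sup>+k. f (x + r *\<^sub>R k) \<partial>lborel)"
    using r by (subst nn_integral_density; (subst nn_integral_distr)?) (auto simp: nn_integral_cmult nn_integral_distr)
  finally show ?thesis .
qed

text \<open>By Tonelli the radius comes outside; for each radius the dilation
  \<open>y = x + \<rho> k\<close> maps the fixed annulus onto the one of that size, at the price of
  \<open>\<rho> ^ DIM('n)\<close>.\<close>

lemma nn_integral_fat_polar:
  fixes g :: "'n::euclidean_space \<Rightarrow> ennreal" and x :: 'n
  assumes [measurable]: "g \<in> borel_measurable borel"
  shows "(\<integral>\<^sup>+y. wt R (norm (y - x)) * g y \<partial>lborel) =
    (\<integral>\<^sup>+\<rho>. \<integral>\<^sup>+k. ennreal (indicator {0<..R} \<rho> * (\<rho> ^ DIM('n) / (\<rho> * ln 2)) * indicator annulus k) * g (x + \<rho> *\<^sub>R k) \<partial>lborel \<partial>lborel)"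
proof -
  have "(\<integral>\<^sup>+y. wt R (norm (y - x)) * g y \<partial>lborel) = (\<integral>\<^sup>+y. \<integral>\<^sup>+\<rho>. ennreal (ring R \<rho> (norm (y - x))) * g y \<partial>lborel \<partial>lborel)"
    unfolding wt_def by (intro nn_integral_cong) (simp add: nn_integral_multc)
  also have "\<dots> = (\<integral>\<^sup>+\<rho>. \<integral>\<^sup>+y. ennreal (ring R \<rho> (norm (y - x))) * g y \<partial>lborel \<partial>lborel)"
    by (rule lborel_pair.Fubini') measurable
  also have "\<dots> = (\<integral>\<^sup>+\<rho>. \<integral>\<^sup>+k. ennreal (indicator {0<..R} \<rho> * (\<rho> ^ DIM('n) / (\<rho> * ln 2)) * indicator annulus k) * g (x + \<rho> *\<^sub>R k) \<partial>lborel \<partial>lborel)"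
  proof (rule nn_integral_cong)
    fix \<rho> :: real
    show "(\<integral>\<^sup>+y. ennreal (ring R \<rho> (norm (y - x))) * g y \<partial>lborel) =
      (\<integral>\<^sup>+k. ennreal (indicator {0<..R} \<rho> * (\<rho> ^ DIM('n) / (\<rho> * ln 2)) * indicator annulus k) * g (x + \<rho> *\<^sub>R k) \<partial>lborel)"
    proof (cases "\<rho> > 0")
      case True
      have "(\<integral>\<^sup>+y. ennreal (ring R \<rho> (norm (y - x))) * g y \<partial>lborel) =
        ennreal (\<rho> ^ DIM('n)) * (\<integral>\<^sup>+k. ennreal (ring R \<rho> (norm (x + \<rho> *\<^sub>R k - x))) * g (x + \<rho> *\<^sub>R k) \<partial>lborel)"
        by (rule nn_integral_dilation[OF _ True]) measurable
      also have "\<dots> = (\<integral>\<^sup>+k. ennreal (\<rho> ^ DIM('n)) * (ennreal (ring R \<rho> (norm (x + \<rho> *\<^sub>R k - x))) * g (x + \<rho> *\<^sub>R k)) \<partial>lborel)"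
        by (rule nn_integral_cmult[symmetric]) measurable
      also have "\<dots> = (\<integral>\<^sup>+k. ennreal (indicator {0<..R} \<rho> * (\<rho> ^ DIM('n) / (\<rho> * ln 2)) * indicator annulus k) * g (x + \<rho> *\<^sub>R k) \<partial>lborel)"
      proof (intro nn_integral_cong)
        fix k :: 'n
        have "\<rho> ^ DIM('n) * ring R \<rho> (norm (x + \<rho> *\<^sub>R k - x)) = indicator {0<..R} \<rho> * (\<rho> ^ DIM('n) / (\<rho> * ln 2)) * indicator annulus k"
          using True by (auto simp: ring_def annulus_def indicator_def)
        then show "ennreal (\<rho> ^ DIM('n)) * (ennreal (ring R \<rho> (norm (x + \<rho> *\<^sub>R k - x))) * g (x + \<rho> *\<^sub>R k)) =
          ennreal (indicator {0<..R} \<rho> * (\<rho> ^ DIM('n) / (\<rho> * ln 2)) * indicator annulus k) * g (x + \<rho> *\<^sub>R k)"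
          using True by (simp add: mult.assoc[symmetric] ennreal_mult[symmetric])
      qed
      finally show ?thesis .
    qed (simp add: ring_def)
  qed
  finally show ?thesis .
qed

section \<open>Bounds and measurability of the kernel\<close>

definition kbound :: "'a::euclidean_space itself \<Rightarrow> complex \<Rightarrow> real" where
  "kbound _ s = (\<Sum>i<3. norm (kpoly i s)) * (real DIM('a) + 2)\<^sup>2"

text \<open>Projections do not increase norms, so with \<open>d\<close> the dimension and
  \<open>t = y \<bullet> y\<close> the numerators are at most \<open>d\<^sup>2 + 2 d\<close>,
  \<open>(2 d + 4) t\<close> and \<open>t\<^sup>2\<close>. The factor \<open>(d + 2)\<^sup>2\<close>
  covers all three.\<close>

lemma kcoef_bound:
  fixes y :: "'a::euclidean_space"
  assumes A: "orthonormal A" and B: "orthonormal B"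
  shows "\<bar>kcoef i (onproj A) (onproj B) y\<bar> \<le> (real DIM('a) + 2)\<^sup>2 * inverse (y \<bullet> y) ^ 2"
proof (cases "y = 0")
  case True
  then show ?thesis by (simp add: kcoef_def)
next
  case False
  define d where "d = real DIM('a)"
  have d: "d \<ge> 0" by (simp add: d_def)
  let ?P = "onproj A" and ?Q = "onproj B"
  have n1: "norm (onproj C i) \<le> 1" if "orthonormal C" "i \<in> Basis" for C and i :: 'a
    using norm_onproj_le[OF that(1), of i] that(2) by simp
  have in1: "\<bar>u \<bullet> v\<bar> \<le> 1" if "norm u \<le> 1" "norm v \<le> 1" for u v :: 'a
    using Cauchy_Schwarz_ineq2[of u v] mult_mono[OF that] by simp
  have tr: "\<bar>tr (onproj C)\<bar> \<le> d" if "orthonormal C" for C :: "'a set"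
  proof -
    have "\<bar>tr (onproj C)\<bar> \<le> (\<Sum>i\<in>(Basis::'a set). 1)" unfolding tr_def
      by (intro order.trans[OF sum_abs sum_mono] in1 n1 that) auto
    then show ?thesis by (simp add: d_def)
  qed
  have tr2: "\<bar>tr2 ?P ?Q\<bar> \<le> d"
  proof -
    have "\<bar>tr2 ?P ?Q\<bar> \<le> (\<Sum>i\<in>(Basis::'a set). 1)" unfolding tr2_def
      by (intro order.trans[OF sum_abs sum_mono] in1 n1 A B)
    then show ?thesis by (simp add: d_def)
  qed
  define t where "t = y \<bullet> y"
  have t: "t > 0" using False by (simp add: t_def)
  have ip: "\<bar>onproj C y \<bullet> onproj D y\<bar> \<le> t" if "orthonormal C" "orthonormal D" for C D
  proof -
    have "\<bar>onproj C y \<bullet> onproj D y\<bar> \<le> norm (onproj C y) * norm (onproj D y)" by (rule Cauchy_Schwarz_ineq2)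
    also have "\<dots> \<le> norm y * norm y" using norm_onproj_le that by (intro mult_mono) auto
    finally show ?thesis by (simp add: t_def power2_norm_eq_inner power2_eq_square[symmetric])
  qed
  have b0: "\<bar>tr ?P * tr ?Q + 2 * tr2 ?P ?Q\<bar> \<le> (d + 2)\<^sup>2"
  proof -
    have "\<bar>tr ?P * tr ?Q\<bar> \<le> d * d" unfolding abs_mult using tr A B d by (intro mult_mono) auto
    moreover have "(d + 2)\<^sup>2 = d * d + 4 * d + 4" by (simp add: power2_eq_square algebra_simps)
    ultimately show ?thesis using tr2 d by linarith
  qed
  have b1: "\<bar>tr ?Q * (?P y \<bullet> ?P y) + 4 * (?P y \<bullet> ?Q y) + tr ?P * (?Q y \<bullet> ?Q y)\<bar> \<le> (d + 2)\<^sup>2 * t"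
  proof -
    have "\<bar>tr ?Q * (?P y \<bullet> ?P y)\<bar> \<le> d * t" "\<bar>tr ?P * (?Q y \<bullet> ?Q y)\<bar> \<le> d * t"
      unfolding abs_mult using mult_mono[OF tr[OF B] ip[OF A A] d abs_ge_zero] mult_mono[OF tr[OF A] ip[OF B B] d abs_ge_zero] .
    moreover have "\<bar>?P y \<bullet> ?Q y\<bar> \<le> t" using ip A B by blast
    moreover have "(d + 2)\<^sup>2 * t = d * d * t + 4 * (d * t) + 4 * t" by (simp add: power2_eq_square algebra_simps)
    moreover have "d * d * t \<ge> 0" "d * t \<ge> 0" using d t by auto
    ultimately show ?thesis by linarith
  qed
  have b2: "\<bar>(?P y \<bullet> ?P y) * (?Q y \<bullet> ?Q y)\<bar> \<le> (d + 2)\<^sup>2 * t\<^sup>2"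
  proof -
    have "\<bar>(?P y \<bullet> ?P y) * (?Q y \<bullet> ?Q y)\<bar> \<le> t * t" unfolding abs_mult
      by (rule mult_mono[OF ip[OF A A] ip[OF B B] less_imp_le[OF t] abs_ge_zero])
    also have "\<dots> \<le> (d + 2)\<^sup>2 * t\<^sup>2"
    proof -
      have "1 \<le> (d + 2)\<^sup>2" using d by (intro one_le_power) simp
      from mult_right_mono[OF this, of "t\<^sup>2"] show ?thesis by (simp add: power2_eq_square)
    qed
    finally show ?thesis .
  qed
  have e: "(d + 2)\<^sup>2 * t * inverse t ^ 3 = (d + 2)\<^sup>2 * inverse t ^ 2" "(d + 2)\<^sup>2 * t\<^sup>2 * inverse t ^ 4 = (d + 2)\<^sup>2 * inverse t ^ 2"
    using t by (simp_all add: field_simps eval_nat_numeral)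
  have p: "0 \<le> inverse t ^ k" for k using t by simp
  show ?thesis
    unfolding kcoef_def d_def[symmetric] t_def[symmetric]
    using mult_right_mono[OF b0 p[of 2]] mult_right_mono[OF b1 p[of 3]] mult_right_mono[OF b2 p[of 4]] t
    unfolding e by (auto simp: abs_mult)
qed

text \<open>Gives boundedness up to the diagonal as soon as \<open>Re s \<ge> 4\<close>, and bounds
  locally uniform in \<open>s\<close> away from the diagonal: the two regimes in which the integrals
  are controlled.\<close>

lemma kern_bound:
  fixes y :: "'a::euclidean_space"
  assumes A: "orthonormal A" and B: "orthonormal B" and y: "y \<noteq> 0"
  shows "norm (kern s (onproj A) (onproj B) y) \<le> kbound TYPE('a) s * exp ((Re s - 4) * ln (norm y))"
proof -
  have pos: "y \<bullet> y > 0" using y by simp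
  have l: "ln (y \<bullet> y) = 2 * ln (norm y)" using y by (simp add: norm_eq_sqrt_inner ln_sqrt)
  have i: "inverse (y \<bullet> y) ^ 2 = exp (- 4 * ln (norm y))"
  proof -
    have "exp (- 4 * ln (norm y)) = inverse (exp (ln (y \<bullet> y)) ^ 2)"
      unfolding l exp_of_nat_mult[symmetric] exp_minus[symmetric] by simp
    then show ?thesis using pos by (simp add: power_inverse)
  qed
  have "norm (\<Sum>i<3. kpoly i s * of_real (kcoef i (onproj A) (onproj B) y)) \<le> (\<Sum>i<3. norm (kpoly i s) * ((real DIM('a) + 2)\<^sup>2 * inverse (y \<bullet> y) ^ 2))"
    unfolding norm_mult by (intro order.trans[OF norm_sum sum_mono]) (auto simp: norm_mult intro!: mult_left_mono kcoef_bound[OF A B])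
  also have "\<dots> = kbound TYPE('a) s * exp (- 4 * ln (norm y))"
    by (simp add: kbound_def sum_distrib_right i mult.assoc)
  finally have 1: "norm (\<Sum>i<3. kpoly i s * of_real (kcoef i (onproj A) (onproj B) y)) \<le> kbound TYPE('a) s * exp (- 4 * ln (norm y))" .
  have "norm (exp (s * of_real (ln (y \<bullet> y) / 2))) = exp (Re s * ln (norm y))" by (simp add: norm_exp_eq_Re l)
  then have "norm (kern s (onproj A) (onproj B) y) = norm (\<Sum>i<3. kpoly i s * of_real (kcoef i (onproj A) (onproj B) y)) * exp (Re s * ln (norm y))"
    unfolding kern_def if_not_P[OF y] norm_mult[of "\<Sum>i<3. kpoly i s * of_real (kcoef i (onproj A) (onproj B) y)"] by (rule arg_cong)
  also have "\<dots> \<le> kbound TYPE('a) s * exp (- 4 * ln (norm y)) * exp (Re s * ln (norm y))"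
    by (rule mult_right_mono[OF 1 exp_ge_zero])
  also have "\<dots> = kbound TYPE('a) s * exp ((Re s - 4) * ln (norm y))"
    unfolding mult.assoc exp_add[symmetric] by (simp add: algebra_simps)
  finally show ?thesis .
qed

lemma kern_holomorphic: "(\<lambda>s. kern s P Q y) holomorphic_on UNIV"
  unfolding kern_def by (cases "y = 0") (auto intro!: holomorphic_intros kpoly_holomorphic)

lemma kbound_nonneg: "0 \<le> kbound TYPE('a::euclidean_space) s"
  by (simp add: kbound_def sum_nonneg)

text \<open>No curve through \<open>u\<close> stays in \<open>M\<close>, so the tangent set is empty
  and every vector is normal. This makes the projection a Borel function of \<open>u\<close> on the
  whole space, where the measure lives.\<close>

lemma nproj_outside:
  assumes "u \<notin> M"
  shows "nproj M u y = y"
proof -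
  have "tangent_space M u = {}"
  proof -
    have "\<gamma> 0 \<in> M" if "e > 0" "\<forall>t. \<bar>t\<bar> < e \<longrightarrow> \<gamma> t \<in> M" for \<gamma> :: "real \<Rightarrow> 'a" and e using that by auto
    with assms show ?thesis unfolding tangent_space_def by blast
  qed
  then have "normal_space M u = UNIV" by (auto simp: normal_space_def)
  then have "y \<in> span (normal_basis M u)" using normal_basis(3)[of M u] by simp
  then show ?thesis unfolding nproj_def by (rule onproj_span[OF normal_basis(1)])
qed

lemma nproj_measurable:
  fixes M :: "'a::euclidean_space set"
  assumes "smooth_submanifold TYPE('n::euclidean_space) M" "closed M"
  shows "(\<lambda>u. nproj M u y) \<in> borel_measurable borel"
proof -
  have M: "M \<in> sets borel" using assms(2) by auto
  have "(\<lambda>u. indicator M u *\<^sub>R nproj M u y) \<in> borel_measurable borel"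
    by (rule borel_measurable_continuous_on_indicator[OF M continuous_on_nproj[OF assms(1)]])
  moreover have "(\<lambda>u. indicator (- M) u *\<^sub>R y) \<in> borel_measurable borel"
    using M by (intro borel_measurable_scaleR borel_measurable_indicator) auto
  ultimately have "(\<lambda>u. indicator M u *\<^sub>R nproj M u y + indicator (- M) u *\<^sub>R y) \<in> borel_measurable borel" by (rule borel_measurable_add)
  also have "(\<lambda>u. indicator M u *\<^sub>R nproj M u y + indicator (- M) u *\<^sub>R y) = (\<lambda>u. nproj M u y)"
    using nproj_outside[of _ M y] by (auto simp: indicator_def fun_eq_iff)
  finally show ?thesis .
qed

definition pair_kern :: "'a::euclidean_space set \<Rightarrow> complex \<Rightarrow> 'a \<times> 'a \<Rightarrow> complex" where
  "pair_kern M s p = kern s (nproj M (fst p)) (nproj M (snd p)) (snd p - fst p)"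

lemma pair_kern_measurable:
  fixes M :: "'a::euclidean_space set"
  assumes "smooth_submanifold TYPE('n::euclidean_space) M" "closed M"
  shows "pair_kern M s \<in> borel_measurable borel"
proof -
  note [measurable] = nproj_measurable[OF assms]
  have F [measurable]: "fst \<in> borel \<rightarrow>\<^sub>M (borel :: 'a measure)" and S [measurable]: "snd \<in> borel \<rightarrow>\<^sub>M (borel :: 'a measure)"
    by (auto intro!: borel_measurable_continuous_onI continuous_intros)
  have N: "(\<lambda>p::'a\<times>'a. nproj M (f p) (g p)) \<in> borel_measurable borel"
    if "f \<in> borel \<rightarrow>\<^sub>M borel" "g \<in> borel \<rightarrow>\<^sub>M borel" for f g :: "'a \<times> 'a \<Rightarrow> 'a"
  proof -
    \<comment> \<open>Linearity in the vector reduces joint measurability to fixed basis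
      vectors.\<close>
    have "nproj M (f p) (g p) = (\<Sum>b\<in>Basis. (g p \<bullet> b) *\<^sub>R nproj M (f p) b)" for p
    proof -
      have "nproj M (f p) (\<Sum>b\<in>Basis. (g p \<bullet> b) *\<^sub>R b) = (\<Sum>b\<in>Basis. (g p \<bullet> b) *\<^sub>R nproj M (f p) b)"
        unfolding nproj_def by (simp add: linear_sum[OF linear_onproj] linear_scale[OF linear_onproj])
      then show ?thesis by (simp add: euclidean_representation)
    qed
    moreover have "(\<lambda>p. \<Sum>b\<in>Basis. (g p \<bullet> b) *\<^sub>R nproj M (f p) b) \<in> borel_measurable borel"
      by (intro borel_measurable_sum borel_measurable_scaleR borel_measurable_inner
        measurable_compose[OF that(1) nproj_measurable[OF assms]] that borel_measurable_const)
    ultimately show ?thesis by simp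
  qed
  have [measurable]: "(\<lambda>p. kcoef i (nproj M (fst p)) (nproj M (snd p)) (snd p - fst p)) \<in> borel_measurable borel" for i
    unfolding kcoef_def tr_def tr2_def
    by (cases "i = 0"; cases "i = 1") (simp_all, (intro borel_measurable_times borel_measurable_add borel_measurable_sum
      borel_measurable_inner borel_measurable_power borel_measurable_inverse N borel_measurable_const borel_measurable_diff F S)+)
  show ?thesis unfolding pair_kern_def[abs_def] kern_def by measurable
qed

section \<open>Decomposition of the beta function\<close>

lemma simple_poles_in_mono: "simple_poles_in S f \<Longrightarrow> S \<subseteq> T \<Longrightarrow> simple_poles_in T f"
  unfolding simple_poles_in_def by blast

context atlas
begin

lemma smooth_M: "smooth_submanifold TYPE('n) M"
  unfolding smooth_submanifold_def
proof
  fix p assume "p \<in> M"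
  then obtain i where i: "i < m" "p \<in> \<phi> i ` ball (c i) (\<epsilon> i)" using cover by blast
  then have "p \<in> \<phi> i ` V i" using ball_V by blast
  with param[OF i(1)] show "\<exists>V (\<phi> :: 'n \<Rightarrow> 'a). local_param M V \<phi> \<and> p \<in> \<phi> ` V" by blast
qed

lemma chart_ball: "i < m \<Longrightarrow> chart_ball M (V i) (\<phi> i) (c i) (\<epsilon> i)"
  using param eps cball_V by unfold_locales auto

text \<open>An injective chart meets a point at most once, and a single parameter value is Lebesgue
  null. Hence the value of the integrand on the diagonal is immaterial.\<close>

lemma area_singleton: "emeasure area {u} = 0"
proof -
  have "emeasure (chart_measure (V i) (\<phi> i) (core i)) {u} = 0" if i: "i < m" for i
  proof -
    have "finite {x \<in> core i. \<phi> i x \<in> {u}}"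
    proof (rule finite_subset)
      show "{x \<in> core i. \<phi> i x \<in> {u}} \<subseteq> {inv_into (V i) (\<phi> i) u}"
        using core_V[OF i] local_paramD(3)[OF param[OF i]] by (auto simp: inv_into_f_f)
    qed simp
    then have "{x \<in> core i. \<phi> i x \<in> {u}} \<in> null_sets lborel" by (intro finite_imp_null_set_lborel)
    then have "(\<integral>\<^sup>+x\<in>{x \<in> core i. \<phi> i x \<in> {u}}. ennreal (area_density (\<phi> i) x) \<partial>lborel) = 0" by (rule nn_integral_null_set)
    then show ?thesis by (subst emeasure_chart_measure[OF param[OF i] core_borel[OF i] core_V[OF i]]) auto
  qed
  then show ?thesis by (subst emeasure_area) auto
qed

lemma finite_measure_area: "finite_measure area"
  using finite_area by (intro finite_measureI) (simp add: less_top)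

abbreviation "area2 \<equiv> area \<Otimes>\<^sub>M area"

lemma sets_area2 [simp]: "sets area2 = sets (borel :: ('a \<times> 'a) measure)" "space area2 = UNIV"
proof -
  have "sets area2 = sets (borel \<Otimes>\<^sub>M borel :: ('a \<times> 'a) measure)" by (rule sets_pair_measure_cong) auto
  then show "sets area2 = sets (borel :: ('a \<times> 'a) measure)" by (simp only: borel_prod)
qed (simp add: space_pair_measure)

lemma borel_measurable_area2 [simp]: "borel_measurable area2 = borel_measurable (borel :: ('a \<times> 'a) measure)"
  by (rule measurable_cong_sets[OF sets_area2(1) refl])

lemma finite_measure_area2: "finite_measure area2"
proof -
  interpret finite_measure area by (rule finite_measure_area)
  show ?thesis
  proof (rule finite_measureI)
    have "emeasure area2 (UNIV \<times> UNIV) = emeasure area UNIV * emeasure area UNIV"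
      by (rule emeasure_pair_measure_Times) auto
    then show "emeasure area2 (space area2) \<noteq> \<infinity>" using finite_area by (simp add: ennreal_mult_eq_top_iff less_top)
  qed
qed

lemma AE_area2: "AE p in area2. p \<in> M \<times> M"
proof -
  interpret finite_measure area by (rule finite_measure_area)
  have M: "UNIV - M \<in> sets area" using closed_M by (auto intro!: sets.Diff)
  have z: "emeasure area (UNIV - M) = 0" using is_surface_measure_area by (simp add: is_surface_measure_def)
  have "emeasure area2 ((UNIV - M) \<times> UNIV) = 0" "emeasure area2 (UNIV \<times> (UNIV - M)) = 0"
    using M z by (simp_all add: emeasure_pair_measure_Times)
  moreover have "(UNIV - M) \<times> UNIV \<in> sets area2" "UNIV \<times> (UNIV - M) \<in> sets area2"
    using M by (auto intro!: pair_measureI simp del: sets_area2)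
  ultimately have "(UNIV - M) \<times> UNIV \<union> UNIV \<times> (UNIV - M) \<in> null_sets area2"
    by (intro null_sets.Un) (auto simp del: sets_area2)
  then show ?thesis by (rule AE_I') auto
qed

lemma pair_kern_borel [measurable]: "pair_kern M s \<in> borel_measurable borel"
  by (rule pair_kern_measurable[OF smooth_M closed_M])

lemma diameter: "\<exists>D\<ge>1. \<forall>u\<in>M. \<forall>v\<in>M. norm (v - u) \<le> D"
proof -
  obtain K where K: "\<And>u. u \<in> M \<Longrightarrow> norm u \<le> K" using compact_imp_bounded[OF compact] unfolding bounded_iff by blast
  have "norm (v - u) \<le> max 1 (2 * K)" if "u \<in> M" "v \<in> M" for u v
    using norm_triangle_ineq4[of v u] K[OF that(1)] K[OF that(2)] by linarith
  then show ?thesis by (intro exI[of _ "max 1 (2 * K)"]) auto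
qed

lemma pair_kern_bounded:
  assumes "Re s \<ge> 4"
  shows "\<exists>B. \<forall>p\<in>M\<times>M. norm (pair_kern M s p) \<le> B"
proof -
  obtain D where D: "D \<ge> 1" "\<And>u v. u \<in> M \<Longrightarrow> v \<in> M \<Longrightarrow> norm (v - u) \<le> D" using diameter by blast
  have "norm (pair_kern M s p) \<le> kbound TYPE('a) s * exp ((Re s - 4) * ln D)" if p: "p \<in> M \<times> M" for p
  proof (cases "snd p = fst p")
    case True
    then show ?thesis using kbound_nonneg[where 'a='a] by (simp add: pair_kern_def kern_def)
  next
    case False
    then have "norm (pair_kern M s p) \<le> kbound TYPE('a) s * exp ((Re s - 4) * ln (norm (snd p - fst p)))"
      unfolding pair_kern_def nproj_def by (intro kern_bound normal_basis(1)) auto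
    also have "\<dots> \<le> kbound TYPE('a) s * exp ((Re s - 4) * ln D)"
      using D(2)[of "fst p" "snd p"] p False assms kbound_nonneg
      by (intro mult_left_mono iffD2[OF exp_le_cancel_iff] ln_mono) auto
    finally show ?thesis .
  qed
  then show ?thesis by blast
qed

lemma integrable_weighted_kern:
  assumes s: "Re s \<ge> 4" and w: "w \<in> borel_measurable borel" "\<And>p. \<bar>w p\<bar> \<le> C"
  shows "integrable area2 (\<lambda>p. w p *\<^sub>R pair_kern M s p)"
proof -
  interpret finite_measure area2 by (rule finite_measure_area2)
  obtain B where B: "\<And>p. p \<in> M \<times> M \<Longrightarrow> norm (pair_kern M s p) \<le> B" using pair_kern_bounded[OF s] by blast
  have C: "C \<ge> 0" using w(2)[of undefined] by linarith
  show ?thesis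
  proof (rule integrable_const_bound)
    show "AE p in area2. norm (w p *\<^sub>R pair_kern M s p) \<le> C * B"
      using AE_area2 by eventually_elim (use B w(2) C in \<open>auto intro!: mult_mono\<close>)
    show "(\<lambda>p. w p *\<^sub>R pair_kern M s p) \<in> borel_measurable area2" using w(1) by simp
  qed
qed

text \<open>For fixed \<open>u\<close> the explicit kernel can differ from the iterated derivative
  only at \<open>v = u\<close>, a null set. It is bounded for \<open>Re s \<ge> 4\<close> and the
  measure is finite, so Fubini applies.\<close>

lemma coaxial_beta_eq:
  assumes "Re s \<ge> 4"
  shows "coaxial_beta TYPE('n) M s = (\<integral>p. pair_kern M s p \<partial>area2)"
proof -
  interpret A: finite_measure area by (rule finite_measure_area)
  interpret pair_sigma_finite area area ..
  have "coaxial_beta TYPE('n) M s = (\<integral>u. \<integral>v. pair_kern M s (u, v) \<partial>area \<partial>area)"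
    unfolding coaxial_beta_def surface_measure_eq_area
  proof (rule Bochner_Integration.integral_cong[OF refl])
    fix u
    show "(\<integral>v. coaxial_deriv M u (\<lambda>w. coaxial_deriv M v (\<lambda>z. Nfun s (z - w))) \<partial>area) = (\<integral>v. pair_kern M s (u, v) \<partial>area)"
      by (rule integral_discrete_difference[of "{u}"]) (auto simp: area_singleton pair_kern_def double_coaxial_deriv)
  qed
  also have "\<dots> = (\<integral>p. pair_kern M s p \<partial>area2)"
    using integrable_weighted_kern[OF assms, of "\<lambda>_. 1" 1] by (intro integral_fst') simp
  finally show ?thesis .
qed

section \<open>The weight near the diagonal in blown-up coordinates\<close>

definition "cinv i v = indicator (\<phi> i ` V i) v *\<^sub>R inv_into (V i) (\<phi> i) v"

lemma cinv_measurable [measurable]: "i < m \<Longrightarrow> cinv i \<in> borel \<rightarrow>\<^sub>M borel"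
  unfolding cinv_def
  by (intro borel_measurable_continuous_on_indicator local_paramD(4)[OF param] borel_chart_range[OF param closed_M])

lemma cinv_chart: "i < m \<Longrightarrow> x \<in> V i \<Longrightarrow> cinv i (\<phi> i x) = x"
  using local_paramD(3)[OF param] by (simp add: cinv_def inv_into_f_f)

abbreviation "patch i \<equiv> ball (c i) (2 * \<epsilon> i)"

lemma patch_V: "i < m \<Longrightarrow> patch i \<subseteq> V i"
  using cball_V[of i] by (force simp: subset_iff)

text \<open>The first point is localised sharply by its piece, the second through its coordinate
  distance to the first, by way of the radial average \<open>wt\<close>. Because of this asymmetry
  the sharp cut to a piece becomes, in the coordinates \<open>(\<rho>, x, k)\<close>, a condition on
  \<open>x\<close> alone.\<close>

definition near_wt :: "nat \<Rightarrow> 'a \<times> 'a \<Rightarrow> real" where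
  "near_wt i p = indicator (piece i) (fst p) * indicator (\<phi> i ` patch i) (snd p)
     * enn2real (wt (\<epsilon> i / 4) (norm (cinv i (snd p) - cinv i (fst p))))"

lemma enn2real_wt: "0 \<le> enn2real (wt R t)" "enn2real (wt R t) \<le> 1" "ennreal (enn2real (wt R t)) = wt R t"
proof -
  have "wt R t < top" using wt_le_1[of R t] by (rule le_less_trans) simp
  then show "ennreal (enn2real (wt R t)) = wt R t" by simp
  show "enn2real (wt R t) \<le> 1" using enn2real_mono[OF wt_le_1[of R t]] by simp
qed simp

lemma patch_image_borel: "i < m \<Longrightarrow> \<phi> i ` patch i \<in> sets borel"
  by (rule borel_chart_image[OF param closed_M _ patch_V]) auto

lemma fst_snd_borel [measurable]: "fst \<in> (borel :: ('a \<times> 'a) measure) \<rightarrow>\<^sub>M borel" "snd \<in> (borel :: ('a \<times> 'a) measure) \<rightarrow>\<^sub>M borel"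
  by (auto intro!: borel_measurable_continuous_onI continuous_intros)

lemma near_wt_measurable:
  assumes i: "i < m"
  shows "near_wt i \<in> borel_measurable borel"
proof -
  note [measurable] = piece_borel[OF i] patch_image_borel[OF i] cinv_measurable[OF i]
  show ?thesis unfolding near_wt_def[abs_def] by measurable
qed

lemma near_wt_bounds: "0 \<le> near_wt i p" "near_wt i p \<le> 1"
  using enn2real_wt[of "\<epsilon> i / 4" "norm (cinv i (snd p) - cinv i (fst p))"] by (auto simp: near_wt_def indicator_def)

text \<open>Weight and Jacobian of the parametrisation \<open>blow_map\<close> together: radial
  average, volume factor of the dilation, and both area densities.\<close>

definition blow_wt :: "nat \<Rightarrow> real \<times> 'n \<times> 'n \<Rightarrow> real" where
  "blow_wt i z = (indicator {0<..\<epsilon> i / 4} (fst z) * (fst z ^ DIM('n) / (fst z * ln 2)) * indicator annulus (snd (snd z)))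
     * ((indicator (core i) (fst (snd z)) * area_density (\<phi> i) (fst (snd z)))
     * (indicator (patch i) (fst (snd z) + fst z *\<^sub>R snd (snd z)) * area_density (\<phi> i) (fst (snd z) + fst z *\<^sub>R snd (snd z))))"

definition blow_map :: "nat \<Rightarrow> real \<times> 'n \<times> 'n \<Rightarrow> 'a \<times> 'a" where
  "blow_map i z = (chart_ext (V i) (\<phi> i) (fst (snd z)), chart_ext (V i) (\<phi> i) (fst (snd z) + fst z *\<^sub>R snd (snd z)))"

lemma real_density_measurable:
  assumes "i < m" "E \<in> sets borel" "E \<subseteq> V i"
  shows "(\<lambda>x. indicator E x * area_density (\<phi> i) x) \<in> borel_measurable borel"
  using borel_measurable_continuous_on_indicator[OF assms(2) continuous_on_subset[OF continuous_on_area_density[OF param[OF assms(1)]] assms(3)]]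
  by simp

lemma real_density_nonneg:
  assumes "i < m" "E \<subseteq> V i"
  shows "0 \<le> indicator E x * area_density (\<phi> i) x"
  using gram_det_pos[OF param[OF assms(1)], of x] assms(2) by (auto simp: indicator_def)

lemma borel_triple [measurable]:
  "(\<lambda>z :: real \<times> 'n \<times> 'n. fst z) \<in> borel \<rightarrow>\<^sub>M borel" "(\<lambda>z :: real \<times> 'n \<times> 'n. fst (snd z)) \<in> borel \<rightarrow>\<^sub>M borel"
  "(\<lambda>z :: real \<times> 'n \<times> 'n. snd (snd z)) \<in> borel \<rightarrow>\<^sub>M borel" "(\<lambda>z :: real \<times> 'n \<times> 'n. fst (snd z) + fst z *\<^sub>R snd (snd z)) \<in> borel \<rightarrow>\<^sub>M borel"
  by (auto intro!: borel_measurable_continuous_onI continuous_intros)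

lemma blow_wt_measurable:
  assumes i: "i < m"
  shows "blow_wt i \<in> borel_measurable borel"
proof -
  have 1: "(\<lambda>z :: real \<times> 'n \<times> 'n. indicator (core i) (fst (snd z)) * area_density (\<phi> i) (fst (snd z))) \<in> borel_measurable borel"
    by (rule measurable_compose[OF borel_triple(2) real_density_measurable[OF i core_borel[OF i] core_V[OF i]]])
  have 2: "(\<lambda>z :: real \<times> 'n \<times> 'n. indicator (patch i) (fst (snd z) + fst z *\<^sub>R snd (snd z)) * area_density (\<phi> i) (fst (snd z) + fst z *\<^sub>R snd (snd z))) \<in> borel_measurable borel"
    by (rule measurable_compose[OF borel_triple(4) real_density_measurable[OF i _ patch_V[OF i]]]) auto
  have 3: "(\<lambda>z :: real \<times> 'n \<times> 'n. indicator {0<..\<epsilon> i / 4} (fst z) * (fst z ^ DIM('n) / (fst z * ln 2)) * indicator annulus (snd (snd z)) :: real) \<in> borel_measurable borel"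
    by measurable
  show ?thesis unfolding blow_wt_def[abs_def] by (intro borel_measurable_times[OF 3] borel_measurable_times[OF 1 2])
qed

lemma blow_wt_nonneg:
  assumes i: "i < m"
  shows "0 \<le> blow_wt i z"
proof -
  have "0 \<le> indicator {0<..\<epsilon> i / 4} (fst z) * (fst z ^ DIM('n) / (fst z * ln 2)) * (indicator annulus (snd (snd z)) :: real)"
    by (auto simp: indicator_def)
  then show ?thesis unfolding blow_wt_def
    by (rule mult_nonneg_nonneg[OF _ mult_nonneg_nonneg[OF real_density_nonneg[OF i core_V[OF i]] real_density_nonneg[OF i patch_V[OF i]]]])
qed

lemma blow_map_measurable:
  assumes i: "i < m"
  shows "blow_map i \<in> borel \<rightarrow>\<^sub>M borel"
  unfolding blow_map_def[abs_def]
  by (intro borel_measurable_Pair measurable_compose[OF borel_triple(2) chart_ext_measurable[OF param[OF i]]]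
      measurable_compose[OF borel_triple(4) chart_ext_measurable[OF param[OF i]]])

text \<open>Stated for nonnegative \<open>h\<close>, where Tonelli and the chart formula need no
  integrability; the complex kernel is reached afterwards through an equality of measures.\<close>

lemma nn_integral_near:
  assumes i: "i < m" and h [measurable]: "h \<in> borel_measurable borel"
  shows "(\<integral>\<^sup>+p. ennreal (near_wt i p) * h p \<partial>area2) = (\<integral>\<^sup>+z. ennreal (blow_wt i z) * h (blow_map i z) \<partial>lborel)"
proof -
  interpret A: finite_measure area by (rule finite_measure_area)
  define R where "R = \<epsilon> i / 4"
  define G where "G = patch i"
  define X where "X = chart_ext (V i) (\<phi> i)"
  define JC where "JC x = ennreal (indicator (core i) x * area_density (\<phi> i) x)" for x
  define JG where "JG x = ennreal (indicator G x * area_density (\<phi> i) x)" for x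
  have GV: "G \<subseteq> V i" "G \<in> sets borel" using patch_V[OF i] by (auto simp: G_def)
  have [measurable]: "JC \<in> borel_measurable borel" "JG \<in> borel_measurable borel"
    unfolding JC_def JG_def using real_density_measurable[OF i core_borel[OF i] core_V[OF i]] real_density_measurable[OF i GV(2,1)]
    by (auto intro: measurable_ennreal[THEN measurable_compose_rev])
  have [measurable]: "X \<in> borel \<rightarrow>\<^sub>M borel" unfolding X_def by (rule chart_ext_measurable[OF param[OF i]])
  note [measurable] = piece_borel[OF i] patch_image_borel[OF i, folded G_def] cinv_measurable[OF i] GV(2) core_borel[OF i]
  have h2 [measurable]: "h \<in> borel_measurable (borel \<Otimes>\<^sub>M borel)" by (simp add: borel_prod)
  have ind_JC: "indicator (core i) x * ennreal (area_density (\<phi> i) x) = JC x" for x by (auto simp: JC_def indicator_def)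
  have ind_JG: "indicator G x * ennreal (area_density (\<phi> i) x) = JG x" for x by (auto simp: JG_def indicator_def)
  define k where "k u v = wt R (norm (cinv i v - cinv i u)) * h (u, v)" for u v
  have k_meas [measurable]: "(\<lambda>(u, v). k u v) \<in> borel_measurable (borel \<Otimes>\<^sub>M borel)" unfolding k_def by measurable
  define g where "g u = (\<integral>\<^sup>+y. JG y * (wt R (norm (y - cinv i u)) * h (u, X y)) \<partial>lborel)" for u
  have [measurable]: "g \<in> borel_measurable borel" unfolding g_def by measurable
  have inner: "(\<integral>\<^sup>+v. indicator (\<phi> i ` G) v * k u v \<partial>area) = g u" for u
  proof -
    have "(\<integral>\<^sup>+v. indicator (\<phi> i ` G) v * k u v \<partial>area) = (\<integral>\<^sup>+y. indicator G y * ennreal (area_density (\<phi> i) y) * k u (\<phi> i y) \<partial>lborel)"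
      by (rule nn_integral_area_chart[OF param[OF i] GV(2,1)]) measurable
    also have "\<dots> = g u" unfolding g_def
    proof (rule nn_integral_cong)
      fix y
      show "indicator G y * ennreal (area_density (\<phi> i) y) * k u (\<phi> i y) = JG y * (wt R (norm (y - cinv i u)) * h (u, X y))"
        using GV(1) cinv_chart[OF i, of y] unfolding ind_JG by (cases "y \<in> G") (auto simp: k_def X_def chart_ext_def JG_def)
    qed
    finally show ?thesis .
  qed
  have "(\<integral>\<^sup>+p. ennreal (near_wt i p) * h p \<partial>area2) = (\<integral>\<^sup>+u. \<integral>\<^sup>+v. ennreal (near_wt i (u, v)) * h (u, v) \<partial>area \<partial>area)"
    by (rule A.nn_integral_fst[symmetric])
      (use borel_measurable_times_ennreal[OF measurable_compose[OF near_wt_measurable[OF i] measurable_ennreal] h] in simp)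
  also have "\<dots> = (\<integral>\<^sup>+u. indicator (piece i) u * g u \<partial>area)"
  proof (rule nn_integral_cong)
    fix u
    have "(\<integral>\<^sup>+v. ennreal (near_wt i (u, v)) * h (u, v) \<partial>area) = (\<integral>\<^sup>+v. indicator (piece i) u * (indicator (\<phi> i ` G) v * k u v) \<partial>area)"
      by (rule nn_integral_cong) (auto simp: near_wt_def k_def G_def R_def indicator_def enn2real_wt(3))
    also have "\<dots> = indicator (piece i) u * g u"
      unfolding inner[symmetric] by (rule nn_integral_cmult) (simp cong: measurable_cong_sets)
    finally show "(\<integral>\<^sup>+v. ennreal (near_wt i (u, v)) * h (u, v) \<partial>area) = indicator (piece i) u * g u" .
  qed
  also have "\<dots> = (\<integral>\<^sup>+x. indicator (core i) x * ennreal (area_density (\<phi> i) x) * g (\<phi> i x) \<partial>lborel)"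
    unfolding image_core[symmetric] by (rule nn_integral_area_chart[OF param[OF i] core_borel[OF i] core_V[OF i]]) measurable
  also have "\<dots> = (\<integral>\<^sup>+x. JC x * (\<integral>\<^sup>+y. wt R (norm (y - x)) * (JG y * h (X x, X y)) \<partial>lborel) \<partial>lborel)"
  proof (rule nn_integral_cong)
    fix x
    show "indicator (core i) x * ennreal (area_density (\<phi> i) x) * g (\<phi> i x) = JC x * (\<integral>\<^sup>+y. wt R (norm (y - x)) * (JG y * h (X x, X y)) \<partial>lborel)"
    proof (cases "x \<in> core i")
      case True
      then have "X x = \<phi> i x" "cinv i (\<phi> i x) = x" using core_V[OF i] cinv_chart[OF i, of x] by (auto simp: X_def chart_ext_def)
      then have "g (\<phi> i x) = (\<integral>\<^sup>+y. wt R (norm (y - x)) * (JG y * h (X x, X y)) \<partial>lborel)"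
        by (simp add: g_def mult.left_commute)
      then show ?thesis by (simp add: ind_JC)
    qed (simp add: JC_def)
  qed
  also have "\<dots> = (\<integral>\<^sup>+x. \<integral>\<^sup>+\<rho>. \<integral>\<^sup>+k. JC x * (ennreal (indicator {0<..R} \<rho> * (\<rho> ^ DIM('n) / (\<rho> * ln 2)) * indicator annulus k) * (JG (x + \<rho> *\<^sub>R k) * h (X x, X (x + \<rho> *\<^sub>R k)))) \<partial>lborel \<partial>lborel \<partial>lborel)"
  proof (rule nn_integral_cong)
    fix x :: 'n
    have "(\<integral>\<^sup>+y. wt R (norm (y - x)) * (JG y * h (X x, X y)) \<partial>lborel) =
       (\<integral>\<^sup>+\<rho>. \<integral>\<^sup>+k. ennreal (indicator {0<..R} \<rho> * (\<rho> ^ DIM('n) / (\<rho> * ln 2)) * indicator annulus k) * (JG (x + \<rho> *\<^sub>R k) * h (X x, X (x + \<rho> *\<^sub>R k))) \<partial>lborel \<partial>lborel)"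
      by (rule nn_integral_fat_polar) measurable
    then show "JC x * (\<integral>\<^sup>+y. wt R (norm (y - x)) * (JG y * h (X x, X y)) \<partial>lborel) =
      (\<integral>\<^sup>+\<rho>. \<integral>\<^sup>+k. JC x * (ennreal (indicator {0<..R} \<rho> * (\<rho> ^ DIM('n) / (\<rho> * ln 2)) * indicator annulus k) * (JG (x + \<rho> *\<^sub>R k) * h (X x, X (x + \<rho> *\<^sub>R k)))) \<partial>lborel \<partial>lborel)"
      by (simp add: nn_integral_cmult)
  qed
  also have "\<dots> = (\<integral>\<^sup>+\<rho>. \<integral>\<^sup>+x. \<integral>\<^sup>+k. JC x * (ennreal (indicator {0<..R} \<rho> * (\<rho> ^ DIM('n) / (\<rho> * ln 2)) * indicator annulus k) * (JG (x + \<rho> *\<^sub>R k) * h (X x, X (x + \<rho> *\<^sub>R k)))) \<partial>lborel \<partial>lborel \<partial>lborel)"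
    by (rule lborel_pair.Fubini') measurable
  also have "\<dots> = (\<integral>\<^sup>+\<rho>. \<integral>\<^sup>+x. \<integral>\<^sup>+k. ennreal (blow_wt i (\<rho>, x, k)) * h (blow_map i (\<rho>, x, k)) \<partial>lborel \<partial>lborel \<partial>lborel)"
  proof (intro nn_integral_cong)
    fix \<rho> :: real and x k :: 'n
    have a: "0 \<le> indicator {0<..R} \<rho> * (\<rho> ^ DIM('n) / (\<rho> * ln 2)) * (indicator annulus k :: real)" by (auto simp: indicator_def)
    note b = real_density_nonneg[OF i core_V[OF i], of x] real_density_nonneg[OF i GV(1), of "x + \<rho> *\<^sub>R k"]
    show "JC x * (ennreal (indicator {0<..R} \<rho> * (\<rho> ^ DIM('n) / (\<rho> * ln 2)) * indicator annulus k) * (JG (x + \<rho> *\<^sub>R k) * h (X x, X (x + \<rho> *\<^sub>R k)))) =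
      ennreal (blow_wt i (\<rho>, x, k)) * h (blow_map i (\<rho>, x, k))"
      unfolding blow_wt_def blow_map_def fst_conv snd_conv R_def[symmetric] G_def[symmetric] X_def[symmetric]
        ennreal_mult[OF a mult_nonneg_nonneg[OF b]] ennreal_mult[OF b] JC_def JG_def
      by (simp only: mult_ac)
  qed
  also have "\<dots> = (\<integral>\<^sup>+\<rho>. \<integral>\<^sup>+q. ennreal (blow_wt i (\<rho>, q)) * h (blow_map i (\<rho>, q)) \<partial>lborel \<partial>lborel)"
  proof (rule nn_integral_cong)
    fix \<rho> :: real
    have "(\<lambda>q :: 'n \<times> 'n. (\<rho>, q)) \<in> borel \<rightarrow>\<^sub>M borel" by (intro borel_measurable_continuous_onI continuous_intros)
    from measurable_compose[OF this blow_wt_measurable[OF i]] measurable_compose[OF measurable_compose[OF this blow_map_measurable[OF i]] h]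
    have "(\<lambda>q. ennreal (blow_wt i (\<rho>, q)) * h (blow_map i (\<rho>, q))) \<in> borel_measurable (lborel \<Otimes>\<^sub>M lborel)"
      by (simp add: lborel_prod)
    from lborel.nn_integral_fst[OF this]
    show "(\<integral>\<^sup>+x. \<integral>\<^sup>+k. ennreal (blow_wt i (\<rho>, x, k)) * h (blow_map i (\<rho>, x, k)) \<partial>lborel \<partial>lborel) = (\<integral>\<^sup>+q. ennreal (blow_wt i (\<rho>, q)) * h (blow_map i (\<rho>, q)) \<partial>lborel)"
      by (simp add: lborel_prod)
  qed
  also have "\<dots> = (\<integral>\<^sup>+z. ennreal (blow_wt i z) * h (blow_map i z) \<partial>lborel)"
  proof -
    from blow_wt_measurable[OF i] measurable_compose[OF blow_map_measurable[OF i] h]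
    have "(\<lambda>z. ennreal (blow_wt i z) * h (blow_map i z)) \<in> borel_measurable (lborel \<Otimes>\<^sub>M lborel)" by (simp add: lborel_prod)
    from lborel.nn_integral_fst[OF this] show ?thesis by (simp add: lborel_prod)
  qed
  finally show ?thesis .
qed

lemma integral_near:
  assumes i: "i < m" and s: "Re s \<ge> 4"
  shows "(\<integral>p. near_wt i p *\<^sub>R pair_kern M s p \<partial>area2) = of_real (1 / ln 2) * chart_ball.diag_term M (\<phi> i) (\<epsilon> i) (core i) s"
proof -
  interpret cb: chart_ball M "V i" "\<phi> i" "c i" "\<epsilon> i" by (rule chart_ball[OF i])
  note mW = near_wt_measurable[OF i] and mT = blow_wt_measurable[OF i] and mP = blow_map_measurable[OF i]
  let ?L = "lborel :: (real \<times> 'n \<times> 'n) measure"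
  \<comment> \<open>For indicator functions \<open>nn_integral_near\<close> says that the weighted
    measure is a push-forward, and this carries over the complex integral.\<close>
  have eq: "density area2 (\<lambda>p. ennreal (near_wt i p)) = distr (density ?L (\<lambda>z. ennreal (blow_wt i z))) borel (blow_map i)"
  proof (rule measure_eqI)
    fix A assume "A \<in> sets (density area2 (\<lambda>p. ennreal (near_wt i p)))"
    then have A: "A \<in> sets borel" by (simp only: sets_density sets_area2)
    have "emeasure (density area2 (\<lambda>p. ennreal (near_wt i p))) A = (\<integral>\<^sup>+p. ennreal (near_wt i p) * indicator A p \<partial>area2)"
    proof (rule emeasure_density)
      show "A \<in> sets area2" by (simp only: sets_area2 A)
    qed (use mW in simp)
    also have "\<dots> = (\<integral>\<^sup>+z. ennreal (blow_wt i z) * indicator A (blow_map i z) \<partial>lborel)"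
      using A by (intro nn_integral_near[OF i]) auto
    also have "\<dots> = emeasure (distr (density ?L (\<lambda>z. ennreal (blow_wt i z))) borel (blow_map i)) A"
      using A mT mP measurable_sets[OF mP A]
      by (subst emeasure_distr) (auto simp: emeasure_density indicator_def intro!: nn_integral_cong)
    finally show "emeasure (density area2 (\<lambda>p. ennreal (near_wt i p))) A = emeasure (distr (density ?L (\<lambda>z. ennreal (blow_wt i z))) borel (blow_map i)) A" .
  qed (simp only: sets_density sets_distr sets_area2)
  define K where "K = pair_kern M s"
  have mK: "K \<in> borel_measurable borel" by (simp add: K_def)
  have mKP: "(\<lambda>z. K (blow_map i z)) \<in> borel_measurable ?L" using measurable_compose[OF mP mK] by simp
  have "integrable area2 (\<lambda>p. near_wt i p *\<^sub>R K p)"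
    unfolding K_def by (rule integrable_weighted_kern[OF s mW, of 1]) (use near_wt_bounds in auto)
  then have "integrable (density area2 (\<lambda>p. ennreal (near_wt i p))) K"
    using mK mW near_wt_bounds by (subst integrable_density) auto
  then have "integrable (density ?L (\<lambda>z. ennreal (blow_wt i z))) (\<lambda>z. K (blow_map i z))"
    unfolding eq using mP mK by (subst (asm) integrable_distr_eq) auto
  then have int: "integrable ?L (\<lambda>z. blow_wt i z *\<^sub>R K (blow_map i z))"
    using mKP mT blow_wt_nonneg[OF i] by (subst (asm) integrable_density) auto
  have "(\<integral>p. near_wt i p *\<^sub>R K p \<partial>area2) = (\<integral>p. K p \<partial>density area2 (\<lambda>p. ennreal (near_wt i p)))"
    using mK mW near_wt_bounds by (subst integral_density) auto
  also have "\<dots> = (\<integral>z. K (blow_map i z) \<partial>density ?L (\<lambda>z. ennreal (blow_wt i z)))"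
    unfolding eq using mP mK by (subst integral_distr) auto
  also have "\<dots> = (\<integral>z. blow_wt i z *\<^sub>R K (blow_map i z) \<partial>?L)"
    using mKP mT blow_wt_nonneg[OF i] by (subst integral_density) auto
  also have "\<dots> = (\<integral>\<rho>. \<integral>q. blow_wt i (\<rho>, q) *\<^sub>R K (blow_map i (\<rho>, q)) \<partial>lborel \<partial>lborel)"
  proof -
    have "integrable ((lborel :: real measure) \<Otimes>\<^sub>M (lborel :: ('n \<times> 'n) measure)) (\<lambda>z. blow_wt i z *\<^sub>R K (blow_map i z))"
      using int by (simp only: lborel_prod)
    from lborel_pair.integral_fst'[OF this] show ?thesis by (simp only: lborel_prod)
  qed
  also have "\<dots> = (\<integral>\<rho>. of_real (1 / ln 2) * (indicator {0<..\<epsilon> i / 4} \<rho> *\<^sub>R (of_real \<rho> powr (s + of_real (real DIM('n) - 4) - 1) *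
      (\<integral>q. indicator (core i \<times> annulus) q *\<^sub>R ((\<Sum>j<3. kpoly j s * of_real (blow_coef M (\<phi> i) j q \<rho>)) * exp (s * of_real (blow_dist (\<phi> i) q \<rho>))) \<partial>lborel))) \<partial>lborel)"
  proof (rule Bochner_Integration.integral_cong[OF refl])
    fix \<rho> :: real
    define S where "S q = (\<Sum>j<3. kpoly j s * of_real (blow_coef M (\<phi> i) j q \<rho>)) * exp (s * of_real (blow_dist (\<phi> i) q \<rho>))" for q
    show "(\<integral>q. blow_wt i (\<rho>, q) *\<^sub>R K (blow_map i (\<rho>, q)) \<partial>lborel) =
       of_real (1 / ln 2) * (indicator {0<..\<epsilon> i / 4} \<rho> *\<^sub>R (of_real \<rho> powr (s + of_real (real DIM('n) - 4) - 1) *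
      (\<integral>q. indicator (core i \<times> annulus) q *\<^sub>R ((\<Sum>j<3. kpoly j s * of_real (blow_coef M (\<phi> i) j q \<rho>)) * exp (s * of_real (blow_dist (\<phi> i) q \<rho>))) \<partial>lborel)))"
      unfolding S_def[symmetric]
    proof (cases "\<rho> \<in> {0<..\<epsilon> i / 4}")
      case False
      then show "(\<integral>q. blow_wt i (\<rho>, q) *\<^sub>R K (blow_map i (\<rho>, q)) \<partial>lborel) = of_real (1 / ln 2) * (indicator {0<..\<epsilon> i / 4} \<rho> *\<^sub>R (of_real \<rho> powr (s + of_real (real DIM('n) - 4) - 1) *
         (\<integral>q. indicator (core i \<times> annulus) q *\<^sub>R S q \<partial>lborel)))" by (simp add: blow_wt_def)
    next
      case True
      have \<rho>: "\<rho> > 0" "\<rho> \<in> cb.J" using True eps(1)[OF i] by auto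
      \<comment> \<open>Degree count: \<open>\<rho> ^ DIM('n) / \<rho>\<close> from the blow-up
        times \<open>\<rho> powr (s - 4)\<close> from the kernel gives the Mellin exponent with
        \<open>a = DIM('n) - 4\<close>.\<close>
      have pw: "of_real (\<rho> ^ DIM('n) / (\<rho> * ln 2)) * (of_real \<rho> powr (s - 4)) = of_real (1 / ln 2) * (of_real \<rho> powr (s + of_real (real DIM('n) - 4) - 1) :: complex)"
      proof -
        have "of_real \<rho> powr (s + of_real (real DIM('n) - 4) - 1) = of_real \<rho> powr ((s - 4) + of_nat DIM('n) - 1)"
          by (simp add: algebra_simps)
        also have "\<dots> = of_real \<rho> powr (s - 4) * of_real \<rho> ^ DIM('n) / (of_real \<rho> :: complex)"
          using \<rho>(1) powr_complexpow[of "of_real \<rho>" "DIM('n)"]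
          unfolding powr_diff[of _ "s - 4 + of_nat DIM('n)" 1] powr_add[of _ "s - 4" "of_nat DIM('n)"] by simp
        finally have e: "of_real \<rho> powr (s + of_real (real DIM('n) - 4) - 1) = of_real \<rho> powr (s - 4) * of_real \<rho> ^ DIM('n) / (of_real \<rho> :: complex)" .
        show ?thesis unfolding e by (simp add: divide_inverse)
      qed
      have "blow_wt i (\<rho>, q) *\<^sub>R K (blow_map i (\<rho>, q)) = (of_real (1 / ln 2) * of_real \<rho> powr (s + of_real (real DIM('n) - 4) - 1)) * (indicator (core i \<times> annulus) q *\<^sub>R S q)" for q
      proof (cases "q \<in> core i \<times> annulus")
        case True
        then have q: "q \<in> cb.P0" using core_ball[of i] by (force simp: subset_iff)
        have x: "fst q \<in> core i" "snd q \<in> annulus" using True by auto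
        note V = cb.in_V[OF q \<rho>(2)]
        have w: "blow_wt i (\<rho>, q) = \<rho> ^ DIM('n) / (\<rho> * ln 2) * (area_density (\<phi> i) (fst q) * area_density (\<phi> i) (fst q + \<rho> *\<^sub>R snd q))"
          using \<open>\<rho> \<in> {0<..\<epsilon> i / 4}\<close> x V(3) by (simp add: blow_wt_def)
        have k: "K (blow_map i (\<rho>, q)) * of_real (area_density (\<phi> i) (fst q) * area_density (\<phi> i) (fst q + \<rho> *\<^sub>R snd q)) = of_real \<rho> powr (s - 4) * S q"
          using cb.kern_blow[OF q \<rho>(2,1), of s] V(1,2) by (simp add: K_def pair_kern_def blow_map_def chart_ext_def S_def)
        have "blow_wt i (\<rho>, q) *\<^sub>R K (blow_map i (\<rho>, q)) = of_real (\<rho> ^ DIM('n) / (\<rho> * ln 2)) * (K (blow_map i (\<rho>, q)) * of_real (area_density (\<phi> i) (fst q) * area_density (\<phi> i) (fst q + \<rho> *\<^sub>R snd q)))"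
          unfolding w scaleR_conv_of_real of_real_mult[of "\<rho> ^ DIM('n) / (\<rho> * ln 2)"] by (simp only: mult_ac)
        also have "\<dots> = (of_real (\<rho> ^ DIM('n) / (\<rho> * ln 2)) * of_real \<rho> powr (s - 4)) * S q" unfolding k by (simp only: mult.assoc)
        finally show ?thesis unfolding pw using True by simp
      next
        case False
        then have "blow_wt i (\<rho>, q) = 0" by (auto simp: blow_wt_def mem_Times_iff)
        with False show ?thesis by simp
      qed
      then have "(\<integral>q. blow_wt i (\<rho>, q) *\<^sub>R K (blow_map i (\<rho>, q)) \<partial>lborel) = (of_real (1 / ln 2) * of_real \<rho> powr (s + of_real (real DIM('n) - 4) - 1)) * (\<integral>q. indicator (core i \<times> annulus) q *\<^sub>R S q \<partial>lborel)"
        by (simp only: integral_mult_right_zero)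
      with True show "(\<integral>q. blow_wt i (\<rho>, q) *\<^sub>R K (blow_map i (\<rho>, q)) \<partial>lborel) = of_real (1 / ln 2) * (indicator {0<..\<epsilon> i / 4} \<rho> *\<^sub>R (of_real \<rho> powr (s + of_real (real DIM('n) - 4) - 1) *
         (\<integral>q. indicator (core i \<times> annulus) q *\<^sub>R S q \<partial>lborel)))" by (simp add: mult.assoc)
    qed
  qed
  also have "\<dots> = of_real (1 / ln 2) * cb.diag_term (core i) s"
    unfolding cb.diag_term_def mellin_def by (rule integral_mult_right_zero)
  finally show ?thesis unfolding K_def .
qed

text \<open>Excludes that another sheet of \<open>M\<close> comes close to the chart ball. Otherwise
  there would be \<open>x n\<close> and \<open>v n\<close> with the distance of
  \<open>\<phi> i (x n)\<close> and \<open>v n\<close> tending to 0; along a subsequence both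
  converge to some \<open>\<phi> i l\<close>, and continuity of the inverse chart brings the
  coordinates together.\<close>

lemma near_separation:
  assumes i: "i < m" and R: "R > 0"
  shows "\<exists>\<delta>>0. \<forall>x\<in>cball (c i) (\<epsilon> i). \<forall>v\<in>M. dist (\<phi> i x) v < \<delta> \<longrightarrow> (\<exists>y\<in>V i. v = \<phi> i y \<and> norm (y - x) < R)"
proof (rule ccontr)
  assume neg: "\<not> ?thesis"
  have "\<exists>x v. x \<in> cball (c i) (\<epsilon> i) \<and> v \<in> M \<and> dist (\<phi> i x) v < inverse (real (Suc n)) \<and> (\<forall>y\<in>V i. v = \<phi> i y \<longrightarrow> \<not> norm (y - x) < R)" for n
  proof -
    have "inverse (real (Suc n)) > 0" by simp
    with neg show ?thesis by blast
  qed
  then obtain x v where x: "\<And>n. x n \<in> cball (c i) (\<epsilon> i)" and v: "\<And>n. v n \<in> M" and d: "\<And>n. dist (\<phi> i (x n)) (v n) < inverse (real (Suc n))"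
    and bad: "\<And>n y. y \<in> V i \<Longrightarrow> v n = \<phi> i y \<Longrightarrow> \<not> norm (y - x n) < R"
    by metis
  obtain l r where l: "l \<in> cball (c i) (\<epsilon> i)" and r: "strict_mono (r :: nat \<Rightarrow> nat)" and lim: "(x \<circ> r) \<longlonglongrightarrow> l"
    using compact_cball[of "c i" "\<epsilon> i"] x unfolding compact_def by metis
  have cV: "cball (c i) (\<epsilon> i) \<subseteq> V i" using cball_V[OF i] eps(1)[OF i] by (force simp: subset_iff)
  have lV: "l \<in> V i" using l cV by blast
  have "isCont (\<phi> i) l" using local_paramD(5)[OF param[OF i]] local_paramD(1)[OF param[OF i]] lV by (simp add: continuous_on_eq_continuous_at)
  then have \<phi>x: "(\<lambda>n. \<phi> i (x (r n))) \<longlonglongrightarrow> \<phi> i l" using isCont_tendsto_compose[OF _ lim] by (simp add: o_def)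
  have "(\<lambda>n. inverse (real (Suc (r n)))) \<longlonglongrightarrow> 0"
    using LIMSEQ_subseq_LIMSEQ[OF LIMSEQ_inverse_real_of_nat r] by (simp add: o_def)
  then have "(\<lambda>n. dist (\<phi> i (x (r n))) (v (r n))) \<longlonglongrightarrow> 0"
    by (rule tendsto_sandwich[OF _ _ tendsto_const, rotated 2]) (use d in \<open>auto intro!: always_eventually less_imp_le\<close>)
  then have vl: "(\<lambda>n. v (r n)) \<longlonglongrightarrow> \<phi> i l"
  proof -
    assume "(\<lambda>n. dist (\<phi> i (x (r n))) (v (r n))) \<longlonglongrightarrow> 0"
    from tendsto_add[OF this iffD1[OF tendsto_dist_iff \<phi>x]]
    have "(\<lambda>n. dist (\<phi> i (x (r n))) (v (r n)) + dist (\<phi> i (x (r n))) (\<phi> i l)) \<longlonglongrightarrow> 0" by simp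
    then have "(\<lambda>n. dist (v (r n)) (\<phi> i l)) \<longlonglongrightarrow> 0"
      by (rule tendsto_sandwich[OF _ _ tendsto_const, rotated 2]) (auto intro!: always_eventually dist_triangle3)
    then show ?thesis by (rule iffD2[OF tendsto_dist_iff])
  qed
  obtain U where U: "open U" "\<phi> i ` V i = M \<inter> U" using local_paramD(6)[OF param[OF i]] by blast
  have "\<phi> i l \<in> U" using U lV by blast
  then have "\<forall>\<^sub>F n in sequentially. v (r n) \<in> U" using vl U(1) by (simp add: topological_tendstoD)
  then have ev: "\<forall>\<^sub>F n in sequentially. v (r n) \<in> \<phi> i ` V i" by eventually_elim (use v U in auto)
  have "(\<lambda>n. inv_into (V i) (\<phi> i) (v (r n))) \<longlonglongrightarrow> inv_into (V i) (\<phi> i) (\<phi> i l)"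
    by (rule continuous_on_tendsto_compose[OF local_paramD(4)[OF param[OF i]] vl _ ev]) (use lV in auto)
  then have "(\<lambda>n. inv_into (V i) (\<phi> i) (v (r n))) \<longlonglongrightarrow> l" using lV local_paramD(3)[OF param[OF i]] by simp
  from tendsto_diff[OF this lim] have "(\<lambda>n. inv_into (V i) (\<phi> i) (v (r n)) - x (r n)) \<longlonglongrightarrow> 0" by (simp add: o_def)
  then have "\<forall>\<^sub>F n in sequentially. dist (inv_into (V i) (\<phi> i) (v (r n)) - x (r n)) 0 < R" using R by (rule tendstoD)
  with ev have "\<forall>\<^sub>F n in sequentially. False"
  proof eventually_elim
    case (elim n)
    with bad[of "inv_into (V i) (\<phi> i) (v (r n))" "r n"] show ?case by (auto simp: inv_into_into f_inv_into_f)
  qed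
  then show False by simp
qed

text \<open>Exactly one piece contains \<open>u\<close>, and the other weights are 0. For that piece
  \<open>near_separation\<close> puts \<open>v\<close> at coordinate distance less than
  \<open>\<epsilon> i / 4\<close>, where \<open>wt\<close> is 1.\<close>

lemma near_wt_sum:
  "\<exists>\<delta>>0. \<forall>u\<in>M. \<forall>v\<in>M. u \<noteq> v \<longrightarrow> dist u v < \<delta> \<longrightarrow> (\<Sum>i<m. near_wt i (u, v)) = 1"
proof -
  have "\<forall>i\<in>{..<m}. \<exists>\<delta>>0. \<forall>x\<in>cball (c i) (\<epsilon> i). \<forall>v\<in>M. dist (\<phi> i x) v < \<delta> \<longrightarrow> (\<exists>y\<in>V i. v = \<phi> i y \<and> norm (y - x) < \<epsilon> i / 4)"
  proof
    fix i assume "i \<in> {..<m}"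
    then show "\<exists>\<delta>>0. \<forall>x\<in>cball (c i) (\<epsilon> i). \<forall>v\<in>M. dist (\<phi> i x) v < \<delta> \<longrightarrow> (\<exists>y\<in>V i. v = \<phi> i y \<and> norm (y - x) < \<epsilon> i / 4)"
      by (intro near_separation) (use eps(1) in auto)
  qed
  from bchoice[OF this] obtain d where d0: "\<forall>i\<in>{..<m}. d i > 0 \<and> (\<forall>x\<in>cball (c i) (\<epsilon> i). \<forall>v\<in>M. dist (\<phi> i x) v < d i \<longrightarrow>
      (\<exists>y\<in>V i. v = \<phi> i y \<and> norm (y - x) < \<epsilon> i / 4))" by blast
  then have d: "\<And>i. i < m \<Longrightarrow> d i > 0"
    "\<And>i x v. i < m \<Longrightarrow> x \<in> cball (c i) (\<epsilon> i) \<Longrightarrow> v \<in> M \<Longrightarrow> dist (\<phi> i x) v < d i \<Longrightarrow> \<exists>y\<in>V i. v = \<phi> i y \<and> norm (y - x) < \<epsilon> i / 4"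
    by (blast intro: lessThan_iff[THEN iffD2])+
  \<comment> \<open>The 1 keeps the minimum meaningful when the atlas is empty.\<close>
  define \<delta> where "\<delta> = Min (insert 1 (d ` {..<m}))"
  have \<delta>: "\<delta> > 0" "\<And>i. i < m \<Longrightarrow> \<delta> \<le> d i" using d(1) by (auto simp: \<delta>_def)
  have "(\<Sum>i<m. near_wt i (u, v)) = 1" if u: "u \<in> M" and v: "v \<in> M" and uv: "u \<noteq> v" "dist u v < \<delta>" for u v
  proof -
    obtain i where i: "i < m" "u \<in> piece i" using u Union_piece by blast
    then obtain x where x: "x \<in> core i" "u = \<phi> i x" using image_core[of i] by auto
    have xb: "x \<in> ball (c i) (\<epsilon> i)" using x core_ball by blast
    have "dist (\<phi> i x) v < d i" using uv x \<delta>(2)[OF i(1)] by simp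
    then obtain y where y: "y \<in> V i" "v = \<phi> i y" "norm (y - x) < \<epsilon> i / 4" using d(2)[OF i(1) _ v, of x] xb by auto
    have xV: "x \<in> V i" using x core_V[OF i(1)] by blast
    have "norm (y - x) > 0" using uv x y by auto
    then have "wt (\<epsilon> i / 4) (norm (y - x)) = 1" using y(3) by (intro wt_eq_1) auto
    moreover have "y \<in> patch i"
      using xb y(3) eps(1)[OF i(1)] norm_triangle_ineq4[of "c i - x" "y - x"] by (simp add: dist_norm)
    ultimately have one: "near_wt i (u, v) = 1"
      using i(2) y x cinv_chart[OF i(1) xV] cinv_chart[OF i(1) y(1)] by (simp add: near_wt_def)
    have zero: "near_wt j (u, v) = 0" if "j \<in> {..<m} - {i}" for j
      using disjoint_family_onD[OF piece_disjoint, of i j] i that by (auto simp: near_wt_def indicator_def)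
    show ?thesis using sum.remove[of "{..<m}" i "\<lambda>i. near_wt i (u, v)"] i(1) one zero by simp
  qed
  with \<delta>(1) show ?thesis by blast
qed

text \<open>By \<open>near_wt_sum\<close> the remaining weight vanishes close to the diagonal, and
  on the diagonal the kernel is 0. So only distances between \<open>\<delta>\<close> and
  \<open>D\<close> count, where the kernel is entire in \<open>s\<close> and locally uniformly
  bounded.\<close>

lemma far_term:
  "\<exists>g. g holomorphic_on UNIV \<and> (\<forall>s. Re s \<ge> 4 \<longrightarrow> g s = (\<integral>p. (1 - (\<Sum>i<m. near_wt i p)) *\<^sub>R pair_kern M s p \<partial>area2))"
proof -
  obtain \<delta> where \<delta>: "\<delta> > 0" "\<And>u v. u \<in> M \<Longrightarrow> v \<in> M \<Longrightarrow> u \<noteq> v \<Longrightarrow> dist u v < \<delta> \<Longrightarrow> (\<Sum>i<m. near_wt i (u, v)) = 1"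
    using near_wt_sum by blast
  obtain D where D: "D \<ge> 1" "\<And>u v. u \<in> M \<Longrightarrow> v \<in> M \<Longrightarrow> norm (v - u) \<le> D" using diameter by blast
  define Far where "Far = (M \<times> M) \<inter> {p. \<delta> \<le> dist (fst p) (snd p)}"
  have Far: "Far \<in> sets borel" unfolding Far_def
    by (intro sets.Int borel_closed closed_Times closed_M closed_Collect_le continuous_intros)
  define W where "W p = 1 - (\<Sum>i<m. near_wt i p)" for p
  have mW: "W \<in> borel_measurable borel" unfolding W_def using near_wt_measurable by (intro borel_measurable_diff borel_measurable_sum) auto
  have bW: "\<bar>W p\<bar> \<le> 1 + real m" for p
  proof -
    have "0 \<le> (\<Sum>i<m. near_wt i p)" using near_wt_bounds by (intro sum_nonneg) auto
    moreover have "(\<Sum>i<m. near_wt i p) \<le> (\<Sum>i<m. 1)" using near_wt_bounds by (intro sum_mono) auto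
    ultimately show ?thesis by (simp add: W_def abs_if)
  qed
  have mIW: "(\<lambda>p. indicator Far p * W p) \<in> borel_measurable borel" using Far mW by auto
  define g where "g s = (\<integral>p. (indicator Far p * W p) *\<^sub>R pair_kern M s p \<partial>area2)" for s
  have "g s = (\<integral>p. W p *\<^sub>R pair_kern M s p \<partial>area2)" for s
    unfolding g_def
  proof (rule integral_cong_AE)
    show "(\<lambda>p. (indicator Far p * W p) *\<^sub>R pair_kern M s p) \<in> borel_measurable area2" "(\<lambda>p. W p *\<^sub>R pair_kern M s p) \<in> borel_measurable area2"
      using mW mIW by (auto intro!: borel_measurable_scaleR)
    show "AE p in area2. (indicator Far p * W p) *\<^sub>R pair_kern M s p = W p *\<^sub>R pair_kern M s p"
      using AE_area2
    proof eventually_elim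
      case (elim p)
      obtain u v where p: "p = (u, v)" by (cases p)
      show ?case
      proof (cases "p \<in> Far")
        case False
        with elim p have "u \<in> M" "v \<in> M" "dist u v < \<delta>" by (auto simp: Far_def)
        then have "u = v \<or> W p = 0" using \<delta>(2)[of u v] by (auto simp: W_def p)
        moreover have "pair_kern M s (u, u) = 0" by (simp add: pair_kern_def kern_def)
        ultimately show ?thesis using False by (auto simp: p)
      qed simp
    qed
  qed
  moreover have "g holomorphic_on UNIV"
    unfolding g_def
  proof (rule holomorphic_on_lebesgue_integral)
    show "(\<lambda>s. (indicator Far p * W p) *\<^sub>R pair_kern M s p) holomorphic_on UNIV" for p
      unfolding scaleR_conv_of_real pair_kern_def by (intro holomorphic_intros kern_holomorphic)
    show "(\<lambda>p. (indicator Far p * W p) *\<^sub>R pair_kern M s p) \<in> borel_measurable area2" for s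
      using mIW by (auto intro!: borel_measurable_scaleR)
    fix s :: complex
    have "continuous_on (cball s 1) (kbound TYPE('a))" unfolding kbound_def[abs_def]
      by (intro continuous_intros holomorphic_on_imp_continuous_on holomorphic_on_subset[OF kpoly_holomorphic]) auto
    from compact_imp_bounded[OF compact_continuous_image[OF this compact_cball]]
    obtain k where k: "\<And>t. t \<in> cball s 1 \<Longrightarrow> kbound TYPE('a) t \<le> k"
      unfolding bounded_iff by (metis imageI real_norm_def abs_le_D1)
    have k0: "0 \<le> k" using k[of s] kbound_nonneg[where 'a='a, of s] by simp
    define L where "L = max \<bar>ln \<delta>\<bar> \<bar>ln D\<bar>"
    \<comment> \<open>On the unit disc around \<open>s\<close> the absolute value of
      \<open>Re t - 4\<close> is at most \<open>norm s + 5\<close>, and \<open>L\<close> bounds the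
      logarithm of every distance that occurs in \<open>Far\<close>.\<close>
    define B where "B = (1 + real m) * (k * exp ((norm s + 5) * L))"
    have "norm ((indicator Far p * W p) *\<^sub>R pair_kern M t p) \<le> B" if t: "t \<in> cball s 1" for p t
    proof (cases "p \<in> Far")
      case True
      then have p: "fst p \<in> M" "snd p \<in> M" "\<delta> \<le> norm (snd p - fst p)" by (auto simp: Far_def dist_norm norm_minus_commute)
      have ne: "snd p - fst p \<noteq> 0" using p(3) \<delta>(1) by auto
      have "ln \<delta> \<le> ln (norm (snd p - fst p))" "ln (norm (snd p - fst p)) \<le> ln D"
        using p \<delta>(1) D(2)[OF p(1,2)] D(1) by (auto intro!: ln_mono)
      then have l: "\<bar>ln (norm (snd p - fst p))\<bar> \<le> L" unfolding L_def by linarith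
      have "\<bar>Re t - 4\<bar> \<le> norm s + 5"
        using abs_Re_le_cmod[of t] norm_triangle_ineq2[of t s] t by (simp add: dist_norm norm_minus_commute)
      then have "\<bar>(Re t - 4) * ln (norm (snd p - fst p))\<bar> \<le> (norm s + 5) * L" unfolding abs_mult using l by (intro mult_mono) auto
      then have e: "exp ((Re t - 4) * ln (norm (snd p - fst p))) \<le> exp ((norm s + 5) * L)" by simp
      have "norm (pair_kern M t p) \<le> kbound TYPE('a) t * exp ((Re t - 4) * ln (norm (snd p - fst p)))"
        unfolding pair_kern_def nproj_def by (rule kern_bound[OF normal_basis(1) normal_basis(1) ne])
      also have "\<dots> \<le> k * exp ((norm s + 5) * L)" by (rule mult_mono[OF k[OF t] e k0]) simp
      finally have "norm (pair_kern M t p) \<le> k * exp ((norm s + 5) * L)" .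
      then have "\<bar>W p\<bar> * norm (pair_kern M t p) \<le> B" unfolding B_def using bW[of p] by (intro mult_mono) auto
      with True show ?thesis by simp
    qed (use k0 in \<open>simp add: B_def\<close>)
    moreover have "integrable area2 (\<lambda>p. B)" using finite_measure.integrable_const[OF finite_measure_area2] .
    ultimately show "\<exists>r>0. \<exists>h. cball s r \<subseteq> UNIV \<and> integrable area2 h \<and> (\<forall>p\<in>space area2. \<forall>t\<in>cball s r. norm ((indicator Far p * W p) *\<^sub>R pair_kern M t p) \<le> h p)"
      by (intro exI[of _ 1] exI[of _ "\<lambda>p. B"]) auto
  qed simp
  ultimately show ?thesis unfolding W_def by blast
qed

text \<open>For \<open>Re s > 4\<close> all terms of the decomposition are integrable, so the beta
  function is the far term plus the diagonal terms, each of which has been continued. The factor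
  \<open>1 / ln 2\<close> is the normalisation of the radial average.\<close>

lemma coaxial_beta_continuation:
  "\<exists>f. simple_poles_in {- of_real (real DIM('n) - 4) - 2 * of_nat j | j. True} f \<and> (\<forall>s. 4 < Re s \<longrightarrow> f s = coaxial_beta TYPE('n) M s)"
proof -
  let ?S = "{- of_real (real DIM('n) - 4) - 2 * of_nat j | j. True} :: complex set"
  have "\<forall>i\<in>{..<m}. \<exists>f. simple_poles_in ?S f \<and> (\<forall>s. Re s > 4 - real DIM('n) \<longrightarrow> f s = chart_ball.diag_term M (\<phi> i) (\<epsilon> i) (core i) s)"
  proof
    fix i assume "i \<in> {..<m}"
    then have i: "i < m" by simp
    have "core i \<subseteq> cball (c i) (\<epsilon> i)" using core_ball[of i] by (force simp: subset_iff)
    from chart_ball.diag_term_continuation[OF chart_ball[OF i] eps(2)[OF i] core_borel[OF i] this]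
    show "\<exists>f. simple_poles_in ?S f \<and> (\<forall>s. Re s > 4 - real DIM('n) \<longrightarrow> f s = chart_ball.diag_term M (\<phi> i) (\<epsilon> i) (core i) s)" .
  qed
  from bchoice[OF this] obtain f where f: "\<And>i. i < m \<Longrightarrow> simple_poles_in ?S (f i)"
    "\<And>i s. i < m \<Longrightarrow> Re s > 4 - real DIM('n) \<Longrightarrow> f i s = chart_ball.diag_term M (\<phi> i) (\<epsilon> i) (core i) s" by auto
  obtain g where g: "g holomorphic_on UNIV" "\<And>s. Re s \<ge> 4 \<Longrightarrow> g s = (\<integral>p. (1 - (\<Sum>i<m. near_wt i p)) *\<^sub>R pair_kern M s p \<partial>area2)"
    using far_term by blast
  define F where "F s = (\<Sum>i<m. of_real (1 / ln 2) * f i s) + g s" for s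
  have "simple_poles_in ?S (\<lambda>s. \<Sum>i<m. of_real (1 / ln 2) * f i s)"
    by (intro simple_poles_in_sum simple_poles_in_mult f(1)) (auto intro: analytic_on_const)
  moreover have "simple_poles_in ?S g" using g(1) by (intro simple_poles_in_analytic) (simp add: analytic_on_open)
  ultimately have "simple_poles_in ?S F" unfolding F_def by (rule simple_poles_in_add)
  moreover have "F s = coaxial_beta TYPE('n) M s" if s: "4 < Re s" for s
  proof -
    have s4: "Re s \<ge> 4" using s by simp
    have int: "integrable area2 (\<lambda>p. near_wt i p *\<^sub>R pair_kern M s p)" if "i < m" for i
      by (rule integrable_weighted_kern[OF s4 near_wt_measurable[OF that], of 1]) (use near_wt_bounds in auto)
    have int0: "integrable area2 (pair_kern M s)" using integrable_weighted_kern[OF s4, of "\<lambda>_. 1" 1] by simp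
    have "g s = (\<integral>p. pair_kern M s p - (\<Sum>i<m. near_wt i p *\<^sub>R pair_kern M s p) \<partial>area2)"
      unfolding g(2)[OF s4] by (simp add: scaleR_left.sum scaleR_left_diff_distrib scaleR_sum_left)
    also have "\<dots> = coaxial_beta TYPE('n) M s - (\<Sum>i<m. \<integral>p. near_wt i p *\<^sub>R pair_kern M s p \<partial>area2)"
      unfolding coaxial_beta_eq[OF s4] using int int0 by (subst Bochner_Integration.integral_diff) (auto intro!: Bochner_Integration.integral_sum)
    also have "(\<Sum>i<m. \<integral>p. near_wt i p *\<^sub>R pair_kern M s p \<partial>area2) = (\<Sum>i<m. of_real (1 / ln 2) * f i s)"
      using s by (intro sum.cong refl) (auto simp: integral_near[OF _ s4] f(2))
    finally show ?thesis by (simp add: F_def)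
  qed
  ultimately show ?thesis by blast
qed

end

theorem theorem3p1:
  fixes M :: "'a::euclidean_space set"
  assumes "DIM('n::euclidean_space) < DIM('a)"
    and "smooth_submanifold TYPE('n) M"
    and "compact M"
  shows "\<exists>f. f meromorphic_on UNIV \<and>
             f analytic_on (UNIV - {- of_nat DIM('n) - of_int j | j::int. j \<ge> -4 \<and> even j}) \<and>
             (\<forall>s. 4 < Re s \<longrightarrow> f s = coaxial_beta TYPE('n) M s) \<and>
             (\<forall>z. is_pole f z \<longrightarrow>
                  z \<in> {- of_nat DIM('n) - of_int j | j::int. j \<ge> -4 \<and> even j} \<and> zorder f z = -1)"
proof -
  let ?T = "{- of_nat DIM('n) - of_int j | j::int. j \<ge> -4 \<and> even j} :: complex set"
  from atlas_exists[OF assms(2,3)] obtain m V and \<phi> :: "nat \<Rightarrow> 'n \<Rightarrow> 'a" and c \<epsilon> where "atlas M m V \<phi> c \<epsilon>" by blast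
  from atlas.coaxial_beta_continuation[OF this] obtain f where
    f: "simple_poles_in {- of_real (real DIM('n) - 4) - 2 * of_nat j | j. True} f" "\<And>s. 4 < Re s \<Longrightarrow> f s = coaxial_beta TYPE('n) M s" by blast
  have "{- of_real (real DIM('n) - 4) - 2 * of_nat j | j. True} \<subseteq> ?T"
  proof
    fix z :: complex assume "z \<in> {- of_real (real DIM('n) - 4) - 2 * of_nat j | j. True}"
    then obtain j where "z = - of_real (real DIM('n) - 4) - 2 * of_nat j" by blast
    \<comment> \<open>With \<open>a = DIM('n) - 4\<close> the pole of index \<open>j\<close> is
      \<open>- DIM('n) - (2 j - 4)\<close>, so the even integers from -4 on appear.\<close>
    then have "z = - of_nat DIM('n) - of_int (2 * int j - 4)" by simp
    then show "z \<in> ?T" by (intro CollectI exI[of _ "2 * int j - 4"]) auto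
  qed
  from simple_poles_in_mono[OF f(1) this] have "simple_poles_in ?T f" .
  from simple_poles_inD[OF this] f(2) show ?thesis by blast
qed

end
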